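(* Let $\lambda>0$ be real and let $n\ge2$ and $1\le K\le n-1$ be integers. Define $A_K(n,\lambda)$ by \[ \begin{aligned} b_n(-\lambda)=\;&\frac{(-1)^n\Gamma(n+\frac12)(\lambda+1)^{2n+1}}{\left(\frac12\pi|\lambda+\log\lambda+1+\pi i|\right)^{\frac12}|\lambda+\log\lambda+1+\pi i|^n}\\ &\times\left(\sum_{k=0}^{K-1}(-1)^k|\lambda+\log\lambda+1+\pi i|^k\gamma_k\frac{\Gamma(n-k+\frac12)}{\Gamma(n+\frac12)}\sin\left(\left(n-k+\tfrac12\right)\omega\right)+A_K(n,\lambda)\right). \end{aligned} \] Then \[ A_K(n,\lambda)=\frac{|\lambda+\log\lambda+1+\pi i|^{n+\frac12}}{2i\,\Gamma(n+\frac12)}\int_0^{+\infty}t^{n-\frac12}e^{-t|\lambda+\log\lambda+1+\pi i|}\left(e^{(n+\frac12)\omega i}M_K(te^{i\omega})-e^{-(n+\frac12)\omega i}M_K(te^{-i\omega})\right)dt, \] and the following bounds hold. (1) If $\lambda\ge W(e^{\pi-1})$, then \[ |A_K(n,\lambda)|\le|\lambda+\log\lambda+1+\pi i|^K|\gamma_K|\frac{\Gamma(n-K+\frac12)}{\Gamma(n+\frac12)}+|\lambda+\log\lambda+1+\pi i|^{K+1}|\gamma_{K+1}|\frac{\Gamma(n-K-\frac12)}{\Gamma(n+\frac12)}. \] (2) For every $\lambda>0$, if $K\ge2$, then \[ |A_K(n,\lambda)|\le\frac12\left(\frac{\sec(\omega-\varphi^\ast)}{\cos^K\varphi^\ast}+1\right)|\lambda+\log\lambda+1+\pi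 i|^K\,\frac1\pi\,\frac{\zeta(K)\Gamma(K)}{(2\pi)^K}\,\frac{\Gamma(n-K+\frac12)}{\Gamma(n+\frac12)}, \] where $\varphi^\ast$ is the unique solution of the equation $(K+1)\sin(\omega-2\varphi^\ast)=(K-1)\sin\omega$ that satisfies $-\frac\pi2+\omega<\varphi^\ast<\frac\pi2$ if $\frac\pi2\le\omega<\pi$, and $0<\varphi^\ast<\omega$ if $0<\omega<\frac\pi2$.
   Context: For $\lambda>0$, $\omega=\omega(\lambda)=\arg(\lambda+\log\lambda+1+\pi i)\in(0,\pi)$. $W$ is the principal branch of the Lambert $W$-function; $\lambda\ge W(e^{\pi-1})$ corresponds to $0<\omega\le\frac\pi4$. $\zeta$ is the Riemann zeta function. The coefficients are \[ b_n(-\lambda)=(\lambda+1)^n\left[\frac{d^n}{dt^n}\left(\frac{(\lambda+1)t}{\lambda e^t+t-\lambda}\right)^{n+1}\right]_{t=0}, \] where the function in the bracket takes the value $1$ at its removable singularity $t=0$. The scaled gamma function is $\Gamma^\ast(z)=\Gamma(z)/(\sqrt{2\pi}\,z^{z-\frac12}e^{-z})$ for $|\arg z|<\pi$ (principal values). The Stirling coefficients $\gamma_n$ are defined by the asymptotic expansion $\Gamma^\ast(z)\sim\sum_{n=0}^\infty(-1)^n\gamma_n z^{-n}$ as $z\to+\infty$, and for $K\ge1$ and $|\arg z|<\pi$ the remainder $M_K(z)$ is defined by \[ \Gamma^\ast(z)=\sum_{n=0}^{K-1}(-1)^n\frac{\gamma_n}{z^n}+M_K(z). \] *)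

theory Defs
  imports "HOL-Analysis.Analysis" "HOL-Library.Landau_Symbols"
begin

definition Lambda :: "real \<Rightarrow> complex" where
  "Lambda l = complex_of_real (l + ln l + 1) + complex_of_real pi * \<i>"

definition omega :: "real \<Rightarrow> real" where
  "omega l = Arg (Lambda l)"

text \<open>\<open>b_neg n l\<close> stands for \<open>b_n(-l)\<close>. For \<open>l > 0\<close> the denominator vanishes, on the
  real line, only at \<open>t = 0\<close>, so the real function below is smooth.\<close>

definition b_neg :: "nat \<Rightarrow> real \<Rightarrow> real" where
  "b_neg n l = (l + 1) ^ n *
     (deriv ^^ n)
       (\<lambda>t. (if t = 0 then 1 else (l + 1) * t / (l * exp t + t - l)) ^ (n + 1)) 0"

definition Gamma_star :: "complex \<Rightarrow> complex" where
  "Gamma_star z =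
     Gamma z / (complex_of_real (sqrt (2 * pi)) * z powr (z - 1 / 2) * exp (- z))"

text \<open>The Poincare asymptotic expansion of the scaled gamma function along the positive reals;
  it determines its coefficients uniquely.\<close>

definition stirling_expansion :: "(nat \<Rightarrow> real) \<Rightarrow> bool" where
  "stirling_expansion g \<longleftrightarrow>
     (\<forall>N. (\<lambda>x::real. Gamma_star (of_real x)
              - (\<Sum>n\<le>N. (-1) ^ n * of_real (g n) / of_real x ^ n))
          \<in> o[at_top](\<lambda>x. 1 / of_real x ^ N))"

definition stirling_coeff :: "nat \<Rightarrow> real" where
  "stirling_coeff = (THE g. stirling_expansion g)"

definition stirling_remainder :: "nat \<Rightarrow> complex \<Rightarrow> complex" where
  "stirling_remainder K z =
     Gamma_star z - (\<Sum>n<K. (-1) ^ n * of_real (stirling_coeff n) / z ^ n)"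

text \<open>The principal real branch, intended for \<open>x \<ge> - exp (- 1)\<close>.\<close>

definition Lambert_W :: "real \<Rightarrow> real" where
  "Lambert_W x = (THE w. - 1 \<le> w \<and> w * exp w = x)"

text \<open>The Riemann zeta function on its half-line of convergence \<open>s > 1\<close>.\<close>

definition zeta :: "real \<Rightarrow> real" where
  "zeta s = (\<Sum>m. 1 / real (Suc m) powr s)"

definition is_phi_star :: "nat \<Rightarrow> real \<Rightarrow> real \<Rightarrow> bool" where
  "is_phi_star K w p \<longleftrightarrow>
     (real K + 1) * sin (w - 2 * p) = (real K - 1) * sin w \<and>
     (pi / 2 \<le> w \<and> w < pi \<longrightarrow> - pi / 2 + w < p \<and> p < pi / 2) \<and>
     (0 < w \<and> w < pi / 2 \<longrightarrow> 0 < p \<and> p < w)"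

definition phi_star :: "nat \<Rightarrow> real \<Rightarrow> real" where
  "phi_star K w = (THE p. is_phi_star K w p)"

end

theory Submission
  imports Defs "HOL-Complex_Analysis.Complex_Analysis" "HOL-Real_Asymp.Real_Asymp"
begin

text \<open>
  Two representations carry the proof.

  First, Cauchy's formula writes \<open>b_n(-l)\<close> as the integral of \<open>1 / f^(n+1)\<close>, where
  \<open>f y = l e^y + y - l\<close>, around the boundary of the strip \<open>|Im y| \<le> pi\<close>, in which \<open>f\<close> vanishes
  only at \<open>0\<close>. Writing \<open>1 / f^(n+1)\<close> as a Laplace integral in a variable \<open>s\<close> and swapping the
  integrals turns the integral over \<open>Im y = pi\<close> into a Gamma integral in \<open>e^y\<close>; what remains is
  the integral of \<open>s^(n-1/2) Gamma_star(s) e^(-s cnj L)\<close>, \<open>L = Lambda l\<close>, over a ray. The angle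
  \<open>omega / 2\<close> makes both integrals converge absolutely for every \<open>l > 0\<close>; afterwards the ray is
  rotated to the angle \<open>omega\<close>.

  Second, \<open>Gamma_star(w)\<close> near the right half-plane and \<open>1 / Gamma_star(-w)\<close> near the left one are
  analytic and tend to \<open>1\<close>, and by the reflection formula they differ on the separating rays by
  \<open>Gamma_star(w) e^(\<plusminus> 2 pi i w)\<close>. Cauchy's formula on both sides therefore expresses \<open>Gamma_star\<close>
  through these jumps. The upper separating ray may be turned by any angle \<open>phi\<close> in \<open>[0, pi/2)\<close>.
  Expanding the Cauchy kernel geometrically gives the remainders \<open>M_K\<close>. For \<open>phi = 0\<close> the real and
  imaginary parts of \<open>Gamma_star(i s)\<close> have constant sign, which yields the first bound; for
  \<open>phi = phi_star\<close> the estimate \<open>|Gamma_star| \<ge> 1\<close> in the right half-plane yields the second.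
\<close>

section \<open>Contour shifts in horizontal strips\<close>

text \<open>\<open>Lambda l\<close> belongs to the critical point -ln l + pi i of f, where f takes
  the value -cnj (Lambda l). On the line Im y = pi and for |alpha| < pi/2, the largest value of Re
  (e^(i alpha) f) is -|Lambda l| cos (omega - alpha). The Laplace integral along the ray of angle
  alpha thus requires |omega - alpha| < pi/2, and the Gamma integral in e^y requires |alpha| < pi/2.
  In the second representation the unturned upper ray lies on the imaginary axis, so a point with
  omega >= pi/2 is not inside the right-hand sector until the ray is turned. Turning by phi costs
  two factors: sec (omega - phi) for the distance of the point from the ray, and 1 / cos^K phi
  because e^(2 pi i w) decays only like e^(-2 pi |w| cos phi). \<open>phi_star\<close> is the
  stationary point of this product. The first bound keeps phi = 0 and adds the two kernels before
  estimating, which works while omega <= pi/4.\<close>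

lemma contour_integral_linepath_same_Im:
  assumes "c < d"
  shows "contour_integral (linepath (Complex c a) (Complex d a)) f =
           integral {c..d} (\<lambda>x. f (Complex x a))"
proof -
  have "contour_integral (linepath (Complex c a) (Complex d a)) f =
         of_real (d - c) * integral {0..1} (\<lambda>x. f (linepath (Complex c a) (Complex d a) x))"
    by (simp add: contour_integral_integral Complex_eq)
  also have "integral {0..1} (\<lambda>x. f (linepath (Complex c a) (Complex d a) x)) =
             integral {0..(d - c) / (d - c)} (\<lambda>x. f (Complex (c + (d - c) * x) a))"
    using \<open>c < d\<close> by (simp add: linepath_def Complex_eq scaleR_conv_of_real algebra_simps)
  also have "{0..(d - c) / (d - c)} = (\<lambda>x. x / (d - c)) ` {0..d - c}"
    using \<open>c < d\<close> by simp
  also have "integral \<dots> (\<lambda>x. f (Complex (c + (d - c) * x) a)) =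
             integral {c-c..d-c} (\<lambda>x. f (Complex (x + c) a)) / of_real (d - c)"
    using \<open>c < d\<close> by (subst integral_stretch_real) (auto simp: scaleR_conv_of_real add_ac)
  also have "\<dots> = integral {c..d} (\<lambda>x. f (Complex x a)) / of_real (d - c)"
    by (subst integral_shift_real_ivl) (rule refl)
  finally show ?thesis
    using \<open>c < d\<close> by simp
qed

text \<open>Dominated convergence with |f| as majorant. It turns the limits of rectangle integrals
  into Lebesgue integrals over whole lines, for which Fubini and norm estimates are
  available.\<close>

lemma tendsto_integral_symmetric:
  fixes f :: "real \<Rightarrow> complex"
  assumes "integrable lborel f"
  shows "((\<lambda>R. integral {-R..R} f) \<longlongrightarrow> (LINT x|lborel. f x)) at_top"
proof -
  have "((\<lambda>R. LINT x|lborel. indicator {-R..R} x *\<^sub>R f x) \<longlongrightarrow> (LINT x|lborel. f x)) at_top"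
  proof (rule integral_dominated_convergence_at_top[where w = "\<lambda>x. norm (f x)"])
    show "AE x in lborel. ((\<lambda>R. indicator {-R..R} x *\<^sub>R f x) \<longlongrightarrow> f x) at_top"
    proof (rule AE_I2)
      fix x :: real
      have "eventually (\<lambda>R. indicator {-R..R} x *\<^sub>R f x = f x) at_top"
        using eventually_ge_at_top[of "\<bar>x\<bar>"] by eventually_elim (auto simp: indicator_def)
      thus "((\<lambda>R. indicator {-R..R} x *\<^sub>R f x) \<longlongrightarrow> f x) at_top"
        by (rule tendsto_eventually)
    qed
  qed (use assms in \<open>auto simp: indicator_def\<close>)
  moreover have "(LINT x|lborel. indicator {-R..R} x *\<^sub>R f x) = integral {-R..R} f" for R
  proof -
    have "set_integrable lborel {-R..R} f"
      using assms unfolding set_integrable_def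
      by (rule integrable_mult_indicator[rotated]) auto
    from set_borel_integral_eq_integral(2)[OF this] show ?thesis
      by (simp add: set_lebesgue_integral_def)
  qed
  ultimately show ?thesis by simp
qed

lemma contour_integral_vertical_bound:
  assumes "a < b" "continuous_on (closed_segment (Complex c a) (Complex c b)) h"
    and "\<And>y. a \<le> y \<Longrightarrow> y \<le> b \<Longrightarrow> norm (h (Complex c y)) \<le> B"
  shows "norm (contour_integral (linepath (Complex c a) (Complex c b)) h) \<le> B * (b - a)"
proof -
  have "B \<ge> 0"
    using assms(1) assms(3)[of a] norm_ge_zero[of "h (Complex c a)"] by linarith
  have "norm (contour_integral (linepath (Complex c a) (Complex c b)) h)
          \<le> B * norm (Complex c b - Complex c a)"
  proof (intro contour_integral_bound_linepath contour_integrable_continuous_linepath)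
    fix z assume "z \<in> closed_segment (Complex c a) (Complex c b)"
    hence "z = Complex c (Im z)" "a \<le> Im z" "Im z \<le> b"
      using assms(1) by (auto simp: closed_segment_same_Re closed_segment_eq_real_ivl complex_eq_iff)
    thus "norm (h z) \<le> B" using assms(3)[of "Im z"] by simp
  qed (use assms \<open>B \<ge> 0\<close> in auto)
  also have "norm (Complex c b - Complex c a) = b - a"
    using assms(1) by (simp add: cmod_def)
  finally show ?thesis .
qed

text \<open>The residue theorem on the rectangle [-R, R] x [a, b]: the majorant \<open>g\<close>
  makes the vertical sides vanish as R grows, and integrability on the two horizontal lines makes
  the truncated integrals converge.\<close>

lemma strip_residue:
  fixes h :: "complex \<Rightarrow> complex"
  assumes ab: "a < b" and U: "open U" "\<And>z. a \<le> Im z \<Longrightarrow> Im z \<le> b \<Longrightarrow> z \<in> U"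
    and holo: "h holomorphic_on U - {p}" and p: "a < Im p" "Im p < b"
    and bound: "\<And>x y. a \<le> y \<Longrightarrow> y \<le> b \<Longrightarrow> X \<le> \<bar>x\<bar> \<Longrightarrow> norm (h (Complex x y)) \<le> g x"
    and g: "(g \<longlongrightarrow> 0) at_top" "(g \<longlongrightarrow> 0) at_bot"
    and int: "integrable lborel (\<lambda>x. h (Complex x a))" "integrable lborel (\<lambda>x. h (Complex x b))"
  shows "(LINT x|lborel. h (Complex x a)) - (LINT x|lborel. h (Complex x b)) =
           2 * pi * \<i> * residue h p"
proof -
  \<comment> \<open>Beyond \<open>X0\<close> the vertical sides miss the pole and the majorant
    applies.\<close>
  define X0 where "X0 = max (max X 1) (\<bar>Re p\<bar> + 1)"
  define V1 where "V1 R = contour_integral (linepath (Complex R a) (Complex R b)) h" for R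
  have cont: "continuous_on (closed_segment (Complex R a) (Complex R b)) h" if "\<bar>R\<bar> \<ge> X0" for R
    by (rule continuous_on_subset[OF holomorphic_on_imp_continuous_on[OF holo]])
       (use that U(2) ab in \<open>auto simp: closed_segment_same_Re closed_segment_eq_real_ivl X0_def\<close>)
  have V1b: "norm (V1 R) \<le> g R * (b - a)" if "\<bar>R\<bar> \<ge> X0" for R
    unfolding V1_def using that
    by (intro contour_integral_vertical_bound ab cont bound) (auto simp: X0_def)
  have eq: "integral {-R..R} (\<lambda>x. h (Complex x a)) - integral {-R..R} (\<lambda>x. h (Complex x b)) +
             V1 R - V1 (-R) = 2 * pi * \<i> * residue h p" if R: "R \<ge> X0" for R
  proof -
    have R0: "R > 0" using R by (auto simp: X0_def)
    let ?a1 = "Complex (-R) a" and ?a3 = "Complex R b"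
    have sub: "cbox ?a1 ?a3 \<subseteq> U"
      using U(2) by (auto simp: in_cbox_complex_iff)
    obtain e where e: "e > 0" "(\<Union>x\<in>cbox ?a1 ?a3. ball x e) \<subseteq> U"
      using compact_subset_open_imp_ball_epsilon_subset[OF compact_cbox U(1) sub] .
    \<comment> \<open>\<open>U\<close> need not be connected, so the residue theorem is applied on
      an e-neighbourhood of the box. Written as box plus ball, it is a sum of convex sets, hence
      convex.\<close>
    define S where "S = (\<Union>x\<in>cbox ?a1 ?a3. ball x e)"
    have S_eq: "S = (\<Union>x\<in>cbox ?a1 ?a3. \<Union>y\<in>ball 0 e. {x + y})"
    proof (rule set_eqI, rule iffI)
      fix z assume "z \<in> S"
      then obtain x where x: "x \<in> cbox ?a1 ?a3" "z \<in> ball x e" by (auto simp: S_def)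
      hence "z - x \<in> ball 0 e" by (auto simp: dist_norm norm_minus_commute)
      thus "z \<in> (\<Union>x\<in>cbox ?a1 ?a3. \<Union>y\<in>ball 0 e. {x + y})"
        by (intro UN_I[OF x(1)] UN_I[of "z - x"]) auto
    next
      fix z assume "z \<in> (\<Union>x\<in>cbox ?a1 ?a3. \<Union>y\<in>ball 0 e. {x + y})"
      then obtain x y where xy: "x \<in> cbox ?a1 ?a3" "y \<in> ball 0 e" "z = x + y" by blast
      thus "z \<in> S" unfolding S_def by (intro UN_I[OF xy(1)]) (simp add: dist_norm)
    qed
    have "convex S" unfolding S_eq by (intro convex_sums convex_box convex_ball)
    hence "connected S" by (rule convex_connected)
    have "open S" unfolding S_def by auto
    have cS: "cbox ?a1 ?a3 \<subseteq> S" unfolding S_def using \<open>e > 0\<close> by force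
    have pbox: "p \<in> box ?a1 ?a3"
      using R p by (auto simp: in_box_complex_iff X0_def abs_le_iff)
    have pi_sub: "path_image (rectpath ?a1 ?a3) \<subseteq> S - {p}"
      using path_image_rectpath_subset_cbox[of ?a1 ?a3] path_image_rectpath_inter_box[of ?a1 ?a3]
        cS pbox R0 ab by fastforce
    have "contour_integral (rectpath ?a1 ?a3) h =
            2 * pi * \<i> * (\<Sum>q\<in>{p}. winding_number (rectpath ?a1 ?a3) q * residue h q)"
    proof (rule Residue_theorem[of S])
      show "h holomorphic_on S - {p}"
        by (rule holomorphic_on_subset[OF holo]) (use e in \<open>auto simp: S_def\<close>)
      show "\<forall>z. z \<notin> S \<longrightarrow> winding_number (rectpath ?a1 ?a3) z = 0"
        using cS R0 ab by (auto intro!: winding_number_rectpath_outside)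
    qed (use \<open>open S\<close> \<open>connected S\<close> pi_sub in auto)
    also have "\<dots> = 2 * pi * \<i> * residue h p"
      using pbox by (simp add: winding_number_rectpath)
    also have "contour_integral (rectpath ?a1 ?a3) h =
       contour_integral (linepath (Complex (-R) a) (Complex R a)) h + V1 R
       + contour_integral (linepath (Complex R b) (Complex (-R) b)) h
       + contour_integral (linepath (Complex (-R) b) (Complex (-R) a)) h"
    proof -
      have c: "h contour_integrable_on linepath u v"
        if "closed_segment u v \<subseteq> path_image (rectpath ?a1 ?a3)" for u v
        by (rule contour_integrable_continuous_linepath,
            rule continuous_on_subset[OF holomorphic_on_imp_continuous_on[OF holo]])
           (use that pi_sub e in \<open>auto simp: S_def\<close>)
      have pim: "path_image (rectpath ?a1 ?a3) =
           closed_segment (Complex (-R) a) (Complex R a) \<union> closed_segment (Complex R a) (Complex R b)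
           \<union> closed_segment (Complex R b) (Complex (-R) b) \<union> closed_segment (Complex (-R) b) (Complex (-R) a)"
        by (simp add: rectpath_def Let_def path_image_join Un_assoc)
      have "h contour_integrable_on linepath (Complex (-R) a) (Complex R a)"
        "h contour_integrable_on linepath (Complex R a) (Complex R b)"
        "h contour_integrable_on linepath (Complex R b) (Complex (-R) b)"
        "h contour_integrable_on linepath (Complex (-R) b) (Complex (-R) a)"
        by (rule c; simp add: pim; blast)+
      thus ?thesis
        by (simp add: rectpath_def Let_def V1_def contour_integrable_joinI)
    qed
    also have "contour_integral (linepath (Complex R b) (Complex (-R) b)) h =
                 - contour_integral (linepath (Complex (-R) b) (Complex R b)) h"
    proof (rule contour_integral_reverse_linepath)
      show "continuous_on (closed_segment (Complex R b) (Complex (-R) b)) h"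
        by (rule continuous_on_subset[OF holomorphic_on_imp_continuous_on[OF holo]])
           (use U(2) p ab in \<open>auto simp: closed_segment_same_Im\<close>)
    qed
    also have "contour_integral (linepath (Complex (-R) b) (Complex (-R) a)) h = - V1 (-R)"
      unfolding V1_def using R R0
      by (subst contour_integral_reverse_linepath)
         (auto simp: closed_segment_commute X0_def intro!: cont)
    finally show ?thesis using R0
      by (simp add: contour_integral_linepath_same_Im algebra_simps)
  qed
  have V_lim: "(V1 \<longlongrightarrow> 0) at_top"
  proof (rule Lim_null_comparison)
    show "eventually (\<lambda>R. norm (V1 R) \<le> g R * (b - a)) at_top"
      using eventually_ge_at_top[of X0] eventually_ge_at_top[of 0]
      by eventually_elim (auto intro!: V1b)
    show "((\<lambda>R. g R * (b - a)) \<longlongrightarrow> 0) at_top"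
      using tendsto_mult_right[OF g(1), of "b - a"] by simp
  qed
  have V_lim': "((\<lambda>R. V1 (-R)) \<longlongrightarrow> 0) at_top"
  proof (rule Lim_null_comparison)
    show "eventually (\<lambda>R. norm (V1 (-R)) \<le> g (-R) * (b - a)) at_top"
      using eventually_ge_at_top[of X0] eventually_ge_at_top[of 0]
      by eventually_elim (auto intro!: V1b)
    have "((\<lambda>R. g (-R)) \<longlongrightarrow> 0) at_top"
      using g(2) by (simp add: filterlim_at_bot_mirror)
    from tendsto_mult_right[OF this, of "b - a"]
    show "((\<lambda>R. g (-R) * (b - a)) \<longlongrightarrow> 0) at_top" by simp
  qed
  have "((\<lambda>R. integral {-R..R} (\<lambda>x. h (Complex x a)) - integral {-R..R} (\<lambda>x. h (Complex x b)) +
             V1 R - V1 (-R)) \<longlongrightarrow>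
         (LINT x|lborel. h (Complex x a)) - (LINT x|lborel. h (Complex x b)) + 0 - 0) at_top"
    by (intro tendsto_intros tendsto_integral_symmetric int V_lim V_lim')
  moreover have "((\<lambda>R. integral {-R..R} (\<lambda>x. h (Complex x a)) - integral {-R..R} (\<lambda>x. h (Complex x b)) +
             V1 R - V1 (-R)) \<longlongrightarrow> 2 * pi * \<i> * residue h p) at_top"
    by (rule tendsto_eventually) (rule eventually_mono[OF eventually_ge_at_top[of X0] eq])
  ultimately have "(LINT x|lborel. h (Complex x a)) - (LINT x|lborel. h (Complex x b)) + 0 - 0 =
      2 * pi * \<i> * residue h p"
    by (rule tendsto_unique[OF trivial_limit_at_top_linorder])
  thus ?thesis by simp
qed

corollary strip_shift:
  fixes h :: "complex \<Rightarrow> complex"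
  assumes ab: "a \<le> b" and U: "open U" "\<And>z. a \<le> Im z \<Longrightarrow> Im z \<le> b \<Longrightarrow> z \<in> U"
    and holo: "h holomorphic_on U"
    and bound: "\<And>x y. a \<le> y \<Longrightarrow> y \<le> b \<Longrightarrow> X \<le> \<bar>x\<bar> \<Longrightarrow> norm (h (Complex x y)) \<le> g x"
    and g: "(g \<longlongrightarrow> 0) at_top" "(g \<longlongrightarrow> 0) at_bot"
    and int: "integrable lborel (\<lambda>x. h (Complex x a))" "integrable lborel (\<lambda>x. h (Complex x b))"
  shows "(LINT x|lborel. h (Complex x a)) = (LINT x|lborel. h (Complex x b))"
proof (cases "a = b")
  case False
  \<comment> \<open>Any point inside the strip serves: \<open>h\<close> is holomorphic there, so its
    residue is 0.\<close>
  define p where "p = Complex 0 ((a + b) / 2)"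
  have p: "a < Im p" "Im p < b" using ab False by (auto simp: p_def)
  have "residue h p = 0"
    by (rule residue_holo[OF U(1) _ holo]) (use U(2) p in auto)
  moreover have "h holomorphic_on U - {p}" using holo by (rule holomorphic_on_subset) auto
  ultimately show ?thesis
    using strip_residue[OF _ U _ p bound g int] ab False by simp
qed auto

text \<open>Bridge between two notions of integral: the facts on Euler's integral and on change of
  variables speak of \<open>absolutely_integrable_on\<close>, the rest of the proof of Lebesgue
  integrals. For Borel measurable functions, completing the measure changes nothing.\<close>

lemma absolutely_integrable_iff_lborel:
  fixes f :: "real \<Rightarrow> real"
  assumes "A \<in> sets borel" "set_borel_measurable borel A f"
  shows "f absolutely_integrable_on A \<longleftrightarrow> set_integrable lborel A f"
  using assms unfolding set_integrable_def set_borel_measurable_def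
  by (subst integrable_completion) auto

lemma exp_substitution_real:
  fixes F :: "real \<Rightarrow> real"
  assumes "continuous_on {0<..} F"
  shows "set_integrable lborel {0<..} F \<longleftrightarrow> integrable lborel (\<lambda>x. exp x * F (exp x))"
    and "(LINT t:{0<..}|lborel. F t) = (LINT x|lborel. exp x * F (exp x))"
proof -
  have img: "exp ` (UNIV :: real set) = {0<..}"
  proof safe
    fix x :: real assume "x > 0"
    thus "x \<in> range exp" by (intro image_eqI[of _ _ "ln x"]) auto
  qed auto
  have m1: "set_borel_measurable borel {0<..} F"
    using assms unfolding set_borel_measurable_def by (intro borel_measurable_continuous_on_indicator) auto
  have "continuous_on UNIV (\<lambda>x. exp x * F (exp x))"
    by (intro continuous_intros continuous_on_compose2[OF assms]) auto
  hence m2: "(\<lambda>x. exp x * F (exp x)) \<in> borel_measurable borel"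
    by (rule borel_measurable_continuous_onI)
  have m2': "set_borel_measurable borel UNIV (\<lambda>x. exp x * F (exp x))"
    using m2 by (simp add: set_borel_measurable_def)
  \<comment> \<open>The value b is left free: taking it equal to the integral on either side yields
    both implications for integrability, and afterwards the equality of the integrals.\<close>
  have iff: "(\<lambda>x. \<bar>exp x\<bar> * F (exp x)) absolutely_integrable_on UNIV \<and>
        integral UNIV (\<lambda>x. \<bar>exp x\<bar> * F (exp x)) = b \<longleftrightarrow>
        F absolutely_integrable_on exp ` UNIV \<and> integral (exp ` UNIV) F = b" for b
    by (rule has_absolute_integral_change_of_variables_1') (auto intro!: derivative_eq_intros inj_onI)
  have 1: "set_integrable lborel {0<..} F \<longleftrightarrow> F absolutely_integrable_on {0<..}"
    using absolutely_integrable_iff_lborel[OF _ m1] by simp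
  have 2: "integrable lborel (\<lambda>x. exp x * F (exp x)) \<longleftrightarrow>
             (\<lambda>x. exp x * F (exp x)) absolutely_integrable_on UNIV"
    using absolutely_integrable_iff_lborel[OF _ m2'] by (simp add: set_integrable_def)
  show int: "set_integrable lborel {0<..} F \<longleftrightarrow> integrable lborel (\<lambda>x. exp x * F (exp x))"
    using iff[of "integral {0<..} F"] iff[of "integral UNIV (\<lambda>x. exp x * F (exp x))"] 1 2
    by (auto simp: img)
  show "(LINT t:{0<..}|lborel. F t) = (LINT x|lborel. exp x * F (exp x))"
  proof (cases "set_integrable lborel {0<..} F")
    case True
    hence "(LINT t:{0<..}|lborel. F t) = integral {0<..} F"
      by (rule set_borel_integral_eq_integral(2))
    moreover have "(LINT x|lborel. exp x * F (exp x)) = integral UNIV (\<lambda>x. exp x * F (exp x))"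
      using True int integral_lborel by metis
    ultimately show ?thesis
      using iff[of "integral {0<..} F"] True 1 by (auto simp: img)
  next
    case False
    moreover from False have "\<not> integrable lborel (\<lambda>x. exp x * F (exp x))" using int by simp
    ultimately show ?thesis
      by (simp add: set_integrable_def set_lebesgue_integral_def not_integrable_integral_eq)
  qed
qed

lemma integrable_complex_iff:
  fixes f :: "'a \<Rightarrow> complex"
  shows "integrable M f \<longleftrightarrow> integrable M (\<lambda>x. Re (f x)) \<and> integrable M (\<lambda>x. Im (f x))"
proof safe
  assume "integrable M (\<lambda>x. Re (f x))" "integrable M (\<lambda>x. Im (f x))"
  hence "integrable M (\<lambda>x. complex_of_real (Re (f x)) + \<i> * complex_of_real (Im (f x)))"
    by (intro Bochner_Integration.integrable_add integrable_mult_right integrable_of_real)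
  thus "integrable M f" by (simp flip: complex_eq)
qed (auto intro: integrable_Re integrable_Im)

lemma exp_substitution:
  fixes F :: "real \<Rightarrow> complex"
  assumes "continuous_on {0<..} F"
  shows "set_integrable lborel {0<..} F \<longleftrightarrow> integrable lborel (\<lambda>x. of_real (exp x) * F (exp x))"
    and "set_integrable lborel {0<..} F \<Longrightarrow>
           (LINT t:{0<..}|lborel. F t) = (LINT x|lborel. of_real (exp x) * F (exp x))"
proof -
  have c: "continuous_on {0<..} (\<lambda>t. Re (F t))" "continuous_on {0<..} (\<lambda>t. Im (F t))"
    using assms by (auto intro!: continuous_intros)
  note R = exp_substitution_real[OF c(1)] and I = exp_substitution_real[OF c(2)]
  show int: "set_integrable lborel {0<..} F \<longleftrightarrow> integrable lborel (\<lambda>x. of_real (exp x) * F (exp x))"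
    using R(1) I(1) unfolding set_integrable_def
    by (subst (1 2) integrable_complex_iff) simp
  assume F: "set_integrable lborel {0<..} F"
  hence F': "integrable lborel (\<lambda>x. of_real (exp x) * F (exp x))" using int by simp
  show "(LINT t:{0<..}|lborel. F t) = (LINT x|lborel. of_real (exp x) * F (exp x))"
    using R(2) I(2) F F'
    by (intro complex_eqI) (simp_all add: set_integrable_def set_lebesgue_integral_def
          flip: integral_Re integral_Im)
qed

section \<open>The Gamma integral and the scaled gamma function\<close>

lemma of_real_exp_powr: "complex_of_real (exp x) powr w = exp (w * of_real x)"
  by (simp add: powr_def Ln_of_real)

lemma exp_gamma_kernel_limits:
  fixes \<sigma> \<kappa> :: real
  assumes "\<sigma> > 0" "\<kappa> > 0"
  shows "((\<lambda>x. exp (\<sigma> * x - \<kappa> * exp x)) \<longlongrightarrow> 0) at_top"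
    and "((\<lambda>x. exp (\<sigma> * x - \<kappa> * exp x)) \<longlongrightarrow> 0) at_bot"
  using assms by real_asymp+

text \<open>This is Euler's integrand for Gamma in the variable x = ln t. Functions of this shape
  are the majorants for integrals along rays.\<close>

lemma integrable_exp_gamma_kernel:
  fixes \<sigma> \<kappa> :: real
  assumes "\<sigma> > 0" "\<kappa> > 0"
  shows "integrable lborel (\<lambda>x. exp (\<sigma> * x - \<kappa> * exp x))"
proof -
  define F where "F = (\<lambda>t::real. of_real t powr (of_real \<sigma> - 1) / of_real (exp (\<kappa> * t)) :: complex)"
  have cF: "continuous_on {0<..} F"
    unfolding F_def by (intro continuous_intros) auto
  have "F absolutely_integrable_on {0<..}"
    unfolding F_def using assms by (intro absolutely_integrable_Gamma_integral) auto
  moreover have "(\<lambda>x. indicator {0<..} x *\<^sub>R F x) \<in> borel_measurable borel"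
    by (intro borel_measurable_continuous_on_indicator cF) auto
  ultimately have "set_integrable lborel {0<..} F"
    unfolding set_integrable_def by (subst (asm) integrable_completion) auto
  hence "integrable lborel (\<lambda>x. of_real (exp x) * F (exp x))"
    using exp_substitution(1)[OF cF] by simp
  also have "(\<lambda>x. of_real (exp x) * F (exp x)) = (\<lambda>x. of_real (exp (\<sigma> * x - \<kappa> * exp x)))"
  proof
    fix x :: real
    show "of_real (exp x) * F (exp x) = of_real (exp (\<sigma> * x - \<kappa> * exp x))"
      unfolding F_def of_real_exp_powr unfolding exp_of_real[symmetric]
      by (simp add: algebra_simps flip: exp_add exp_diff)
  qed
  finally show ?thesis by (subst (asm) integrable_complex_iff) simp
qed

lemma Gamma_integral_exp_aux:
  assumes "Re s > 0"
  shows "(LINT x|lborel. exp (s * of_real x - of_real (exp x))) = Gamma s"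
proof -
  define F where "F = (\<lambda>t::real. of_real t powr (s - 1) / of_real (exp t) :: complex)"
  have cF: "continuous_on {0<..} F"
    unfolding F_def by (intro continuous_intros) auto
  have "F absolutely_integrable_on {0<..}"
    unfolding F_def using absolutely_integrable_Gamma_integral[OF assms zero_less_one] by simp
  moreover have "(\<lambda>x. indicator {0<..} x *\<^sub>R F x) \<in> borel_measurable borel"
    by (intro borel_measurable_continuous_on_indicator cF) auto
  ultimately have int: "set_integrable lborel {0<..} F"
    unfolding set_integrable_def by (subst (asm) integrable_completion) auto
  have "(LINT t:{0<..}|lborel. F t) = Gamma s"
    using set_borel_integral_eq_integral(2)[OF int] Gamma_integral_complex'[OF assms]
    by (simp add: F_def integral_unique)
  moreover have "of_real (exp x) * F (exp x) = exp (s * of_real x - of_real (exp x))" for x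
    unfolding F_def of_real_exp_powr unfolding exp_of_real[symmetric]
    by (simp add: algebra_simps flip: exp_add exp_diff)
  ultimately show ?thesis
    using exp_substitution(2)[OF cF int] by simp
qed

text \<open>The shift of x by Ln c leads to the line Im w = arg c, which Cauchy's theorem moves back
  to the real line: in between |Im w| <= |arg c| < pi/2, so Re (e^w) >= cos (arg c) e^x and the
  integrand keeps its decay.\<close>

lemma Gamma_integral_exp:
  fixes s c :: complex
  assumes s: "Re s > 0" and c: "Re c > 0"
  shows "integrable lborel (\<lambda>x. exp (s * of_real x - c * of_real (exp x)))"
    and "(LINT x|lborel. exp (s * of_real x - c * of_real (exp x))) = Gamma s * c powr (-s)"
proof -
  define h where "h = (\<lambda>w. exp (s * w - exp w))"
  define \<theta> where "\<theta> = Im (Ln c)"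
  have c0: "c \<noteq> 0" using c by auto
  have \<theta>: "\<bar>\<theta>\<bar> < pi / 2" using Re_Ln_pos_lt[OF c0] c by (simp add: \<theta>_def)
  define \<kappa> where "\<kappa> = cos \<theta>"
  have \<kappa>: "\<kappa> > 0" unfolding \<kappa>_def using \<theta> by (intro cos_gt_zero_pi) auto
  define B where "B = exp (\<bar>Im s\<bar> * \<bar>\<theta>\<bar>)"
  have bound: "norm (h (Complex x y)) \<le> B * exp (Re s * x - \<kappa> * exp x)"
    if "\<bar>y\<bar> \<le> \<bar>\<theta>\<bar>" for x y
  proof -
    have "\<kappa> \<le> cos y"
      unfolding \<kappa>_def using that \<theta> cos_monotone_0_pi_le[of "\<bar>y\<bar>" "\<bar>\<theta>\<bar>"] by simp
    hence 1: "\<kappa> * exp x \<le> exp x * cos y" by simp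
    have "-(Im s * y) \<le> \<bar>Im s * y\<bar>" by simp
    also have "\<dots> \<le> \<bar>Im s\<bar> * \<bar>\<theta>\<bar>" using that by (simp add: abs_mult mult_left_mono)
    finally have 2: "-(Im s * y) \<le> \<bar>Im s\<bar> * \<bar>\<theta>\<bar>" .
    have "norm (h (Complex x y)) = exp (Re s * x - Im s * y - exp x * cos y)"
      by (simp add: h_def Re_exp)
    also have "\<dots> \<le> exp (\<bar>Im s\<bar> * \<bar>\<theta>\<bar> + (Re s * x - \<kappa> * exp x))"
      unfolding exp_le_cancel_iff using 1 2 by linarith
    also have "\<dots> = B * exp (Re s * x - \<kappa> * exp x)" unfolding B_def exp_add ..
    finally show ?thesis .
  qed
  have int: "integrable lborel (\<lambda>x. h (Complex x y))" if "\<bar>y\<bar> \<le> \<bar>\<theta>\<bar>" for y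
  proof (rule Bochner_Integration.integrable_bound)
    show "integrable lborel (\<lambda>x. B * exp (Re s * x - \<kappa> * exp x))"
      using integrable_exp_gamma_kernel[OF s \<kappa>] by simp
    have "continuous_on UNIV (\<lambda>x. h (Complex x y))"
      unfolding h_def Complex_eq by (intro continuous_intros)
    thus "(\<lambda>x. h (Complex x y)) \<in> borel_measurable lborel"
      using borel_measurable_continuous_onI by auto
    show "AE x in lborel. norm (h (Complex x y)) \<le> norm (B * exp (Re s * x - \<kappa> * exp x))"
      using bound[OF that] by (auto simp: B_def)
  qed
  have lim: "((\<lambda>x. B * exp (Re s * x - \<kappa> * exp x)) \<longlongrightarrow> 0) at_top"
            "((\<lambda>x. B * exp (Re s * x - \<kappa> * exp x)) \<longlongrightarrow> 0) at_bot"
    using exp_gamma_kernel_limits[OF s \<kappa>, THEN tendsto_mult_left, of B] by simp_all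
  \<comment> \<open>arg c may have either sign, so the two lines are ordered by min and max.\<close>
  have "(LINT x|lborel. h (Complex x (min 0 \<theta>))) = (LINT x|lborel. h (Complex x (max 0 \<theta>)))"
  proof (rule strip_shift[where U = UNIV and X = 0 and g = "\<lambda>x. B * exp (Re s * x - \<kappa> * exp x)"])
    show "h holomorphic_on UNIV" unfolding h_def by (intro holomorphic_intros)
  qed (auto intro!: bound int lim simp: min_def max_def split: if_splits)
  hence shift: "(LINT x|lborel. h (Complex x \<theta>)) = (LINT x|lborel. h (Complex x 0))"
    by (auto simp: min_def max_def split: if_splits)
  have hx: "h (Complex (x + Re (Ln c)) \<theta>) = exp (s * of_real x - c * of_real (exp x)) * exp (s * Ln c)" for x
  proof -
    have "Complex (x + Re (Ln c)) \<theta> = of_real x + Ln c"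
      by (auto simp: complex_eq_iff \<theta>_def)
    moreover have "exp (of_real x + Ln c) = c * of_real (exp x)"
      using c0 by (simp add: exp_add exp_of_real)
    ultimately show ?thesis
      unfolding h_def by (simp add: algebra_simps exp_diff exp_add)
  qed
  have eq: "exp (s * of_real x - c * of_real (exp x)) = c powr (-s) * h (Complex (x + Re (Ln c)) \<theta>)" for x
    unfolding hx using c0 by (simp add: powr_def exp_minus)
  have shift2: "integrable lborel (\<lambda>x. h (Complex (x + Re (Ln c)) \<theta>))"
    using lborel_integrable_real_affine[OF int[of \<theta>], of 1 "Re (Ln c)"] by (simp add: add.commute)
  thus "integrable lborel (\<lambda>x. exp (s * of_real x - c * of_real (exp x)))"
    unfolding eq by simp
  have "(LINT x|lborel. h (Complex (x + Re (Ln c)) \<theta>)) = (LINT x|lborel. h (Complex x \<theta>))"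
    using lborel_integral_real_affine[of 1 "\<lambda>x. h (Complex x \<theta>)" "Re (Ln c)"]
    by (simp add: add.commute)
  also have "\<dots> = Gamma s"
    unfolding shift using Gamma_integral_exp_aux[OF s]
    by (simp add: h_def Complex_eq exp_of_real)
  finally show "(LINT x|lborel. exp (s * of_real x - c * of_real (exp x))) = Gamma s * c powr (-s)"
    unfolding eq by simp
qed

section \<open>Conjugation, reflection and behaviour at the origin of
  \<open>Gamma_star\<close>\<close>

lemma Gamma_star_cnj:
  assumes "z \<notin> \<real>\<^sub>\<le>\<^sub>0"
  shows "Gamma_star (cnj z) = cnj (Gamma_star z)"
proof -
  have "cnj z \<noteq> 0" "z \<noteq> 0" using assms by auto
  thus ?thesis
    unfolding Gamma_star_def powr_def using assms
    by (simp add: cnj_Gamma cnj_Ln exp_cnj)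
qed

lemma Gamma_star_holomorphic: "Gamma_star holomorphic_on (- \<real>\<^sub>\<le>\<^sub>0)"
proof -
  have "z \<notin> \<int>\<^sub>\<le>\<^sub>0" if "z \<notin> \<real>\<^sub>\<le>\<^sub>0" for z :: complex
    using that nonpos_Ints_subset_nonpos_Reals by blast
  moreover have "(\<lambda>z. Gamma z / (complex_of_real (sqrt (2 * pi)) * z powr (z - 1 / 2) * exp (- z)))
                   holomorphic_on (- \<real>\<^sub>\<le>\<^sub>0)"
    by (intro holomorphic_intros) (auto simp: calculation)
  ultimately show ?thesis unfolding Gamma_star_def[abs_def] by simp
qed

lemma Gamma_star_nonzero: "z \<notin> \<real>\<^sub>\<le>\<^sub>0 \<Longrightarrow> Gamma_star z \<noteq> 0"
  using nonpos_Ints_subset_nonpos_Reals by (auto simp: Gamma_star_def Gamma_eq_zero_iff)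

lemma Im_nonzero_notin_nonpos_Reals: "Im z \<noteq> 0 \<Longrightarrow> z \<notin> \<real>\<^sub>\<le>\<^sub>0"
  by (auto simp: complex_nonpos_Reals_iff)

text \<open>In the upper half-plane Ln (-z) = Ln z - pi i, so the two powers in the denominators
  multiply to i e^(pi i z) / z. Euler's reflection formula supplies the sine, and the exponentials
  combine.\<close>

lemma Gamma_star_reflection:
  assumes "Im z > 0"
  shows "Gamma_star z * Gamma_star (-z) * (1 - exp (2 * pi * \<i> * z)) = 1"
proof -
  have z0: "z \<noteq> 0" using assms by auto
  have L: "Ln (-z) = Ln z - \<i> * pi"
    using assms z0 by (subst Ln_minus) auto
  define E where "E = exp (\<i> * pi * z)"
  have E: "E \<noteq> 0" by (simp add: E_def)
  have E2: "exp (2 * pi * \<i> * z) = E * E"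
    unfolding E_def by (simp flip: exp_add add: algebra_simps)
  have sinE: "sin (of_real pi * z) = (E - 1 / E) / (2 * \<i>)"
    unfolding E_def sin_exp_eq' by (simp add: exp_minus field_simps)
  have EE: "1 - E * E \<noteq> 0"
  proof
    assume "1 - E * E = 0"
    hence "norm (E * E) = 1" by simp
    thus False using assms by (simp flip: E2)
  qed
  have P: "z powr (z - 1 / 2) * (-z) powr (-z - 1 / 2) = \<i> * E / z"
  proof -
    have "z powr (z - 1 / 2) * (-z) powr (-z - 1 / 2) =
            exp (- Ln z + \<i> * pi * z + \<i> * pi / 2)"
      using z0 by (simp add: powr_def L algebra_simps flip: exp_add)
    also have "\<dots> = exp (- Ln z) * E * exp (\<i> * of_real (pi / 2))"
      by (simp add: E_def flip: exp_add)
    also have "exp (\<i> * of_real (pi / 2)) = \<i>"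
      using cis_pi_half by (simp only: cis_conv_exp)
    also have "exp (- Ln z) = 1 / z" using z0 by (simp add: exp_minus field_simps)
    also have "1 / z * E * \<i> = \<i> * E / z" by simp
    finally show ?thesis .
  qed
  have sq: "complex_of_real (sqrt (2 * pi)) * complex_of_real (sqrt (2 * pi)) = 2 * pi"
    by (simp flip: of_real_mult)
  have "Gamma_star z * Gamma_star (-z) =
     Gamma z * Gamma (-z) / ((complex_of_real (sqrt (2 * pi)) * complex_of_real (sqrt (2 * pi))) *
       (z powr (z - 1 / 2) * (-z) powr (-z - 1 / 2)) * (exp (-z) * exp z))"
    unfolding Gamma_star_def by (simp add: mult_ac)
  also have "\<dots> = - pi / (z * sin (of_real pi * z)) / (2 * pi * (\<i> * E / z))"
    unfolding P sq Gamma_reflection_complex' by (simp flip: exp_add)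
  also have "\<dots> = 1 / (1 - E * E)"
    using z0 E EE unfolding sinE by (simp add: field_simps)
  finally show ?thesis unfolding E2 using EE by simp
qed

text \<open>On the imaginary axis -z is the conjugate of z, so the product in the reflection formula
  is a squared modulus.\<close>

lemma norm_Gamma_star_imaginary:
  assumes "s > 0"
  shows "norm (Gamma_star (\<i> * of_real s)) ^ 2 = 1 / (1 - exp (-2 * pi * s))"
proof -
  let ?z = "\<i> * complex_of_real s"
  have "Gamma_star (- ?z) = cnj (Gamma_star ?z)"
    using Gamma_star_cnj[of ?z] assms by (simp add: Im_nonzero_notin_nonpos_Reals)
  hence "Gamma_star ?z * Gamma_star (- ?z) = of_real (norm (Gamma_star ?z) ^ 2)"
    by (simp only: complex_norm_square)
  moreover have "exp (2 * pi * \<i> * ?z) = of_real (exp (-2 * pi * s))"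
  proof -
    have "2 * pi * \<i> * ?z = of_real (-2 * pi * s)" by (simp add: algebra_simps)
    thus ?thesis by (simp only: exp_of_real)
  qed
  ultimately have "complex_of_real (norm (Gamma_star ?z) ^ 2 * (1 - exp (-2 * pi * s))) = 1"
    using Gamma_star_reflection[of ?z] assms by simp
  hence "norm (Gamma_star ?z) ^ 2 * (1 - exp (-2 * pi * s)) = 1"
    using of_real_eq_1_iff by blast
  moreover have "1 - exp (-2 * pi * s) > 0" using assms by simp
  ultimately show ?thesis by (metis less_irrefl nonzero_eq_divide_eq)
qed

text \<open>The delicate part of z Ln z near 0 is |z| ln |z|; ln t <= t - 1 at t = 1 / |z| bounds it
  by 1 in modulus, and |Im (Ln z)| <= pi does the rest. So z^z contributes only a bounded factor to
  \<open>Gamma_star\<close> at the origin.\<close>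

lemma abs_Re_mult_Ln_le:
  assumes z0: "z \<noteq> 0" and nz: "norm z \<le> 1 / 2"
  shows "\<bar>Re (z * Ln z)\<bar> \<le> 1 + pi"
proof -
  define r where "r = norm z"
  have r: "r > 0" "r \<le> 1 / 2" using z0 nz by (auto simp: r_def)
  have "- ln r \<le> 1 / r - 1"
    using ln_le_minus_one[of "1 / r"] r by (simp add: ln_div)
  hence "r * (- ln r) \<le> 1" using r mult_left_mono[of "- ln r" "1 / r" r] by simp
  moreover have "ln r \<le> 0" using r by simp
  ultimately have rl: "r * \<bar>ln r\<bar> \<le> 1" by simp
  have "norm (Ln z) \<le> \<bar>Re (Ln z)\<bar> + \<bar>Im (Ln z)\<bar>" by (rule cmod_le)
  also have "\<dots> \<le> \<bar>ln r\<bar> + pi"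
    using z0 mpi_less_Im_Ln[OF z0] Im_Ln_le_pi[OF z0] by (simp add: r_def abs_le_iff)
  finally have "r * norm (Ln z) \<le> r * (\<bar>ln r\<bar> + pi)" using r by (intro mult_left_mono) auto
  also have "\<dots> \<le> 1 + pi"
  proof -
    have "r * pi \<le> 1 * pi" using r by (intro mult_right_mono) auto
    thus ?thesis unfolding distrib_left using rl by linarith
  qed
  finally show ?thesis
    using abs_Re_le_cmod[of "z * Ln z"] by (simp add: norm_mult r_def)
qed

text \<open>Writing Gamma z = Gamma (z + 1) / z takes the pole out of the Gamma function and
  exhibits the exact singularity |z|^(-1/2) at the origin.\<close>

lemma norm_Gamma_star_eq:
  assumes z: "z \<notin> \<real>\<^sub>\<le>\<^sub>0"
  shows "norm (Gamma_star z) =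
           norm (Gamma (z + 1)) * exp (Re z - Re (z * Ln z)) / (sqrt (2 * pi) * sqrt (norm z))"
proof -
  have z0: "z \<noteq> 0" using z by auto
  define r where "r = norm z"
  have r: "r > 0" using z0 by (auto simp: r_def)
  have "z \<notin> \<int>\<^sub>\<le>\<^sub>0" using z nonpos_Ints_subset_nonpos_Reals by blast
  from Gamma_plus1[OF this] have G: "Gamma z = Gamma (z + 1) / z" using z0 by simp
  define q where "q = Re (z * Ln z)"
  have "norm (z powr (z - 1 / 2)) = exp (q - ln r / 2)"
    using z0 by (simp add: powr_def algebra_simps r_def q_def)
  also have "\<dots> = exp q / sqrt r"
    using r by (simp add: exp_diff ln_sqrt[symmetric])
  finally have P: "norm (z powr (z - 1 / 2)) = exp q / sqrt r" .
  have "norm (Gamma_star z) = norm (Gamma (z + 1)) / (r * sqrt (2 * pi) * (exp q / sqrt r) * exp (- Re z))"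
    unfolding Gamma_star_def G norm_divide norm_mult P by (simp add: r_def mult_ac)
  also have "\<dots> = norm (Gamma (z + 1)) * exp (Re z - q) / (sqrt (2 * pi) * (r / sqrt r))"
    by (simp add: exp_diff exp_minus field_simps)
  also have "r / sqrt r = sqrt r" using r by (simp add: real_div_sqrt)
  finally show ?thesis by (simp add: q_def r_def)
qed

text \<open>Gamma (z + 1) is continuous on the disc of radius 1/2, which stays away from the pole at
  z = -1.\<close>

lemma Gamma_star_bound_near_0:
  obtains C where "C > 0"
    "\<And>z. z \<notin> \<real>\<^sub>\<le>\<^sub>0 \<Longrightarrow> norm z \<le> 1 / 2 \<Longrightarrow> norm (Gamma_star z) \<le> C / sqrt (norm z)"
proof -
  have "continuous_on (cball 0 (1/2)) (\<lambda>z::complex. Gamma (z + 1))"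
  proof (intro holomorphic_on_imp_continuous_on holomorphic_intros)
    fix z :: complex assume "z \<in> cball 0 (1 / 2)"
    hence "\<bar>Re z\<bar> \<le> 1 / 2" using abs_Re_le_cmod[of z] by simp
    thus "z + 1 \<notin> \<int>\<^sub>\<le>\<^sub>0" by (auto elim!: nonpos_Ints_cases simp: complex_eq_iff)
  qed
  hence "compact ((\<lambda>z::complex. Gamma (z + 1)) ` cball 0 (1/2))"
    by (intro compact_continuous_image) auto
  then obtain C where C: "C > 0" "\<And>z. norm z \<le> 1 / 2 \<Longrightarrow> norm (Gamma (z + 1 :: complex)) \<le> C"
    using compact_imp_bounded bounded_pos by (metis (no_types, lifting) dist_0_norm imageI mem_cball)
  show ?thesis
  proof (rule that)
    show "C * exp (2 + pi) / sqrt (2 * pi) > 0" using C by simp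
    fix z :: complex assume z: "z \<notin> \<real>\<^sub>\<le>\<^sub>0" and nz: "norm z \<le> 1 / 2"
    have "z \<noteq> 0" using z by auto
    from abs_Re_mult_Ln_le[OF this nz] have "Re z - Re (z * Ln z) \<le> 2 + pi"
      using abs_Re_le_cmod[of z] nz by linarith
    hence "norm (Gamma_star z) \<le> C * exp (2 + pi) / (sqrt (2 * pi) * sqrt (norm z))"
      unfolding norm_Gamma_star_eq[OF z] using C
      by (intro divide_right_mono mult_mono C(2) nz) auto
    thus "norm (Gamma_star z) \<le> C * exp (2 + pi) / sqrt (2 * pi) / sqrt (norm z)"
      by simp
  qed
qed

text \<open>An upper bound for Gamma says nothing about the reciprocal, so this case is separate;
  \<open>rGamma\<close> is entire and hence bounded on the disc.\<close>

lemma inverse_Gamma_star_bound_near_0: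
  obtains C where "C > 0"
    "\<And>z. z \<notin> \<real>\<^sub>\<le>\<^sub>0 \<Longrightarrow> norm z \<le> 1 / 2 \<Longrightarrow> norm (inverse (Gamma_star z)) \<le> C * sqrt (norm z)"
proof -
  have "continuous_on (cball 0 (1/2)) (\<lambda>z::complex. rGamma (z + 1))"
    by (intro holomorphic_on_imp_continuous_on holomorphic_intros)
  hence "compact ((\<lambda>z::complex. rGamma (z + 1)) ` cball 0 (1/2))"
    by (intro compact_continuous_image) auto
  then obtain C where C: "C > 0" "\<And>z. norm z \<le> 1 / 2 \<Longrightarrow> norm (rGamma (z + 1 :: complex)) \<le> C"
    using compact_imp_bounded bounded_pos by (metis (no_types, lifting) dist_0_norm imageI mem_cball)
  show ?thesis
  proof (rule that)
    show "C * exp (2 + pi) * sqrt (2 * pi) > 0" using C by simp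
    fix z :: complex assume z: "z \<notin> \<real>\<^sub>\<le>\<^sub>0" and nz: "norm z \<le> 1 / 2"
    have "z \<noteq> 0" using z by auto
    from abs_Re_mult_Ln_le[OF this nz] have le: "- (Re z - Re (z * Ln z)) \<le> 2 + pi"
      using abs_Re_le_cmod[of z] nz by linarith
    have "norm (inverse (Gamma_star z)) =
            norm (rGamma (z + 1)) * exp (- (Re z - Re (z * Ln z))) * (sqrt (2 * pi) * sqrt (norm z))"
      unfolding norm_inverse norm_Gamma_star_eq[OF z] rGamma_inverse_Gamma exp_minus
      by (simp add: divide_inverse)
    also have "\<dots> \<le> C * exp (2 + pi) * (sqrt (2 * pi) * sqrt (norm z))"
      using le C by (intro mult_right_mono mult_mono C(2) nz) auto
    finally show "norm (inverse (Gamma_star z)) \<le> C * exp (2 + pi) * sqrt (2 * pi) * sqrt (norm z)"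
      by (simp add: mult_ac)
  qed
qed

section \<open>Binet's series\<close>

text \<open>Summand of Gudermann's series for log \<open>Gamma_star\<close>. The difference of two
  logarithms stands in place of Ln (1 + 1 / w), so that partial products telescope without questions
  of branches.\<close>

definition binet_term :: "complex \<Rightarrow> complex" where
  "binet_term w = (w + 1 / 2) * (Ln (w + 1) - Ln w) - 1"

definition binet :: "complex \<Rightarrow> complex" where
  "binet z = (\<Sum>k. binet_term (z + of_nat k))"

lemma add_of_real_notin_nonpos_Reals:
  assumes "Re w \<ge> 0" "w \<noteq> 0" "u \<ge> 0"
  shows "w + of_real u \<notin> \<real>\<^sub>\<le>\<^sub>0"
  using assms by (auto simp: complex_nonpos_Reals_iff complex_eq_iff)

text \<open>Two integral forms of one term, related by an integration by parts. The first keeps the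
  factor 1/2 - u of mean zero, from which the sign of an imaginary part is read; the second is of
  order 1 / |w|^2, which makes the series converge.\<close>

lemma binet_term_integral:
  assumes w: "Re w \<ge> 0" "w \<noteq> 0"
  shows "((\<lambda>u. (1 / 2 - of_real u) / (w + of_real u)) has_integral binet_term w) {0..1}"
    and "((\<lambda>u. of_real (u * (1 - u) / 2) / (w + of_real u) ^ 2) has_integral binet_term w) {0..1}"
proof -
  note nz = add_of_real_notin_nonpos_Reals[OF w]
  have nz': "w + of_real u \<noteq> 0" if "u \<ge> 0" for u using nz[OF that] by auto
  define P where "P = (\<lambda>z. (w + 1 / 2) * Ln (w + z) - z)"
  \<comment> \<open>\<open>Q\<close> differs from \<open>P\<close> by a function vanishing at z = 0
    and z = 1, so both antiderivatives have the same increment.\<close>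
  define Q where "Q = (\<lambda>z. (w + 1 / 2) * Ln (w + z) - z - z * (1 - z) / 2 / (w + z))"
  have dP: "(P has_field_derivative (1 / 2 - of_real u) / (w + of_real u)) (at (of_real u))"
    if "u \<ge> 0" for u
  proof -
    define W where "W = w + of_real u"
    have W: "W \<noteq> 0" "W \<notin> \<real>\<^sub>\<le>\<^sub>0" using nz'[OF that] nz[OF that] by (auto simp: W_def)
    have "((\<lambda>z. w + z) has_field_derivative 1) (at (of_real u))"
      by (auto intro!: derivative_eq_intros)
    have "((\<lambda>z. Ln (w + z)) has_field_derivative inverse W * 1) (at (of_real u))"
      unfolding W_def
      by (rule DERIV_chain2[where f = Ln and g = "\<lambda>z. w + z"], rule has_field_derivative_Ln)
         (use W(2) \<open>((\<lambda>z. w + z) has_field_derivative 1) (at (of_real u))\<close> in \<open>simp_all add: W_def\<close>)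
    hence "(P has_field_derivative (w + 1 / 2) * (inverse W * 1) - 1) (at (of_real u))"
      unfolding P_def by (intro DERIV_diff DERIV_cmult DERIV_ident)
    also have "(w + 1 / 2) * (inverse W * 1) - 1 = (W + (1 / 2 - of_real u)) * inverse W - 1"
      by (simp add: W_def)
    also have "(W + (1 / 2 - of_real u)) * inverse W = W * inverse W + (1 / 2 - of_real u) * inverse W"
      by (rule distrib_right)
    also have "W * inverse W + (1 / 2 - of_real u) * inverse W - 1 = (1 / 2 - of_real u) / W"
      unfolding right_inverse[OF W(1)] divide_inverse by (rule add_diff_cancel_left')
    finally show ?thesis unfolding W_def .
  qed
  have dQ: "(Q has_field_derivative of_real (u * (1 - u) / 2) / (w + of_real u) ^ 2) (at (of_real u))"
    if "u \<ge> 0" for u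
  proof -
    define W where "W = w + of_real u"
    have W: "W \<noteq> 0" using nz'[OF that] by (simp add: W_def)
    have "((\<lambda>z. z * (1 - z) / 2) has_field_derivative (1 / 2 - of_real u)) (at (of_real u))"
      by (auto intro!: derivative_eq_intros simp: field_simps)
    moreover have "((\<lambda>z. w + z) has_field_derivative 1) (at (of_real u))"
      by (auto intro!: derivative_eq_intros)
    ultimately have "((\<lambda>z. z * (1 - z) / 2 / (w + z)) has_field_derivative
        ((1 / 2 - of_real u) * W - of_real u * (1 - of_real u) / 2 * 1) / (W * W)) (at (of_real u))"
      unfolding W_def by (rule DERIV_divide) (use nz'[OF that] in auto)
    also have "((1 / 2 - of_real u) * W - of_real u * (1 - of_real u) / 2 * 1) / (W * W) =
        (1 / 2 - of_real u) / W - of_real (u * (1 - u) / 2) / W ^ 2"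
      using W by (simp add: diff_divide_distrib power2_eq_square)
    finally have "((\<lambda>z. P z - z * (1 - z) / 2 / (w + z)) has_field_derivative
        (1 / 2 - of_real u) / W - ((1 / 2 - of_real u) / W - of_real (u * (1 - u) / 2) / W ^ 2)) (at (of_real u))"
      using dP[OF that] unfolding W_def by (intro DERIV_diff)
    thus ?thesis by (simp add: Q_def P_def W_def)
  qed
  have "((\<lambda>u. (1 / 2 - of_real u) / (w + of_real u)) has_integral P (of_real 1) - P (of_real 0)) {0..1}"
    by (rule fundamental_theorem_of_calculus)
       (auto intro!: has_vector_derivative_real_field[OF dP])
  also have "P (of_real 1) - P (of_real 0) = binet_term w"
    by (simp add: P_def binet_term_def algebra_simps)
  finally show "((\<lambda>u. (1 / 2 - of_real u) / (w + of_real u)) has_integral binet_term w) {0..1}" .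
  have "((\<lambda>u. of_real (u * (1 - u) / 2) / (w + of_real u) ^ 2) has_integral Q (of_real 1) - Q (of_real 0)) {0..1}"
    by (rule fundamental_theorem_of_calculus, simp, rule has_vector_derivative_real_field[OF dQ], simp)
  also have "Q (of_real 1) - Q (of_real 0) = binet_term w"
    by (simp add: Q_def binet_term_def algebra_simps)
  finally show "((\<lambda>u. of_real (u * (1 - u) / 2) / (w + of_real u) ^ 2) has_integral binet_term w) {0..1}" .
qed

lemma has_integral_arctan_kernel:
  fixes r c :: real
  assumes r: "r > 0"
  shows "((\<lambda>u. 1 / (r\<^sup>2 + (c + u)\<^sup>2)) has_integral (arctan ((c + 1) / r) - arctan (c / r)) / r) {0..1}"
proof -
  have "((\<lambda>u. 1 / (r\<^sup>2 + (c + u)\<^sup>2)) has_integral arctan ((c + 1) / r) / r - arctan ((c + 0) / r) / r) {0..1}"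
  proof (rule fundamental_theorem_of_calculus)
    fix u :: real
    have e: "(1 + ((c + u) / r)\<^sup>2) * (r * r) = r\<^sup>2 + (c + u)\<^sup>2"
    proof -
      define q where "q = (c + u) / r"
      have "c + u = q * r" using r by (simp add: q_def)
      thus ?thesis unfolding q_def[symmetric] by (simp add: power2_eq_square algebra_simps)
    qed
    have "((\<lambda>u. arctan ((c + u) / r) / r) has_real_derivative
            1 / ((1 + ((c + u) / r)\<^sup>2) * (r * r))) (at u within {0..1})"
      using r by (auto intro!: derivative_eq_intros simp: divide_inverse)
    thus "((\<lambda>u. arctan ((c + u) / r) / r) has_vector_derivative
            1 / (r\<^sup>2 + (c + u)\<^sup>2)) (at u within {0..1})"
      unfolding e by (simp add: has_real_derivative_iff_has_vector_derivative)
  qed auto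
  thus ?thesis by (simp add: diff_divide_distrib)
qed

text \<open>For Re z >= 0 and t >= 0, |z + t|^2 >= |z|^2 + t^2, and u (1 - u) / 2 <= 1/8. The
  resulting bound is an increment of arctan, so its sum over k telescopes.\<close>

lemma norm_binet_term_le:
  assumes z: "Re z \<ge> 0" "z \<noteq> 0"
  shows "norm (binet_term (z + of_nat k)) \<le>
           (arctan ((real k + 1) / norm z) - arctan (real k / norm z)) / (8 * norm z)"
proof -
  define r where "r = norm z"
  have r: "r > 0" using z by (simp add: r_def)
  have w: "Re (z + of_nat k) \<ge> 0" "z + of_nat k \<noteq> 0"
    using z by (auto simp: complex_eq_iff)
  have I: "((\<lambda>u. 1 / (8 * (r\<^sup>2 + (real k + u)\<^sup>2))) has_integral
             (arctan ((real k + 1) / r) - arctan (real k / r)) / (8 * r)) {0..1}"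
    using has_integral_mult_right[OF has_integral_arctan_kernel[OF r, of "real k"], of "1 / 8"] by simp
  have le: "norm (of_real (u * (1 - u) / 2) / (z + of_nat k + of_real u) ^ 2 :: complex)
              \<le> 1 / (8 * (r\<^sup>2 + (real k + u)\<^sup>2))" if "u \<in> {0..1}" for u
  proof -
    have u: "0 \<le> u" "u \<le> 1" using that by auto
    have n: "norm (z + of_nat k + of_real u) ^ 2 = (Re z + real k + u)\<^sup>2 + (Im z)\<^sup>2"
      by (simp add: cmod_power2)
    have "r\<^sup>2 + (real k + u)\<^sup>2 \<le> norm (z + of_nat k + of_real u) ^ 2"
      using z(1) u unfolding n r_def cmod_power2 by (simp add: power2_eq_square algebra_simps)
    moreover have "r\<^sup>2 + (real k + u)\<^sup>2 > 0" using r by (simp add: add_pos_nonneg)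
    moreover have "u * (1 - u) / 2 \<le> 1 / 8"
      using sum_squares_ge_zero[of "2 * u - 1" 0] by (simp add: algebra_simps)
    moreover have nn: "u * (1 - u) / 2 \<ge> 0" using u by simp
    ultimately have "(u * (1 - u) / 2) / norm (z + of_nat k + of_real u) ^ 2 \<le> (1 / 8) / (r\<^sup>2 + (real k + u)\<^sup>2)"
      by (intro frac_le[of "1 / 8" "u * (1 - u) / 2"]) simp_all
    thus ?thesis using nn unfolding norm_divide norm_power norm_of_real by simp
  qed
  have "norm (binet_term (z + of_nat k)) \<le> (arctan ((real k + 1) / r) - arctan (real k / r)) / (8 * r)"
    unfolding integral_unique[OF binet_term_integral(2)[OF w], symmetric]
      integral_unique[OF I, symmetric]
    by (rule integral_norm_bound_integral)
       (use binet_term_integral(2)[OF w] I le in \<open>auto intro: has_integral_integrable\<close>)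
  thus ?thesis by (simp add: r_def)
qed

text \<open>The start index m is free because the whole series (m = 0) and the tail without its
  first term (m = 1) are both estimated.\<close>

lemma arctan_telescope_sums:
  assumes "r > 0"
  shows "(\<lambda>k. (arctan ((real (k + m) + 1) / r) - arctan (real (k + m) / r)) / (8 * r)) sums
           ((pi / 2 - arctan (real m / r)) / (8 * r))"
proof -
  have "(\<lambda>k. arctan (real (k + m) / r)) \<longlonglongrightarrow> pi / 2"
    using assms by real_asymp
  from telescope_sums[OF this]
  have "(\<lambda>k. arctan (real (Suc k + m) / r) - arctan (real (k + m) / r)) sums (pi / 2 - arctan (real m / r))"
    by simp
  from sums_divide[OF this, of "8 * r"] show ?thesis by (simp add: add_ac)
qed

lemma binet_summable_norm:
  assumes z: "Re z \<ge> 0" "z \<noteq> 0"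
  shows "summable (\<lambda>k. norm (binet_term (z + of_nat k)))"
  by (rule summable_comparison_test'[OF sums_summable[OF arctan_telescope_sums[of "norm z" 0]]])
     (use norm_binet_term_le[OF z] z in auto)

lemma binet_sums:
  assumes z: "Re z \<ge> 0" "z \<noteq> 0"
  shows "(\<lambda>k. binet_term (z + of_nat k)) sums binet z"
  using summable_norm_cancel[OF binet_summable_norm[OF z]] by (simp add: binet_def summable_sums)

lemma norm_binet_le:
  assumes z: "Re z \<ge> 0" "z \<noteq> 0"
  shows "norm (binet z) \<le> pi / (16 * norm z)"
proof -
  have "norm (binet z) \<le> (\<Sum>k. norm (binet_term (z + of_nat k)))"
    unfolding binet_def by (rule summable_norm[OF binet_summable_norm[OF z]])
  also have "\<dots> \<le> (\<Sum>k. (arctan ((real (k + 0) + 1) / norm z) - arctan (real (k + 0) / norm z)) / (8 * norm z))"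
    by (rule suminf_le[OF _ binet_summable_norm[OF z] sums_summable[OF arctan_telescope_sums]])
       (use norm_binet_term_le[OF z] z in auto)
  also have "\<dots> = pi / (16 * norm z)"
    using sums_unique[OF arctan_telescope_sums[of "norm z" 0]] z by simp
  finally show ?thesis .
qed

text \<open>This range of the argument puts \<open>Gamma_star\<close> (i s) into the fourth
  quadrant. The first term is bounded separately through the first integral form, and only the tail
  is left to the arctan estimate, because the norm bound for the whole series blows up as s tends to
  0.\<close>

lemma Im_binet_imaginary:
  assumes s: "s > 0"
  shows "Im (binet (\<i> * of_real s)) \<le> 0" "Im (binet (\<i> * of_real s)) > - (pi / 2)"
proof -
  define z where "z = \<i> * complex_of_real s"
  have z: "Re z \<ge> 0" "z \<noteq> 0" and nz: "norm z = s" using s by (auto simp: z_def norm_mult)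
  have Im_integrand: "Im ((1 / 2 - of_real u) / (z + of_nat k + of_real u)) =
      - (1 / 2 - u) * (s / ((real k + u)\<^sup>2 + s\<^sup>2))" for u k
  proof -
    have e: "1 / 2 - of_real u = complex_of_real (1 / 2 - u)" by simp
    show ?thesis unfolding e by (simp add: z_def Im_divide minus_divide_left left_diff_distrib)
  qed
  have ImI: "((\<lambda>u. - (1 / 2 - u) * (s / ((real k + u)\<^sup>2 + s\<^sup>2))) has_integral Im (binet_term (z + of_nat k))) {0..1}" for k
  proof -
    have w: "Re (z + of_nat k) \<ge> 0" "z + of_nat k \<noteq> 0"
      using z s by (auto simp: complex_eq_iff z_def)
    show ?thesis
      using has_integral_linear[OF binet_term_integral(1)[OF w] bounded_linear_Im]
      by (simp only: o_def Im_integrand)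
  qed
  have le0: "Im (binet_term (z + of_nat k)) \<le> 0" for k
  proof -
    \<comment> \<open>\<open>h0\<close> is the weight s / ((k + u)^2 + s^2) at the midpoint u = 1/2.
      The weight decreases in u, and -(1/2 - u) changes from negative to positive at the midpoint,
      so replacing the weight by \<open>h0\<close> can only increase the integrand; the new
      integrand has mean zero.\<close>
    define h0 where "h0 = s / ((real k + 1 / 2)\<^sup>2 + s\<^sup>2)"
    have "((\<lambda>u::real. u\<^sup>2 / 2 - u / 2) has_vector_derivative - (1 / 2 - u)) (at u within {0..1})" for u
      unfolding has_real_derivative_iff_has_vector_derivative[symmetric]
      by (auto intro!: derivative_eq_intros)
    hence "((\<lambda>u::real. - (1 / 2 - u)) has_integral ((1::real)\<^sup>2 / 2 - 1 / 2) - (0\<^sup>2 / 2 - 0 / 2)) {0..1}"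
      by (intro fundamental_theorem_of_calculus) auto
    from has_integral_mult_left[OF this, of h0]
    have "((\<lambda>u::real. - (1 / 2 - u) * h0) has_integral 0) {0..1}" by simp
    with ImI[of k] show ?thesis
    proof (rule has_integral_le)
      fix u :: real assume "u \<in> {0..1}"
      hence u: "0 \<le> u" "u \<le> 1" by auto
      have pos: "(real k + v)\<^sup>2 + s\<^sup>2 > 0" for v using s by (simp add: add_nonneg_pos)
      show "- (1 / 2 - u) * (s / ((real k + u)\<^sup>2 + s\<^sup>2)) \<le> - (1 / 2 - u) * h0"
      proof (cases "u \<le> 1 / 2")
        case True
        have "h0 \<le> s / ((real k + u)\<^sup>2 + s\<^sup>2)"
          unfolding h0_def using s pos u True
          by (intro divide_left_mono add_mono power_mono mult_pos_pos) auto
        with True show ?thesis by (intro mult_left_mono_neg) auto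
      next
        case False
        have "s / ((real k + u)\<^sup>2 + s\<^sup>2) \<le> h0"
          unfolding h0_def using s pos u False
          by (intro divide_left_mono add_mono power_mono mult_pos_pos) auto
        with False show ?thesis by (intro mult_left_mono) auto
      qed
    qed
  qed
  have Im_sums: "(\<lambda>k. Im (binet_term (z + of_nat k))) sums Im (binet z)"
    using binet_sums[OF z] by (simp add: sums_complex_iff)
  show "Im (binet (\<i> * of_real s)) \<le> 0"
    using sums_le[OF le0 Im_sums sums_zero] by (simp add: z_def)
  \<comment> \<open>Replacing the factor 1/2 - u by 1/2 leaves -(1/2) arctan (1 / s), which exceeds
    -pi/4.\<close>
  have first: "Im (binet_term z) \<ge> - (pi / 4)"
  proof -
    have "((\<lambda>u. - (1 / 2) * (s / (u\<^sup>2 + s\<^sup>2))) has_integral - (1 / 2) * arctan (1 / s)) {0..1}"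
      using has_integral_mult_right[OF has_integral_arctan_kernel[OF s, of 0], of "- (1 / 2) * s"] s
      by (simp add: add.commute)
    from this ImI[of 0] have "- (1 / 2) * arctan (1 / s) \<le> Im (binet_term (z + of_nat 0))"
    proof (rule has_integral_le)
      fix u :: real assume "u \<in> {0..1}"
      have "s / (u\<^sup>2 + s\<^sup>2) \<ge> 0" using s by simp
      thus "- (1 / 2) * (s / (u\<^sup>2 + s\<^sup>2)) \<le> - (1 / 2 - u) * (s / ((real 0 + u)\<^sup>2 + s\<^sup>2))"
        using \<open>u \<in> {0..1}\<close> mult_right_mono[of "1 / 2 - u" "1 / 2" "s / (u\<^sup>2 + s\<^sup>2)"]
        unfolding mult_minus_left of_nat_0 add_0 neg_le_iff_le by simp
    qed
    thus ?thesis using arctan_ubound[of "1 / s"] by simp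
  qed
  have rest: "Im (binet z) - Im (binet_term z) \<ge> - (1 / 8)"
  proof -
    have sm: "(\<lambda>k. Im (binet_term (z + of_nat (k + 1)))) sums (Im (binet z) - Im (binet_term z))"
      using sums_split_initial_segment[OF Im_sums, of 1] by simp
    have sr: "(\<lambda>k. - ((arctan ((real (k + 1) + 1) / s) - arctan (real (k + 1) / s)) / (8 * s))) sums
                - ((pi / 2 - arctan (real 1 / s)) / (8 * s))"
      by (rule sums_minus[OF arctan_telescope_sums[OF s]])
    have "- ((pi / 2 - arctan (real 1 / s)) / (8 * s)) \<le> Im (binet z) - Im (binet_term z)"
    proof (rule sums_le[OF _ sr sm])
      fix k
      show "- ((arctan ((real (k + 1) + 1) / s) - arctan (real (k + 1) / s)) / (8 * s)) \<le> Im (binet_term (z + of_nat (k + 1)))"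
        using norm_binet_term_le[OF z, of "k + 1"] abs_Im_le_cmod[of "binet_term (z + of_nat (k + 1))"]
        unfolding nz by linarith
    qed
    \<comment> \<open>The tail is at least -arctan s / (8 s) >= -1/8 for every s, and pi/4 + 1/8 <
      pi/2.\<close>
    moreover have "pi / 2 - arctan (real 1 / s) = arctan s"
      using arctan_inverse[of s] s by (simp add: inverse_eq_divide)
    moreover have "arctan s \<le> s" using arctan_le_self[of s] s by simp
    hence "arctan s / (8 * s) \<le> 1 / 8" using s by (simp add: field_simps)
    ultimately show ?thesis by simp
  qed
  show "Im (binet (\<i> * of_real s)) > - (pi / 2)"
    using first rest pi_gt3 unfolding z_def by linarith
qed

text \<open>Multiplying by the Pochhammer symbol makes the partial products telescope.\<close>

lemma exp_sum_binet_term: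
  assumes z: "Re z \<ge> 0" "z \<noteq> 0"
  shows "exp (\<Sum>k<N. binet_term (z + of_nat k)) * pochhammer z N =
           exp ((z + of_nat N - 1 / 2) * Ln (z + of_nat N) - (z - 1 / 2) * Ln z - of_nat N)"
proof (induction N)
  case (Suc N)
  have nz: "z + of_nat N \<noteq> 0" using z by (auto simp: complex_eq_iff)
  have "exp (\<Sum>k<Suc N. binet_term (z + of_nat k)) * pochhammer z (Suc N) =
          exp (\<Sum>k<N. binet_term (z + of_nat k)) * pochhammer z N * exp (binet_term (z + of_nat N)) *
          exp (Ln (z + of_nat N))"
    using nz by (simp add: exp_add pochhammer_Suc)
  also have "\<dots> = exp ((z + of_nat N - 1 / 2) * Ln (z + of_nat N) - (z - 1 / 2) * Ln z - of_nat N
                     + binet_term (z + of_nat N) + Ln (z + of_nat N))"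
    unfolding Suc.IH by (simp only: exp_add)
  also have "\<dots> = exp ((z + of_nat (Suc N) - 1 / 2) * Ln (z + of_nat (Suc N)) - (z - 1 / 2) * Ln z - of_nat (Suc N))"
    by (rule arg_cong[of _ _ exp]) (simp add: binet_term_def algebra_simps)
  finally show ?case .
next
  case 0
  show ?case by simp
qed

text \<open>This is the derivative of Ln at 1, taken along h = a / N.\<close>

lemma tendsto_nat_mult_Ln:
  "(\<lambda>N. of_nat N * Ln (1 + a / of_nat N)) \<longlonglongrightarrow> a"
proof (cases "a = 0")
  case False
  have "(Ln has_field_derivative 1) (at 1)"
    by (auto intro!: derivative_eq_intros)
  hence "((\<lambda>h. Ln (1 + h) / h) \<longlongrightarrow> 1) (at 0)"
    by (simp add: DERIV_def)
  moreover have "filterlim (\<lambda>N. a / of_nat N) (at 0) sequentially"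
    unfolding filterlim_at
  proof
    show "\<forall>\<^sub>F N in sequentially. a / of_nat N \<in> UNIV \<and> a / of_nat N \<noteq> 0"
      using eventually_gt_at_top[of 0] by eventually_elim (use False in auto)
    show "(\<lambda>N. a / of_nat N) \<longlonglongrightarrow> 0"
      by (rule tendsto_divide_0[OF tendsto_const tendsto_of_nat])
  qed
  ultimately have "(\<lambda>N. Ln (1 + a / of_nat N) / (a / of_nat N)) \<longlonglongrightarrow> 1"
    by (rule filterlim_compose[where g = "\<lambda>h. Ln (1 + h) / h"])
  from tendsto_mult_left[OF this, of a] show ?thesis using False by (simp add: mult.commute)
qed auto

text \<open>\<open>E z N\<close> is the elementary factor left over when the partial products of the
  series are compared with \<open>Gamma_series\<close>. Its growth is that of N!; the quotient by
  its value at 1 removes this growth and has a limit that follows from Ln (1 + a / N).\<close>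

lemma tendsto_binet_prefactor_ratio:
  fixes z :: complex
  assumes z: "Re z \<ge> 0"
  defines "E \<equiv> \<lambda>z N. exp ((z + of_nat N + 1 / 2) * Ln (z + of_nat N + 1) - z * of_real (ln (real N)) - of_nat N - 1)"
  shows "(\<lambda>N. E z N / E 1 N) \<longlonglongrightarrow> exp (z - 1)"
proof -
  have sm: "(\<lambda>N. Ln (1 + a / of_nat N)) \<longlonglongrightarrow> 0" for a
  proof -
    have "(\<lambda>N. a / of_nat N) \<longlonglongrightarrow> 0" by (rule tendsto_divide_0[OF tendsto_const tendsto_of_nat])
    hence "(\<lambda>N. Ln (1 + a / of_nat N)) \<longlonglongrightarrow> Ln (1 + 0)"
      by (intro tendsto_intros) auto
    thus ?thesis by simp
  qed
  have "(\<lambda>N. exp ((z + 1 / 2) * Ln (1 + (z + 1) / of_nat N) + of_nat N * Ln (1 + (z + 1) / of_nat N)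
            - (3 / 2) * Ln (1 + (1 + 1) / of_nat N) - of_nat N * Ln (1 + (1 + 1) / of_nat N)))
          \<longlonglongrightarrow> exp ((z + 1 / 2) * 0 + (z + 1) - (3 / 2) * 0 - (1 + 1))"
    by (intro tendsto_exp tendsto_add tendsto_diff tendsto_mult_left sm tendsto_nat_mult_Ln)
  moreover have "eventually (\<lambda>N. exp ((z + 1 / 2) * Ln (1 + (z + 1) / of_nat N) + of_nat N * Ln (1 + (z + 1) / of_nat N)
            - (3 / 2) * Ln (1 + (1 + 1) / of_nat N) - of_nat N * Ln (1 + (1 + 1) / of_nat N)) = E z N / E 1 N) sequentially"
    using eventually_gt_at_top[of 0]
  proof eventually_elim
    case (elim N)
    have L: "Ln (w + of_nat N + 1) = of_real (ln (real N)) + Ln (1 + (w + 1) / of_nat N)" if "Re w \<ge> 0" for w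
    proof -
      have "Re (1 + (w + 1) / of_nat N) > 0"
        using that elim by (simp add: Re_divide_of_nat add_pos_nonneg)
      hence "1 + (w + 1) / of_nat N \<noteq> 0" by (metis less_irrefl zero_complex.sel(1))
      hence "Ln (of_real (real N) * (1 + (w + 1) / of_nat N)) = of_real (ln (real N)) + Ln (1 + (w + 1) / of_nat N)"
        using Ln_times_of_real[of "real N" "1 + (w + 1) / of_nat N"] elim by (simp add: Ln_of_real)
      moreover have "of_real (real N) * (1 + (w + 1) / of_nat N) = w + of_nat N + 1"
        using elim by (simp only: distrib_left) simp
      ultimately show ?thesis by simp
    qed
    have one: "Re 1 \<ge> 0" by simp
    show ?case
      unfolding E_def exp_diff[symmetric] L[OF z] L[OF one]
      by (rule arg_cong[of _ _ exp]) (simp add: algebra_simps)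
  qed
  ultimately have "(\<lambda>N. E z N / E 1 N) \<longlonglongrightarrow> exp ((z + 1 / 2) * 0 + (z + 1) - (3 / 2) * 0 - (1 + 1))"
    by (rule Lim_transform_eventually)
  thus ?thesis by (simp add: algebra_simps)
qed

text \<open>\<open>Gamma_series\<close> tends to Gamma and the partial products tend to exp (binet
  z). The limit of \<open>E 1 N / fact N\<close> is read off from the case z = 1, where Gamma is
  known; this leaves the constant exp (binet 1 - 1) to be determined.\<close>

lemma exp_binet_aux:
  assumes z: "Re z \<ge> 0" "z \<noteq> 0"
  shows "exp (binet z) = Gamma z * exp (z - (z - 1 / 2) * Ln z) * exp (binet 1 - 1)"
proof -
  define E where "E = (\<lambda>z N. exp ((z + of_nat N + 1 / 2) * Ln (z + of_nat N + 1) - z * of_real (ln (real N)) - of_nat N - 1))"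
  have lim: "(\<lambda>N. Gamma_series w N * (E w N / fact N)) \<longlonglongrightarrow> exp (binet w + (w - 1 / 2) * Ln w)"
    if w: "Re w \<ge> 0" "w \<noteq> 0" for w
  proof -
    have "(\<lambda>N. exp (\<Sum>k<Suc N. binet_term (w + of_nat k)) * exp ((w - 1 / 2) * Ln w)) \<longlonglongrightarrow>
            exp (binet w) * exp ((w - 1 / 2) * Ln w)"
      using binet_sums[OF w, unfolded sums_def, THEN LIMSEQ_Suc]
      by (intro tendsto_mult_right tendsto_exp)
    moreover have "exp (\<Sum>k<Suc N. binet_term (w + of_nat k)) * exp ((w - 1 / 2) * Ln w) =
                     Gamma_series w N * (E w N / fact N)" for N
    proof -
      have nz: "w + of_nat k \<noteq> 0" for k using w by (auto simp: complex_eq_iff)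
      hence "pochhammer w (Suc N) \<noteq> 0"
        by (metis add.commute add_eq_0_iff pochhammer_eq_0_iff add.inverse_inverse)
      hence "exp (\<Sum>k<Suc N. binet_term (w + of_nat k)) * exp ((w - 1 / 2) * Ln w) =
          (exp (\<Sum>k<Suc N. binet_term (w + of_nat k)) * pochhammer w (Suc N)) * exp ((w - 1 / 2) * Ln w) / pochhammer w (Suc N)"
        by (simp del: sum.lessThan_Suc)
      also have "exp (\<Sum>k<Suc N. binet_term (w + of_nat k)) * pochhammer w (Suc N) * exp ((w - 1 / 2) * Ln w) =
          exp ((w + of_nat (Suc N) - 1 / 2) * Ln (w + of_nat (Suc N)) - (w - 1 / 2) * Ln w - of_nat (Suc N) + (w - 1 / 2) * Ln w)"
        unfolding exp_sum_binet_term[OF w] by (simp only: exp_add)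
      also have "\<dots> = E w N * exp (w * of_real (ln (real N)))"
        unfolding E_def exp_add[symmetric] by (rule arg_cong[of _ _ exp]) (simp add: algebra_simps)
      finally show ?thesis by (simp add: Gamma_series_def)
    qed
    ultimately show ?thesis by (simp add: exp_add del: sum.lessThan_Suc)
  qed
  have E1: "(\<lambda>N. E 1 N / fact N) \<longlonglongrightarrow> exp (binet 1)"
  proof -
    have "(\<lambda>N. Gamma_series 1 N * (E 1 N / fact N) / Gamma_series 1 N) \<longlonglongrightarrow> exp (binet 1 + (1 - 1 / 2) * Ln 1) / Gamma 1"
      by (intro tendsto_divide lim Gamma_series_LIMSEQ) auto
    moreover have "eventually (\<lambda>N. Gamma_series 1 N * (E 1 N / fact N) / Gamma_series 1 N = E 1 N / fact N) sequentially"
    proof -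
      have "eventually (\<lambda>N. Gamma_series (1::complex) N \<noteq> 0) sequentially"
        using tendsto_imp_eventually_ne[OF Gamma_series_LIMSEQ[of "1::complex"], of 0] by simp
      thus ?thesis by eventually_elim simp
    qed
    ultimately have "(\<lambda>N. E 1 N / fact N) \<longlonglongrightarrow> exp (binet 1 + (1 - 1 / 2) * Ln 1) / Gamma 1"
      by (rule Lim_transform_eventually)
    thus ?thesis by simp
  qed
  have "(\<lambda>N. Gamma_series z N * ((E z N / E 1 N) * (E 1 N / fact N))) \<longlonglongrightarrow> Gamma z * (exp (z - 1) * exp (binet 1))"
    using tendsto_binet_prefactor_ratio[OF z(1)] E1 unfolding E_def
    by (intro tendsto_mult Gamma_series_LIMSEQ)
  moreover have "(E z N / E 1 N) * (E 1 N / fact N) = E z N / fact N" for N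
    by (simp add: E_def)
  ultimately have "(\<lambda>N. Gamma_series z N * (E z N / fact N)) \<longlonglongrightarrow> Gamma z * (exp (z - 1) * exp (binet 1))"
    by simp
  from LIMSEQ_unique[OF lim[OF z] this]
  have *: "exp (binet z + (z - 1 / 2) * Ln z) = Gamma z * (exp (z - 1) * exp (binet 1))" .
  define P where "P = (z - 1 / 2) * Ln z"
  from * have "exp (binet z) * exp P = Gamma z * (exp (z - 1) * exp (binet 1))"
    unfolding P_def[symmetric] exp_add .
  thus ?thesis unfolding P_def[symmetric] by (simp add: exp_diff field_simps)
qed

text \<open>Reality of \<open>binet 1\<close> makes the unknown constant a positive number, so that
  a comparison of moduli determines it.\<close>

lemma Im_binet_1: "Im (binet 1) = 0"
proof -
  have "Im (binet_term (1 + of_nat k)) = 0" for k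
  proof -
    have "Ln (1 + of_nat k + 1) = of_real (ln (real k + 2))"
      using Ln_of_real[of "real k + 2"] by (simp add: add_ac)
    moreover have "Ln (1 + of_nat k) = of_real (ln (1 + real k))"
      using Ln_of_real[of "1 + real k"] by simp
    moreover have "1 + of_nat k + 1 / 2 = complex_of_real (1 + real k + 1 / 2)" by simp
    ultimately show ?thesis unfolding binet_term_def by (simp only: flip: of_real_diff) simp
  qed
  moreover have "(\<lambda>k. Im (binet_term (1 + of_nat k))) sums Im (binet 1)"
    using binet_sums[of 1] by (simp add: sums_complex_iff)
  ultimately show ?thesis using sums_unique2[OF sums_zero] by simp
qed

text \<open>The constant factor is found on the imaginary axis, where the reflection formula gives
  \<open>|Gamma_star(i s)|\<close> exactly; Stirling's formula is not needed.\<close>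

theorem Gamma_star_eq_exp_binet:
  assumes z: "Re z \<ge> 0" "z \<noteq> 0"
  shows "Gamma_star z = exp (binet z)"
proof -
  define c where "c = sqrt (2 * pi) * exp (Re (binet 1) - 1)"
  have c0: "c > 0" by (simp add: c_def)
  have b1: "exp (binet 1 - 1) = of_real (exp (Re (binet 1) - 1))"
    using Im_binet_1 by (simp add: exp_eq_polar cis_conv_exp[symmetric])
  have eq: "exp (binet w) = of_real c * Gamma_star w" if w: "Re w \<ge> 0" "w \<noteq> 0" for w
  proof -
    define P where "P = (w - 1 / 2) * Ln w"
    have "w powr (w - 1 / 2) = exp P" using w by (simp add: powr_def P_def)
    thus ?thesis
      unfolding exp_binet_aux[OF w] b1 Gamma_star_def c_def P_def[symmetric]
      by (simp add: exp_diff exp_minus field_simps)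
  qed
  have "((\<lambda>s. binet (\<i> * of_real s)) \<longlongrightarrow> 0) at_top"
  proof (rule Lim_null_comparison)
    show "eventually (\<lambda>s. norm (binet (\<i> * of_real s)) \<le> pi / (16 * s)) at_top"
      using eventually_gt_at_top[of 0]
    proof eventually_elim
      case (elim s)
      thus ?case using norm_binet_le[of "\<i> * of_real s"] by (simp add: norm_mult)
    qed
    show "((\<lambda>s::real. pi / (16 * s)) \<longlongrightarrow> 0) at_top" by real_asymp
  qed
  hence "((\<lambda>s. norm (exp (binet (\<i> * of_real s))) ^ 2) \<longlongrightarrow> norm (exp (0::complex)) ^ 2) at_top"
    by (intro tendsto_intros)
  moreover have "eventually (\<lambda>s. norm (exp (binet (\<i> * of_real s))) ^ 2 = c ^ 2 * (1 / (1 - exp (-2 * pi * s)))) at_top"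
    using eventually_gt_at_top[of 0]
  proof eventually_elim
    case (elim s)
    have "exp (binet (\<i> * of_real s)) = of_real c * Gamma_star (\<i> * of_real s)"
      using elim by (intro eq) auto
    thus ?case using norm_Gamma_star_imaginary[OF elim] c0 by (simp add: norm_mult power_mult_distrib)
  qed
  ultimately have "((\<lambda>s. c ^ 2 * (1 / (1 - exp (-2 * pi * s)))) \<longlongrightarrow> norm (exp (0::complex)) ^ 2) at_top"
    by (rule Lim_transform_eventually)
  moreover have "((\<lambda>s. c ^ 2 * (1 / (1 - exp (-2 * pi * s)))) \<longlongrightarrow> c ^ 2) at_top"
    by real_asymp
  ultimately have "c ^ 2 = 1"
    using tendsto_unique[OF trivial_limit_at_top_linorder] by fastforce
  hence "c = 1" using c0 by (simp add: power2_eq_1_iff)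
  thus ?thesis using eq[OF z] by simp
qed

section \<open>Bounds in sectors\<close>

lemma norm_exp_Complex: "norm (exp (Complex x y)) = exp x"
  by (simp add: norm_exp_eq_Re)

lemma exp_Complex_eq: "exp (Complex x y) = of_real (exp x) * cis y"
  by (simp add: exp_eq_polar)

lemma Re_nonneg_notin_nonpos_Reals: "Re z \<ge> 0 \<Longrightarrow> z \<noteq> 0 \<Longrightarrow> z \<notin> \<real>\<^sub>\<le>\<^sub>0"
  by (auto simp: complex_nonpos_Reals_iff complex_eq_iff)

lemma norm_inverse_Gamma_star_le_aux:
  assumes z: "Re z \<ge> 0" "z \<noteq> 0"
  shows "norm (inverse (Gamma_star z)) \<le> exp (pi / (16 * norm z))"
proof -
  have "norm (inverse (Gamma_star z)) = exp (- Re (binet z))"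
    by (simp add: Gamma_star_eq_exp_binet[OF z] norm_inverse exp_minus)
  also have "\<dots> \<le> exp (pi / (16 * norm z))"
    using norm_binet_le[OF z] abs_Re_le_cmod[of "binet z"] by simp
  finally show ?thesis .
qed

lemma norm_Gamma_star_ge_1_imaginary:
  assumes "Re z = 0" "z \<noteq> 0"
  shows "norm (Gamma_star z) \<ge> 1"
proof -
  have *: "norm (Gamma_star (\<i> * of_real s)) \<ge> 1" if "s > 0" for s
  proof -
    have "exp (-2 * pi * s) < 1" using that by simp
    hence "1 / (1 - exp (-2 * pi * s)) \<ge> 1" by (simp add: field_simps)
    hence "1\<^sup>2 \<le> norm (Gamma_star (\<i> * of_real s)) ^ 2"
      using norm_Gamma_star_imaginary[OF that] by simp
    thus ?thesis by (rule power2_le_imp_le) simp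
  qed
  show ?thesis
  proof (cases "Im z > 0")
    case pos: True
    have "z = \<i> * of_real (Im z)" using assms by (simp add: complex_eq_iff)
    thus ?thesis using *[OF pos] by simp
  next
    case False
    define s where "s = - Im z"
    have s: "s > 0" using False assms by (auto simp: complex_eq_iff s_def)
    have e: "z = cnj (\<i> * of_real s)" using assms by (simp add: complex_eq_iff s_def)
    have "\<i> * of_real s \<notin> \<real>\<^sub>\<le>\<^sub>0"
      by (rule Im_nonzero_notin_nonpos_Reals) (use s in auto)
    from Gamma_star_cnj[OF this] show ?thesis using *[OF s] by (simp only: e complex_mod_cnj)
  qed
qed

text \<open>Maximum principle on half-discs of radius R: the reciprocal is at most 1 on the
  imaginary axis by the reflection formula and at most exp (pi / (16 R)) on the arc by the series;
  then R tends to infinity. The series alone gives only exp (pi / (16 |z|)).\<close>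

lemma norm_inverse_Gamma_star_le_1:
  assumes z: "Re z \<ge> 0" "z \<noteq> 0"
  shows "norm (inverse (Gamma_star z)) \<le> 1"
proof (cases "Re z = 0")
  case True
  thus ?thesis using norm_Gamma_star_ge_1_imaginary[OF True z(2)] by (simp add: norm_inverse inverse_le_1_iff)
next
  case False
  hence Rz: "Re z > 0" using z by simp
  \<comment> \<open>0 is the limit at the origin, since \<open>Gamma_star\<close> grows like
    |z|^(-1/2) there; with this value \<open>f\<close> is continuous on the closed
    half-plane.\<close>
  define f where "f = (\<lambda>z. if z = 0 then 0 else inverse (Gamma_star z))"
  have holo: "f holomorphic_on {z. Re z > 0}"
  proof -
    have "(\<lambda>z. inverse (Gamma_star z)) holomorphic_on {z. Re z > 0}"
      by (intro holomorphic_intros holomorphic_on_subset[OF Gamma_star_holomorphic])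
         (auto simp: complex_nonpos_Reals_iff intro!: Gamma_star_nonzero)
    thus ?thesis by (rule holomorphic_transform) (auto simp: f_def)
  qed
  have cont: "continuous_on {z. Re z \<ge> 0} f"
  proof -
    have "continuous (at w within {z. Re z \<ge> 0}) f" if w: "Re w \<ge> 0" for w
    proof (cases "w = 0")
      case False
      have "(\<lambda>z. inverse (Gamma_star z)) holomorphic_on (- \<real>\<^sub>\<le>\<^sub>0)"
        by (intro holomorphic_intros Gamma_star_holomorphic Gamma_star_nonzero) auto
      hence "f holomorphic_on (- \<real>\<^sub>\<le>\<^sub>0)" by (rule holomorphic_transform) (auto simp: f_def)
      moreover have "open (- \<real>\<^sub>\<le>\<^sub>0 :: complex set)" by auto
      moreover have "w \<in> - \<real>\<^sub>\<le>\<^sub>0" using Re_nonneg_notin_nonpos_Reals[OF w False] by simp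
      ultimately have "isCont f w"
        using holomorphic_on_imp_continuous_on continuous_on_eq_continuous_at by blast
      thus ?thesis by (rule continuous_at_imp_continuous_at_within)
    next
      case True
      obtain C where C: "C > 0" "\<And>z. z \<notin> \<real>\<^sub>\<le>\<^sub>0 \<Longrightarrow> norm z \<le> 1 / 2 \<Longrightarrow> norm (inverse (Gamma_star z)) \<le> C * sqrt (norm z)"
        using inverse_Gamma_star_bound_near_0 by blast
      have "(f \<longlongrightarrow> 0) (at 0 within {z. Re z \<ge> 0})"
      proof (rule Lim_null_comparison)
        show "eventually (\<lambda>z. norm (f z) \<le> C * sqrt (norm z)) (at 0 within {z. Re z \<ge> 0})"
          unfolding eventually_at
          by (rule exI[of _ "1/2"]) (auto simp: f_def intro!: C(2) dest: Re_nonneg_notin_nonpos_Reals)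
        have "((\<lambda>z::complex. C * sqrt (norm z)) \<longlongrightarrow> C * sqrt (norm (0::complex))) (at 0 within {z. Re z \<ge> 0})"
          by (intro tendsto_intros)
        thus "((\<lambda>z::complex. C * sqrt (norm z)) \<longlongrightarrow> 0) (at 0 within {z. Re z \<ge> 0})" by simp
      qed
      thus ?thesis using True by (simp add: continuous_within f_def)
    qed
    thus ?thesis by (simp add: continuous_on_eq_continuous_within)
  qed
  have bound: "norm (f z) \<le> exp (pi / (16 * R))" if R: "R > norm z" for R
  proof -
    define S where "S = ball 0 R \<inter> {z. Re z > 0}"
    have R0: "R > 0" using R norm_ge_zero[of z] by linarith
    have "open S" unfolding S_def by (intro open_Int open_ball open_halfspace_Re_gt)
    have cl: "closure S \<subseteq> cball 0 R \<inter> {z. Re z \<ge> 0}"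
      by (rule closure_minimal) (auto simp: S_def intro!: closed_Int closed_halfspace_Re_ge)
    show ?thesis
    proof (rule maximum_modulus_frontier[of f S])
      show "f holomorphic_on interior S"
        unfolding interior_open[OF \<open>open S\<close>] by (rule holomorphic_on_subset[OF holo]) (auto simp: S_def)
      show "continuous_on (closure S) f"
        using cl by (auto intro: continuous_on_subset[OF cont])
      show "bounded S" by (auto simp: S_def intro: bounded_subset[OF bounded_ball])
      show "z \<in> S" using R Rz by (simp add: S_def)
      fix w assume "w \<in> frontier S"
      hence w: "w \<in> closure S" "w \<notin> S" using \<open>open S\<close> by (auto simp: frontier_def interior_open)
      hence w': "norm w \<le> R" "Re w \<ge> 0" "norm w = R \<or> Re w = 0" using cl by (auto simp: S_def)
      show "norm (f w) \<le> exp (pi / (16 * R))"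
      proof (cases "w = 0")
        case w0: False
        show ?thesis
        proof (cases "norm w = R")
          case True
          thus ?thesis using norm_inverse_Gamma_star_le_aux[OF w'(2) w0] w0 by (simp add: f_def)
        next
          case False
          hence "Re w = 0" using w' by simp
          from norm_Gamma_star_ge_1_imaginary[OF this w0]
          have "norm (f w) \<le> 1" using w0 by (simp add: f_def norm_inverse inverse_le_1_iff)
          also have "1 \<le> exp (pi / (16 * R))" using R0 by simp
          finally show ?thesis .
        qed
      qed (simp add: f_def)
    qed
  qed
  have "((\<lambda>R. exp (pi / (16 * R))) \<longlongrightarrow> 1) at_top" by real_asymp
  hence "norm (f z) \<le> 1"
    by (rule tendsto_lowerbound)
       (auto intro: eventually_mono[OF eventually_gt_at_top[of "norm z"] bound])
  thus ?thesis using z by (simp add: f_def)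
qed

lemma exp_minus_1_bound:
  fixes w :: complex
  assumes "norm w \<le> 1 / 2"
  shows "norm (exp w - 1) \<le> 2 * norm w"
proof -
  have "norm (exp w - (\<Sum>k\<le>0. w ^ k / fact k)) \<le> exp \<bar>Re w\<bar> * norm w ^ Suc 0 / fact 0"
    by (rule Taylor_exp)
  hence "norm (exp w - 1) \<le> exp \<bar>Re w\<bar> * norm w" by simp
  also have "exp \<bar>Re w\<bar> \<le> exp (1 / 2)" using assms abs_Re_le_cmod[of w] by simp
  also have "exp (1 / 2) \<le> (2::real)" using exp_bound_half[of "1/2::real"] by simp
  finally show ?thesis by (simp add: mult_right_mono)
qed

text \<open>For |z| >= 1/2, pi < 4 gives |binet z| <= 1 / (4 |z|) <= 1/2, which is the range in
  which |e^w - 1| <= 2 |w| is available.\<close>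

lemma Gamma_star_minus_1_bound:
  assumes z: "Re z \<ge> 0" "norm z \<ge> 1 / 2"
  shows "norm (Gamma_star z - 1) \<le> 1 / norm z" "norm (inverse (Gamma_star z) - 1) \<le> 1 / norm z"
proof -
  have z0: "z \<noteq> 0" using z by auto
  have b: "norm (binet z) \<le> pi / (16 * norm z)" by (rule norm_binet_le[OF z(1) z0])
  also have b': "pi / (16 * norm z) \<le> 4 / (16 * norm z)"
    using pi_less_4 z0 by (intro divide_right_mono) auto
  finally have b2: "norm (binet z) \<le> (1 / norm z) / 4" by simp
  define t where "t = 1 / norm z"
  have "t \<le> 2" using z by (simp add: divide_simps t_def)
  hence b1: "norm (binet z) \<le> 1 / 2" using b2 unfolding t_def[symmetric] by linarith
  have b3: "norm (binet z) \<le> t / 4" using b2 by (simp add: t_def)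
  show "norm (Gamma_star z - 1) \<le> 1 / norm z"
    using exp_minus_1_bound[OF b1] b3 norm_ge_zero[of "binet z"]
    unfolding t_def[symmetric] Gamma_star_eq_exp_binet[OF z(1) z0] by linarith
  show "norm (inverse (Gamma_star z) - 1) \<le> 1 / norm z"
    using exp_minus_1_bound[of "- binet z"] b1 b3 norm_ge_zero[of "binet z"]
    unfolding t_def[symmetric] Gamma_star_eq_exp_binet[OF z(1) z0] exp_minus[symmetric] norm_minus_cancel
    by linarith
qed

lemma norm_one_minus_exp_ge:
  assumes "Im z > 0"
  shows "norm (1 - exp (2 * pi * \<i> * z)) \<ge> 1 - exp (- 2 * pi * Im z)"
proof -
  have "norm (exp (2 * pi * \<i> * z)) = exp (- 2 * pi * Im z)"
    by (simp add: norm_exp_eq_Re)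
  thus ?thesis using norm_triangle_ineq2[of 1 "exp (2 * pi * \<i> * z)"] by simp
qed

lemma Gamma_star_left:
  assumes "Im z > 0"
  shows "Gamma_star z = inverse (Gamma_star (- z)) / (1 - exp (2 * pi * \<i> * z))"
proof -
  have "Gamma_star z * Gamma_star (-z) * (1 - exp (2 * pi * \<i> * z)) = 1"
    by (rule Gamma_star_reflection[OF assms])
  moreover define a b d where "a = Gamma_star z" and "b = Gamma_star (- z)" and "d = 1 - exp (2 * pi * \<i> * z)"
  ultimately have abd: "a * b * d = 1" by simp
  hence "b \<noteq> 0" "d \<noteq> 0" by auto
  with abd have "a = inverse b / d" by (simp add: field_simps)
  thus ?thesis by (simp only: a_def b_def d_def)
qed

text \<open>Reflection carries the bound 1 for the reciprocal from the right to the left quadrant.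
  The denominator is the source of the geometric series behind zeta.\<close>

lemma Gamma_star_left_bound:
  assumes "Im z > 0" "Re z \<le> 0"
  shows "norm (Gamma_star z) \<le> 1 / (1 - exp (- 2 * pi * Im z))"
proof -
  have "norm (inverse (Gamma_star (- z))) \<le> 1"
    using assms by (intro norm_inverse_Gamma_star_le_1) auto
  moreover have "1 - exp (- 2 * pi * Im z) > 0" using assms by simp
  ultimately show ?thesis
    unfolding Gamma_star_left[OF assms(1)] norm_divide
    using norm_one_minus_exp_ge[OF assms(1)] by (intro frac_le) auto
qed

text \<open>\<open>c\<close> bounds sin (arg z) from below. This keeps 1 - q away from 0 and makes q
  = e^(2 pi i z) at most 1 / (c |z|) in modulus, so that a / (1 - q) - 1 = (a - 1 + q) / (1 - q),
  with a = 1 / Gamma_star (-z), is of order 1 / |z|.\<close>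

lemma Gamma_star_left_minus_1_bound:
  assumes c: "0 < c" and z: "Im z \<ge> c * norm z" "Re z \<le> 0" "norm z \<ge> 1 / 2"
  shows "norm (Gamma_star z - 1) \<le> (1 + 1 / c) / (1 - exp (- pi * c)) / norm z"
proof -
  have cz: "c * norm z > 0" using c z(3) by (intro mult_pos_pos) auto
  have Im: "Im z > 0" using cz z by linarith
  define q where "q = exp (2 * pi * \<i> * z)"
  have nq: "norm q = exp (- 2 * pi * Im z)" by (simp add: q_def norm_exp_eq_Re)
  have "c * (1 / 2) \<le> c * norm z" using c z(3) by (intro mult_left_mono) auto
  hence "pi * c \<le> pi * (2 * Im z)" using z(1) by (intro mult_left_mono) auto
  hence "1 - exp (- pi * c) \<le> 1 - exp (- 2 * pi * Im z)" by simp
  also have "\<dots> \<le> norm (1 - q)" unfolding q_def by (rule norm_one_minus_exp_ge[OF Im])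
  finally have d: "1 - exp (- pi * c) \<le> norm (1 - q)" .
  have d0: "1 - exp (- pi * c) > 0" using c by simp
  have q1: "1 - q \<noteq> 0" using d d0 by auto
  have "norm q \<le> 1 / (c * norm z)"
  proof -
    have "c * norm z \<le> 2 * pi * Im z"
      using z(1) pi_ge_two Im mult_right_mono[of 1 "2 * pi" "Im z"] by linarith
    also have "\<dots> \<le> exp (2 * pi * Im z)" using exp_ge_add_one_self[of "2 * pi * Im z"] by linarith
    finally have "c * norm z \<le> exp (2 * pi * Im z)" .
    thus ?thesis unfolding nq using cz by (simp add: exp_minus field_simps)
  qed
  moreover have "norm (inverse (Gamma_star (- z)) - 1) \<le> 1 / norm z"
    using Gamma_star_minus_1_bound(2)[of "- z"] z by simp
  moreover have "norm (inverse (Gamma_star (- z)) - 1 + q) \<le> norm (inverse (Gamma_star (- z)) - 1) + norm q"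
    by (rule norm_triangle_ineq)
  ultimately have n: "norm (inverse (Gamma_star (- z)) - 1 + q) \<le> (1 + 1 / c) / norm z"
    by (simp add: add_divide_distrib)
  have "Gamma_star z - 1 = (inverse (Gamma_star (- z)) - 1 + q) / (1 - q)"
  proof -
    define a where "a = inverse (Gamma_star (- z))"
    show ?thesis
      unfolding Gamma_star_left[OF Im] q_def[symmetric] a_def[symmetric] using q1 by (simp add: field_simps)
  qed
  hence "norm (Gamma_star z - 1) = norm (inverse (Gamma_star (- z)) - 1 + q) / norm (1 - q)"
    by (simp add: norm_divide)
  also have "\<dots> \<le> ((1 + 1 / c) / norm z) / (1 - exp (- pi * c))"
    using n d d0 c by (intro frac_le) auto
  finally show ?thesis by (simp add: mult.commute)
qed

lemma exp_Complex_notin_nonpos_Reals: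
  assumes "\<bar>y\<bar> < pi"
  shows "exp (Complex x y) \<notin> \<real>\<^sub>\<le>\<^sub>0"
proof
  assume "exp (Complex x y) \<in> \<real>\<^sub>\<le>\<^sub>0"
  hence *: "cos y \<le> 0" "sin y = 0"
    by (auto simp: complex_nonpos_Reals_iff Re_exp Im_exp mult_le_0_iff)
  from *(2) assms have "y = 0" using sin_eq_0_pi[of y] by auto
  with *(1) show False by simp
qed

text \<open>The closed sector is the one cut out by the two separating rays. The factor 1 + exp (- x
  / 2) is 1 + |z|^(-1/2) and records the singularity at the origin. Beyond the imaginary axis the
  reflection formula takes over, with c = cos phi the least value of sin (arg z).\<close>

lemma Gamma_star_sector_bound:
  assumes \<phi>: "0 \<le> \<phi>" "\<phi> < pi / 2"
  shows "\<exists>C\<ge>1. \<forall>x y. - pi / 2 \<le> y \<longrightarrow> y \<le> pi / 2 + \<phi> \<longrightarrow>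
           norm (Gamma_star (exp (Complex x y))) \<le> C * (1 + exp (- x / 2)) \<and>
           (x \<ge> 0 \<longrightarrow> norm (Gamma_star (exp (Complex x y)) - 1) \<le> C * exp (- x))"
proof -
  define c where "c = cos \<phi>"
  have c: "c > 0" unfolding c_def using \<phi> by (intro cos_gt_zero_pi) auto
  define C1 where "C1 = (1 + 1 / c) / (1 - exp (- pi * c))"
  have C1: "C1 \<ge> 1"
  proof -
    have "1 - exp (- pi * c) > 0" "1 - exp (- pi * c) \<le> 1" "1 + 1 / c \<ge> 1" using c by auto
    thus ?thesis unfolding C1_def by (subst le_divide_eq_1_pos) linarith+
  qed
  obtain C2 where C2: "C2 > 0" "\<And>z. z \<notin> \<real>\<^sub>\<le>\<^sub>0 \<Longrightarrow> norm z \<le> 1 / 2 \<Longrightarrow> norm (Gamma_star z) \<le> C2 / sqrt (norm z)"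
    using Gamma_star_bound_near_0 by blast
  have far: "norm (Gamma_star (exp (Complex x y)) - 1) \<le> C1 / exp x"
    if y: "- pi / 2 \<le> y" "y \<le> pi / 2 + \<phi>" and x: "exp x \<ge> 1 / 2" for x y
  proof (cases "y \<le> pi / 2")
    case True
    have "norm (Gamma_star (exp (Complex x y)) - 1) \<le> 1 / exp x"
      using Gamma_star_minus_1_bound(1)[of "exp (Complex x y)"] x y True cos_ge_zero[of y]
      by (simp add: norm_exp_Complex Re_exp)
    also have "\<dots> \<le> C1 / exp x" using C1 by (intro divide_right_mono) auto
    finally show ?thesis .
  next
    case False
    have "cos y \<le> 0" using cos_ge_zero[of "pi - y"] False y \<phi> by simp
    moreover have "sin y \<ge> c"
    proof -
      have "cos (y - pi / 2) \<ge> cos \<phi>"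
        using False y \<phi> by (intro cos_monotone_0_pi_le) auto
      thus ?thesis by (simp add: c_def cos_diff)
    qed
    ultimately show ?thesis
      using Gamma_star_left_minus_1_bound[OF c, of "exp (Complex x y)"] x
      by (simp add: norm_exp_Complex Re_exp Im_exp mult_le_0_iff C1_def mult.commute)
  qed
  define C where "C = 1 + 2 * C1 + C2"
  show ?thesis
  proof (intro exI[of _ C] conjI allI impI)
    show "C \<ge> 1" using C1 C2(1) by (simp add: C_def)
  next
    fix x y assume y: "- pi / 2 \<le> y" "y \<le> pi / 2 + \<phi>" and x: "x \<ge> (0::real)"
    have "exp x \<ge> 1" using x by simp
    hence "exp x \<ge> 1 / 2" by linarith
    from far[OF y this] have "norm (Gamma_star (exp (Complex x y)) - 1) \<le> C1 * exp (- x)"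
      by (simp add: exp_minus divide_inverse)
    also have "\<dots> \<le> C * exp (- x)" using C1 C2(1) by (intro mult_right_mono) (auto simp: C_def)
    finally show "norm (Gamma_star (exp (Complex x y)) - 1) \<le> C * exp (- x)" .
  next
    fix x y assume y: "- pi / 2 \<le> y" "y \<le> pi / 2 + \<phi>"
    show "norm (Gamma_star (exp (Complex x y))) \<le> C * (1 + exp (- x / 2))"
    proof (cases "exp x \<ge> 1 / 2")
      case True
      have "norm (Gamma_star (exp (Complex x y))) \<le> norm (Gamma_star (exp (Complex x y)) - 1) + norm (1::complex)"
        by (metis diff_add_cancel norm_triangle_ineq)
      also have "\<dots> \<le> C1 / exp x + 1" using far[OF y True] by simp
      also have "C1 / exp x \<le> C1 / (1 / 2)" using True C1 by (intro divide_left_mono) auto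
      also have "C1 / (1 / 2) + 1 \<le> C * 1" using C2(1) by (simp add: C_def)
      also have "C * 1 \<le> C * (1 + exp (- x / 2))"
        using C1 C2(1) by (intro mult_left_mono) (auto simp: C_def)
      finally show ?thesis by simp
    next
      case False
      have "norm (Gamma_star (exp (Complex x y))) \<le> C2 / sqrt (norm (exp (Complex x y)))"
      proof (rule C2(2))
        show "exp (Complex x y) \<notin> \<real>\<^sub>\<le>\<^sub>0"
          by (rule exp_Complex_notin_nonpos_Reals) (use y \<phi> in linarith)
        show "norm (exp (Complex x y)) \<le> 1 / 2" using False by (simp add: norm_exp_Complex)
      qed
      also have "sqrt (norm (exp (Complex x y))) = exp (x / 2)"
      proof (rule real_sqrt_unique)
        show "(exp (x / 2))\<^sup>2 = norm (exp (Complex x y))"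
          unfolding norm_exp_Complex power2_eq_square exp_add[symmetric] by simp
      qed simp
      also have "C2 / exp (x / 2) = C2 * exp (- x / 2)"
        unfolding minus_divide_left[symmetric] exp_minus divide_inverse[of C2] ..
      also have "\<dots> \<le> C * (1 + exp (- x / 2))"
        using C1 C2(1) by (intro mult_mono) (auto simp: C_def)
      finally show ?thesis .
    qed
  qed
qed

text \<open>The argument of exp (binet (i s)) lies in (-pi/2, 0].\<close>

lemma Gamma_star_imaginary_signs:
  assumes "s > 0"
  shows "Re (Gamma_star (\<i> * of_real s)) > 0" "Im (Gamma_star (\<i> * of_real s)) \<le> 0"
proof -
  have G: "Gamma_star (\<i> * of_real s) = exp (binet (\<i> * of_real s))"
    using assms by (intro Gamma_star_eq_exp_binet) auto
  note I = Im_binet_imaginary[OF assms]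
  have "cos (Im (binet (\<i> * of_real s))) > 0"
    using I pi_gt_zero by (intro cos_gt_zero_pi) (auto simp del: pi_gt_zero)
  thus "Re (Gamma_star (\<i> * of_real s)) > 0" unfolding G Re_exp by simp
  have "sin (- Im (binet (\<i> * of_real s))) \<ge> 0"
    using I pi_gt_zero by (intro sin_ge_zero) auto
  thus "Im (Gamma_star (\<i> * of_real s)) \<le> 0" unfolding G Im_exp
    by (simp add: mult_le_0_iff)
qed

section \<open>A Plemelj formula across two rays\<close>

lemma integrable_exp_neg_abs:
  fixes \<delta> :: real
  assumes "\<delta> > 0"
  shows "integrable lborel (\<lambda>x. exp (- \<delta> * \<bar>x\<bar>))"
proof -
  have hi: "((\<lambda>x. exp (- \<delta> * x)) has_integral exp (- \<delta> * 0) / \<delta>) {0..}"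
    using has_integral_exp_minus_to_infinity[OF assms, of 0] by simp
  have "(\<lambda>x. exp (- \<delta> * x)) absolutely_integrable_on {0..}"
    by (rule nonnegative_absolutely_integrable_1) (use hi in \<open>auto intro: has_integral_integrable\<close>)
  moreover have "set_borel_measurable borel {0..} (\<lambda>x. exp (- \<delta> * x))"
    unfolding set_borel_measurable_def
    by (intro borel_measurable_continuous_on_indicator continuous_intros) auto
  ultimately have 1: "integrable lborel (\<lambda>x. indicator {0..} x *\<^sub>R exp (- \<delta> * x))"
    using absolutely_integrable_iff_lborel[of "{0..}"] by (simp add: set_integrable_def)
  have 2: "integrable lborel (\<lambda>x. indicator {0..} (-x) *\<^sub>R exp (- \<delta> * (-x)))"
    using lborel_integrable_real_affine[OF 1, of "-1" 0] by simp
  show ?thesis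
    by (rule Bochner_Integration.integrable_bound[OF Bochner_Integration.integrable_add[OF 1 2]])
       (auto simp: indicator_def abs_if)
qed

lemma integrable_of_exp_decay:
  fixes f :: "real \<Rightarrow> complex"
  assumes cont: "continuous_on UNIV f" and \<delta>: "\<delta> > 0"
    and bound: "\<And>x. X \<le> \<bar>x\<bar> \<Longrightarrow> norm (f x) \<le> B * exp (- \<delta> * \<bar>x\<bar>)"
  shows "integrable lborel f"
proof -
  have "compact (f ` {-X..X})"
    by (intro compact_continuous_image continuous_on_subset[OF cont]) auto
  then obtain M where M: "M > 0" "\<And>x. x \<in> {-X..X} \<Longrightarrow> norm (f x) \<le> M"
    using compact_imp_bounded bounded_pos by (metis imageI)
  show ?thesis
  proof (rule Bochner_Integration.integrable_bound)
    \<comment> \<open>On |x| < X the factor exp (delta X) makes this majorant at least M, the bound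
      on the compact part.\<close>
    show "integrable lborel (\<lambda>x. (M * exp (\<delta> * X) + \<bar>B\<bar>) * exp (- \<delta> * \<bar>x\<bar>))"
      using integrable_exp_neg_abs[OF \<delta>] by simp
    show "f \<in> borel_measurable lborel" using borel_measurable_continuous_onI[OF cont] by simp
    show "AE x in lborel. norm (f x) \<le> norm ((M * exp (\<delta> * X) + \<bar>B\<bar>) * exp (- \<delta> * \<bar>x\<bar>))"
    proof (rule AE_I2)
      fix x
      have nn: "(M * exp (\<delta> * X) + \<bar>B\<bar>) * exp (- \<delta> * \<bar>x\<bar>) \<ge> 0" using M(1) by simp
      have "norm (f x) \<le> (M * exp (\<delta> * X) + \<bar>B\<bar>) * exp (- \<delta> * \<bar>x\<bar>)"
      proof (cases "X \<le> \<bar>x\<bar>")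
        case True
        have "norm (f x) \<le> B * exp (- \<delta> * \<bar>x\<bar>)" by (rule bound[OF True])
        also have "\<dots> \<le> (M * exp (\<delta> * X) + \<bar>B\<bar>) * exp (- \<delta> * \<bar>x\<bar>)"
          using M(1) by (intro mult_right_mono) (auto intro: order_trans[OF abs_ge_self])
        finally show ?thesis .
      next
        case False
        have "norm (f x) \<le> M * 1" using False M(2)[of x] by (auto simp: abs_if split: if_splits)
        also have "1 \<le> exp (\<delta> * X + - \<delta> * \<bar>x\<bar>)" using False \<delta> by simp
        also have "\<dots> = exp (\<delta> * X) * exp (- \<delta> * \<bar>x\<bar>)" by (rule exp_add)
        finally have "norm (f x) \<le> M * (exp (\<delta> * X) * exp (- \<delta> * \<bar>x\<bar>))" using M(1) by simp
        also have "\<dots> \<le> (M * exp (\<delta> * X) + \<bar>B\<bar>) * exp (- \<delta> * \<bar>x\<bar>)"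
          by (simp add: distrib_right mult.assoc)
        finally show ?thesis .
      qed
      thus "norm (f x) \<le> norm ((M * exp (\<delta> * X) + \<bar>B\<bar>) * exp (- \<delta> * \<bar>x\<bar>))" using nn by simp
    qed
  qed
qed

lemma tendsto_exp_neg_abs:
  fixes \<delta> B :: real
  assumes "\<delta> > 0"
  shows "((\<lambda>x. B * exp (- \<delta> * \<bar>x\<bar>)) \<longlongrightarrow> 0) at_top" "((\<lambda>x. B * exp (- \<delta> * \<bar>x\<bar>)) \<longlongrightarrow> 0) at_bot"
proof -
  have *: "((\<lambda>x. B * exp (- \<delta> * x)) \<longlongrightarrow> 0) at_top" using assms by real_asymp
  show 1: "((\<lambda>x. B * exp (- \<delta> * \<bar>x\<bar>)) \<longlongrightarrow> 0) at_top"
    by (rule Lim_transform_eventually[OF *])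
       (auto intro: eventually_mono[OF eventually_ge_at_top[of 0]])
  show "((\<lambda>x. B * exp (- \<delta> * \<bar>x\<bar>)) \<longlongrightarrow> 0) at_bot"
    using 1 by (simp add: filterlim_at_bot_mirror)
qed

lemma continuous_on_horizontal:
  assumes "h holomorphic_on A" "\<And>x. Complex x a \<in> A"
  shows "continuous_on UNIV (\<lambda>x. h (Complex x a))"
proof (rule continuous_on_compose2[OF holomorphic_on_imp_continuous_on[OF assms(1)]])
  show "continuous_on UNIV (\<lambda>x. Complex x a)" unfolding Complex_eq by (intro continuous_intros)
qed (use assms(2) in auto)

text \<open>With a majorant B e^(-delta |x|) in the whole strip, a single estimate yields both the
  decay of the vertical sides and integrability on the boundary lines.\<close>

lemma strip_residue_exp:
  fixes h :: "complex \<Rightarrow> complex"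
  assumes ab: "a < b" and U: "open U" "\<And>z. a \<le> Im z \<Longrightarrow> Im z \<le> b \<Longrightarrow> z \<in> U"
    and holo: "h holomorphic_on U - {p}" and p: "a < Im p" "Im p < b" and \<delta>: "\<delta> > 0"
    and bound: "\<And>x y. a \<le> y \<Longrightarrow> y \<le> b \<Longrightarrow> X \<le> \<bar>x\<bar> \<Longrightarrow> norm (h (Complex x y)) \<le> B * exp (- \<delta> * \<bar>x\<bar>)"
  shows "integrable lborel (\<lambda>x. h (Complex x a))" "integrable lborel (\<lambda>x. h (Complex x b))"
    and "(LINT x|lborel. h (Complex x a)) - (LINT x|lborel. h (Complex x b)) =
           2 * pi * \<i> * residue h p"
proof -
  have "Complex x a \<in> U - {p}" "Complex x b \<in> U - {p}" for x
    using U(2)[of "Complex x a"] U(2)[of "Complex x b"] ab p by auto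
  hence c: "continuous_on UNIV (\<lambda>x. h (Complex x a))" "continuous_on UNIV (\<lambda>x. h (Complex x b))"
    using continuous_on_horizontal[OF holo] by blast+
  show *: "integrable lborel (\<lambda>x. h (Complex x a))" "integrable lborel (\<lambda>x. h (Complex x b))"
    using ab by (auto intro!: integrable_of_exp_decay[OF c(1) \<delta> bound] integrable_of_exp_decay[OF c(2) \<delta> bound])
  show "(LINT x|lborel. h (Complex x a)) - (LINT x|lborel. h (Complex x b)) =
           2 * pi * \<i> * residue h p"
    by (rule strip_residue[OF ab U holo p bound tendsto_exp_neg_abs[OF \<delta>] *])
qed

lemma strip_shift_exp:
  fixes h :: "complex \<Rightarrow> complex"
  assumes ab: "a \<le> b" and U: "open U" "\<And>z. a \<le> Im z \<Longrightarrow> Im z \<le> b \<Longrightarrow> z \<in> U"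
    and holo: "h holomorphic_on U" and \<delta>: "\<delta> > 0"
    and bound: "\<And>x y. a \<le> y \<Longrightarrow> y \<le> b \<Longrightarrow> X \<le> \<bar>x\<bar> \<Longrightarrow> norm (h (Complex x y)) \<le> B * exp (- \<delta> * \<bar>x\<bar>)"
  shows "integrable lborel (\<lambda>x. h (Complex x a))" "integrable lborel (\<lambda>x. h (Complex x b))"
    and "(LINT x|lborel. h (Complex x a)) = (LINT x|lborel. h (Complex x b))"
proof -
  have "Complex x a \<in> U" "Complex x b \<in> U" for x
    using U(2)[of "Complex x a"] U(2)[of "Complex x b"] ab by auto
  hence c: "continuous_on UNIV (\<lambda>x. h (Complex x a))" "continuous_on UNIV (\<lambda>x. h (Complex x b))"
    using continuous_on_horizontal[OF holo] by blast+
  show *: "integrable lborel (\<lambda>x. h (Complex x a))" "integrable lborel (\<lambda>x. h (Complex x b))"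
    using ab by (auto intro!: integrable_of_exp_decay[OF c(1) \<delta> bound] integrable_of_exp_decay[OF c(2) \<delta> bound])
  show "(LINT x|lborel. h (Complex x a)) = (LINT x|lborel. h (Complex x b))"
    by (rule strip_shift[OF ab U holo bound tendsto_exp_neg_abs[OF \<delta>] *])
qed

text \<open>The Cauchy kernel in logarithmic coordinates: bounded far out, and of order |u| near the
  origin, where it compensates the singularity of \<open>Gamma_star\<close>. The margin 2 in the
  exponent separates |u| and |z| by a factor e^2 >= 2.\<close>

lemma norm_ratio_le:
  fixes u z :: complex
  assumes u: "norm u = exp x" and z: "norm z = exp r"
  shows "x \<ge> \<bar>r\<bar> + 2 \<Longrightarrow> norm (u / (u - z)) \<le> 2"
    and "x \<le> - (\<bar>r\<bar> + 2) \<Longrightarrow> norm (u / (u - z)) \<le> 2 * exp (- r) * exp x"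
proof -
  have e2: "2 \<le> exp (2::real)" using exp_ge_add_one_self[of "2::real"] by simp
  {
    assume "x \<ge> \<bar>r\<bar> + 2"
    hence "exp (r + 2) \<le> exp x" by simp
    hence "exp r * exp 2 \<le> exp x" by (simp only: exp_add)
    moreover have "exp r * 2 \<le> exp r * exp 2" by (rule mult_left_mono[OF e2]) simp
    ultimately have "exp x / 2 \<le> exp x - exp r" by linarith
    also have "\<dots> \<le> norm (u - z)" using norm_triangle_ineq2[of u z] by (simp add: u z)
    finally have "exp x / 2 \<le> norm (u - z)" .
    thus "norm (u / (u - z)) \<le> 2"
      unfolding norm_divide u using exp_gt_zero[of x] by (subst divide_le_eq) auto
  }
  {
    assume "x \<le> - (\<bar>r\<bar> + 2)"
    hence "exp (x + 2) \<le> exp r" by simp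
    hence "exp x * exp 2 \<le> exp r" by (simp only: exp_add)
    moreover have "exp x * 2 \<le> exp x * exp 2" by (rule mult_left_mono[OF e2]) simp
    ultimately have "exp r / 2 \<le> exp r - exp x" by linarith
    also have "\<dots> \<le> norm (u - z)" using norm_triangle_ineq3[of u z] by (simp add: u z)
    finally have "exp r / 2 \<le> norm (u - z)" .
    hence "norm u / norm (u - z) \<le> exp x / (exp r / 2)"
      unfolding u using exp_gt_zero[of r] by (intro divide_left_mono mult_pos_pos) (linarith | simp)+
    thus "norm (u / (u - z)) \<le> 2 * exp (- r) * exp x"
      by (simp add: norm_divide exp_minus field_simps)
  }
qed

text \<open>All rays are parametrised by \<open>x = ln |w|\<close>, so that rotating a ray is a shift in a strip.\<close>

definition upper_ray :: "real \<Rightarrow> real \<Rightarrow> complex" where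
  "upper_ray \<phi> x = exp (Complex x (pi / 2 + \<phi>))"

definition lower_ray :: "real \<Rightarrow> complex" where
  "lower_ray x = exp (Complex x (- (pi / 2)))"

text \<open>Defined as a product because its decay is then visible; by the reflection formula it is
  the difference of \<open>Gamma_star\<close> at w and the reciprocal of \<open>Gamma_star\<close>
  at -w, see \<open>upper_jump_eq\<close>.\<close>

definition upper_jump :: "real \<Rightarrow> real \<Rightarrow> complex" where
  "upper_jump \<phi> x = Gamma_star (upper_ray \<phi> x) * exp (2 * pi * \<i> * upper_ray \<phi> x)"

definition lower_jump :: "real \<Rightarrow> complex" where
  "lower_jump x = Gamma_star (lower_ray x) * exp (- (2 * pi * \<i> * lower_ray x))"

lemma norm_upper_ray [simp]: "norm (upper_ray \<phi> x) = exp x"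
  and norm_lower_ray [simp]: "norm (lower_ray x) = exp x"
  by (simp_all add: upper_ray_def lower_ray_def norm_exp_Complex)

lemma Re_upper_ray: "Re (upper_ray \<phi> x) = - exp x * sin \<phi>"
  and Im_upper_ray: "Im (upper_ray \<phi> x) = exp x * cos \<phi>"
  by (simp_all add: upper_ray_def Re_exp Im_exp cos_add sin_add)

lemma Re_lower_ray: "Re (lower_ray x) = 0"
  and Im_lower_ray: "Im (lower_ray x) = - exp x"
  by (simp_all add: lower_ray_def Re_exp Im_exp)

lemma lower_ray_eq: "lower_ray x = - \<i> * of_real (exp x)"
  by (rule complex_eqI) (simp_all add: Re_lower_ray Im_lower_ray)

lemma exp_Complex_minus_pi: "exp (Complex x (y - pi)) = - exp (Complex x y)"
  by (rule complex_eqI) (simp_all add: Re_exp Im_exp cos_diff sin_diff)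

lemma upper_jump_eq:
  assumes "0 \<le> \<phi>" "\<phi> < pi / 2"
  shows "upper_jump \<phi> x = Gamma_star (upper_ray \<phi> x) - inverse (Gamma_star (- upper_ray \<phi> x))"
proof -
  have "cos \<phi> > 0" using assms by (intro cos_gt_zero_pi) auto
  hence Im: "Im (upper_ray \<phi> x) > 0" by (simp add: Im_upper_ray)
  define a b q where "a = Gamma_star (upper_ray \<phi> x)" and "b = Gamma_star (- upper_ray \<phi> x)"
    and "q = exp (2 * pi * \<i> * upper_ray \<phi> x)"
  have abq: "a * b * (1 - q) = 1"
    using Gamma_star_reflection[OF Im] by (simp add: a_def b_def q_def)
  hence "b \<noteq> 0" by auto
  with abq have "inverse b = a * (1 - q)" by (simp add: field_simps)
  hence "a * q = a - inverse b" by (simp add: algebra_simps)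
  thus ?thesis by (simp add: upper_jump_def a_def b_def q_def)
qed

lemma lower_jump_eq:
  "lower_jump x = Gamma_star (lower_ray x) - inverse (Gamma_star (- lower_ray x))"
proof -
  have Im: "Im (- lower_ray x) > 0" by (simp add: Im_lower_ray)
  define a b q where "a = Gamma_star (lower_ray x)" and "b = Gamma_star (- lower_ray x)"
    and "q = exp (- (2 * pi * \<i> * lower_ray x))"
  have abq: "b * a * (1 - q) = 1"
    using Gamma_star_reflection[OF Im] by (simp add: a_def b_def q_def)
  hence "b \<noteq> 0" by auto
  with abq have "inverse b = a * (1 - q)" by (simp add: field_simps)
  hence "a * q = a - inverse b" by (simp add: algebra_simps)
  thus ?thesis by (simp add: lower_jump_def a_def b_def q_def)
qed

lemma exp_strip_holomorphic:
  "(\<lambda>w. Gamma_star (exp w)) holomorphic_on {w. \<bar>Im w\<bar> < pi}"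
proof -
  have "Gamma_star \<circ> exp holomorphic_on {w. \<bar>Im w\<bar> < pi}"
  proof (rule holomorphic_on_compose_gen[OF _ Gamma_star_holomorphic])
    show "exp ` {w. \<bar>Im w\<bar> < pi} \<subseteq> - \<real>\<^sub>\<le>\<^sub>0"
    proof (rule image_subsetI)
      fix w :: complex assume "w \<in> {w. \<bar>Im w\<bar> < pi}"
      hence "exp (Complex (Re w) (Im w)) \<notin> \<real>\<^sub>\<le>\<^sub>0" by (intro exp_Complex_notin_nonpos_Reals) auto
      thus "exp w \<in> - \<real>\<^sub>\<le>\<^sub>0" by simp
    qed
  qed (intro holomorphic_intros)
  thus ?thesis by (simp only: o_def)
qed

lemma open_Im_strip: "open {w. \<bar>Im w\<bar> < c}"
  by (intro open_Collect_less continuous_intros)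

text \<open>Cauchy's formula in logarithmic coordinates, where du / (u - z) with u = e^w becomes e^w
  / (e^w - z) dw. Subtracting 1 from \<open>Gamma_star\<close> produces decay at infinity; at the
  origin the factor |u| of the kernel outweighs |u|^(-1/2).\<close>

lemma Gamma_star_plemelj_right:
  fixes r \<phi> \<omega> :: real
  assumes \<phi>: "0 \<le> \<phi>" "\<phi> < pi / 2" and \<omega>: "- (pi / 2) < \<omega>" "\<omega> < pi / 2 + \<phi>"
  defines "z \<equiv> exp (Complex r \<omega>)"
  defines "h \<equiv> \<lambda>w. (Gamma_star (exp w) - 1) * (exp w / (exp w - z))"
  shows "integrable lborel (\<lambda>x. h (Complex x (- (pi / 2))))"
    and "integrable lborel (\<lambda>x. h (Complex x (pi / 2 + \<phi>)))"
    and "(LINT x|lborel. h (Complex x (- (pi / 2)))) - (LINT x|lborel. h (Complex x (pi / 2 + \<phi>))) =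
           2 * pi * \<i> * (Gamma_star z - 1)"
proof -
  define p where "p = Complex r \<omega>"
  define U where "U = {w. \<bar>Im w\<bar> < pi}"
  have oU: "open U" unfolding U_def by (rule open_Im_strip)
  have abs\<omega>: "\<bar>\<omega>\<bar> < pi" unfolding abs_less_iff using \<phi> \<omega> pi_gt_zero by (intro conjI; linarith)
  hence pU: "p \<in> U" by (simp add: p_def U_def)
  \<comment> \<open>exp is injective on the strip |Im w| < pi, because imaginary parts there differ
    by less than 2 pi; so p is the only pole.\<close>
  have ne: "exp w - z \<noteq> 0" if "w \<in> U - {p}" for w
  proof
    assume "exp w - z = 0"
    hence e: "exp w = exp p" unfolding z_def p_def by (rule iffD1[OF right_minus_eq])
    have "\<bar>Im w\<bar> < pi" using that by (simp add: U_def)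
    hence "\<bar>Im w - Im p\<bar> < 2 * pi" using abs\<omega> abs_triangle_ineq4[of "Im w" "Im p"] by (simp add: p_def)
    from this e have "w = p" by (rule exp_complex_eqI)
    thus False using that by simp
  qed
  have F: "(\<lambda>w. (Gamma_star (exp w) - 1) * exp w) holomorphic_on U"
    unfolding U_def by (intro holomorphic_intros exp_strip_holomorphic)
  have holo: "h holomorphic_on U - {p}"
    unfolding h_def using ne
    by (intro holomorphic_intros holomorphic_on_subset[OF exp_strip_holomorphic]) (auto simp: U_def)
  have res: "residue h p = Gamma_star z - 1"
  proof (rule residue_simple'[OF oU pU holo])
    have "isCont (\<lambda>w. (Gamma_star (exp w) - 1) * exp w) p"
      using bspec[OF iffD1[OF continuous_on_eq_continuous_at[OF oU] holomorphic_on_imp_continuous_on[OF F]] pU] .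
    hence 1: "((\<lambda>w. (Gamma_star (exp w) - 1) * exp w) \<longlongrightarrow> (Gamma_star (exp p) - 1) * exp p) (at p)"
      by (simp add: isCont_def)
    have "((\<lambda>w. (exp w - exp p) / (w - p)) \<longlongrightarrow> exp p) (at p)"
      using DERIV_exp[of p] by (simp add: has_field_derivative_iff)
    from tendsto_mult[OF 1 tendsto_inverse[OF this]]
    have "((\<lambda>w. (Gamma_star (exp w) - 1) * exp w * inverse ((exp w - exp p) / (w - p))) \<longlongrightarrow>
            (Gamma_star (exp p) - 1) * exp p * inverse (exp p)) (at p)" by simp
    moreover have "(Gamma_star (exp w) - 1) * exp w * inverse ((exp w - exp p) / (w - p)) = h w * (w - p)" for w
      by (simp add: h_def z_def p_def)
    ultimately have "((\<lambda>w. h w * (w - p)) \<longlongrightarrow> (Gamma_star (exp p) - 1) * exp p * inverse (exp p)) (at p)"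
      by (simp only:)
    thus "((\<lambda>w. h w * (w - p)) \<longlongrightarrow> Gamma_star z - 1) (at p)"
      unfolding mult.assoc right_inverse[OF exp_not_eq_zero] mult_1_right by (simp only: z_def p_def)
  qed
  obtain C where C: "C \<ge> 1"
    "\<And>x y. - pi / 2 \<le> y \<Longrightarrow> y \<le> pi / 2 + \<phi> \<Longrightarrow> norm (Gamma_star (exp (Complex x y))) \<le> C * (1 + exp (- x / 2))"
    "\<And>x y. - pi / 2 \<le> y \<Longrightarrow> y \<le> pi / 2 + \<phi> \<Longrightarrow> x \<ge> 0 \<Longrightarrow> norm (Gamma_star (exp (Complex x y)) - 1) \<le> C * exp (- x)"
    using Gamma_star_sector_bound[OF \<phi>] by blast
  \<comment> \<open>2 C comes from the end at infinity (decay C e^(-x), kernel bound 2), and 6 C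
    e^(-r) from the origin (3 C e^(-x/2) times the kernel bound 2 e^(-r) e^x). Both parts decay at
    least like e^(-|x|/2).\<close>
  define B where "B = 2 * C + 6 * C * exp (- r)"
  have bound: "norm (h (Complex x y)) \<le> B * exp (- (1 / 2) * \<bar>x\<bar>)"
    if y: "- (pi / 2) \<le> y" "y \<le> pi / 2 + \<phi>" and x: "\<bar>r\<bar> + 2 \<le> \<bar>x\<bar>" for x y
  proof (cases "x \<ge> 0")
    case True
    have "norm (h (Complex x y)) \<le> (C * exp (- x)) * 2"
      unfolding h_def norm_mult using True x y C(1)
      by (intro mult_mono C(3) norm_ratio_le(1)[where x = x and r = r])
         (auto simp: norm_exp_Complex z_def)
    also have "\<dots> = (2 * C) * exp (- x)" by simp
    also have "\<dots> \<le> B * exp (- (1 / 2) * \<bar>x\<bar>)"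
      using C(1) True by (intro mult_mono) (auto simp: B_def)
    finally show ?thesis .
  next
    case False
    have "norm (Gamma_star (exp (Complex x y)) - 1) \<le> norm (Gamma_star (exp (Complex x y))) + norm (1::complex)"
      by (rule norm_triangle_ineq4)
    also have "\<dots> \<le> C * (1 + exp (- x / 2)) + 1" using C(2)[of y x] y by simp
    also have "\<dots> \<le> C * (exp (- x / 2) + exp (- x / 2)) + C * exp (- x / 2)"
    proof (intro add_mono mult_left_mono)
      have 1: "1 \<le> exp (- x / 2)" using False by simp
      thus "1 \<le> exp (- x / 2)" .
      show "1 \<le> C * exp (- x / 2)" using mult_mono[OF C(1) 1] C(1) by simp
    qed (use C(1) in auto)
    also have "\<dots> = 3 * C * exp (- x / 2)" by simp
    finally have "norm (h (Complex x y)) \<le> (3 * C * exp (- x / 2)) * (2 * exp (- r) * exp x)"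
      unfolding h_def norm_mult using False x C(1)
      by (intro mult_mono norm_ratio_le(2)) (auto simp: norm_exp_Complex z_def)
    also have "\<dots> = (6 * C * exp (- r)) * (exp (- x / 2) * exp x)" by simp
    also have "exp (- x / 2) * exp x = exp (- (1 / 2) * \<bar>x\<bar>)"
      using False by (simp flip: exp_add)
    also have "(6 * C * exp (- r)) * exp (- (1 / 2) * \<bar>x\<bar>) \<le> B * exp (- (1 / 2) * \<bar>x\<bar>)"
      using C(1) by (intro mult_right_mono) (auto simp: B_def)
    finally show ?thesis .
  qed
  have ab: "- (pi / 2) < pi / 2 + \<phi>" using \<omega> by linarith
  have U2: "w \<in> U" if "- (pi / 2) \<le> Im w" "Im w \<le> pi / 2 + \<phi>" for w
    using that \<phi> pi_gt_zero unfolding U_def by (simp add: abs_less_iff)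
  have p: "- (pi / 2) < Im p" "Im p < pi / 2 + \<phi>" using \<omega> by (auto simp: p_def)
  have half: "(1 / 2 :: real) > 0" by simp
  note * = strip_residue_exp[OF ab oU U2 holo p half bound]
  show "integrable lborel (\<lambda>x. h (Complex x (- (pi / 2))))" by (rule *(1))
  show "integrable lborel (\<lambda>x. h (Complex x (pi / 2 + \<phi>)))" by (rule *(2))
  show "(LINT x|lborel. h (Complex x (- (pi / 2)))) - (LINT x|lborel. h (Complex x (pi / 2 + \<phi>))) =
           2 * pi * \<i> * (Gamma_star z - 1)"
    unfolding res[symmetric] by (rule *(3))
qed

text \<open>The left sector, reflected into the right half-plane by a change of sign. The kernel has
  its pole at -z, whose argument omega - pi lies outside [phi - pi/2, pi/2] modulo 2 pi, so the two
  boundary integrals agree.\<close>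

lemma Gamma_star_plemelj_left:
  fixes r \<phi> \<omega> :: real
  assumes \<phi>: "0 \<le> \<phi>" "\<phi> < pi / 2" and \<omega>: "- (pi / 2) < \<omega>" "\<omega> < pi / 2 + \<phi>"
  defines "z \<equiv> exp (Complex r \<omega>)"
  defines "h \<equiv> \<lambda>w. (inverse (Gamma_star (exp w)) - 1) * (exp w / (exp w + z))"
  shows "integrable lborel (\<lambda>x. h (Complex x (\<phi> - pi / 2)))"
    and "integrable lborel (\<lambda>x. h (Complex x (pi / 2)))"
    and "(LINT x|lborel. h (Complex x (\<phi> - pi / 2))) = (LINT x|lborel. h (Complex x (pi / 2)))"
proof -
  define U where "U = {w. \<bar>Im w\<bar> < pi} \<inter> {w. exp w + z \<noteq> 0}"
  have oU: "open U"
    unfolding U_def by (intro open_Int open_Im_strip open_Collect_neq continuous_intros)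
  have U2: "w \<in> U" if w: "\<phi> - pi / 2 \<le> Im w" "Im w \<le> pi / 2" for w
  proof -
    have "exp w + z \<noteq> 0"
    proof
      assume "exp w + z = 0"
      hence "exp w = - z" by (simp add: eq_neg_iff_add_eq_0)
      also have "- z = exp (Complex r (\<omega> - pi))"
        unfolding z_def exp_Complex_minus_pi ..
      finally obtain n :: int where "w = Complex r (\<omega> - pi) + complex_of_real (2 * of_int n * pi) * \<i>"
        unfolding exp_eq by auto
      hence Im: "Im w = \<omega> - pi + 2 * of_int n * pi" by (simp add: complex_eq_iff)
      show False
      proof (cases "n \<le> 0")
        case True
        hence "2 * of_int n * pi \<le> 0" by (simp add: mult_le_0_iff)
        thus False using Im w \<omega> by linarith
      next
        case False
        hence "2 * 1 * pi \<le> 2 * of_int n * pi" by (intro mult_right_mono mult_left_mono) auto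
        thus False using Im w \<omega> by linarith
      qed
    qed
    moreover have "\<bar>Im w\<bar> < pi" using w \<phi> pi_gt_zero by (simp add: abs_less_iff)
    ultimately show ?thesis by (simp add: U_def)
  qed
  have nz: "Gamma_star (exp w) \<noteq> 0" if "\<bar>Im w\<bar> < pi" for w
    using Gamma_star_nonzero[OF exp_Complex_notin_nonpos_Reals[OF that, of "Re w"]] by simp
  have holo: "h holomorphic_on U"
    unfolding h_def U_def using nz
    by (intro holomorphic_intros holomorphic_on_subset[OF exp_strip_holomorphic]) auto
  define B where "B = 2 + 4 * exp (- r)"
  have bound: "norm (h (Complex x y)) \<le> B * exp (- (1 / 2) * \<bar>x\<bar>)"
    if y: "\<phi> - pi / 2 \<le> y" "y \<le> pi / 2" and x: "\<bar>r\<bar> + 2 \<le> \<bar>x\<bar>" for x y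
  proof -
    have Re: "Re (exp (Complex x y)) \<ge> 0"
      using y \<phi> cos_ge_zero[of y] by (simp add: Re_exp)
    have e: "exp (Complex x y) / (exp (Complex x y) + z) = exp (Complex x y) / (exp (Complex x y) - (- z))"
      by simp
    have nz: "norm (- z) = exp r" by (simp add: z_def norm_exp_Complex)
    show ?thesis
    proof (cases "x \<ge> 0")
      case True
      have "exp x \<ge> 1" using True by simp
      hence "norm (exp (Complex x y)) \<ge> 1 / 2" unfolding norm_exp_Complex by linarith
      from Gamma_star_minus_1_bound(2)[OF Re this]
      have "norm (inverse (Gamma_star (exp (Complex x y))) - 1) \<le> exp (- x)"
        by (simp add: norm_exp_Complex exp_minus inverse_eq_divide)
      hence "norm (h (Complex x y)) \<le> exp (- x) * 2"
        unfolding h_def norm_mult e using True x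
        by (intro mult_mono norm_ratio_le(1)[where x = x and r = r] nz) (auto simp: norm_exp_Complex)
      also have "\<dots> = 2 * exp (- x)" by simp
      also have "\<dots> \<le> B * exp (- (1 / 2) * \<bar>x\<bar>)"
        using True by (intro mult_mono) (auto simp: B_def)
      finally show ?thesis .
    next
      case False
      have "norm (inverse (Gamma_star (exp (Complex x y))) - 1) \<le>
              norm (inverse (Gamma_star (exp (Complex x y)))) + norm (1::complex)"
        by (rule norm_triangle_ineq4)
      also have "\<dots> \<le> 2" using norm_inverse_Gamma_star_le_1[OF Re] by simp
      finally have "norm (h (Complex x y)) \<le> 2 * (2 * exp (- r) * exp x)"
        unfolding h_def norm_mult e using False x
        by (intro mult_mono norm_ratio_le(2)[where x = x and r = r] nz) (auto simp: norm_exp_Complex)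
      also have "\<dots> = (4 * exp (- r)) * exp x" by simp
      also have "\<dots> \<le> B * exp (- (1 / 2) * \<bar>x\<bar>)"
        using False by (intro mult_mono) (auto simp: B_def)
      finally show ?thesis .
    qed
  qed
  have ab: "\<phi> - pi / 2 \<le> pi / 2" using \<phi> by linarith
  have half: "(1 / 2 :: real) > 0" by simp
  note * = strip_shift_exp[OF ab oU U2 holo half bound]
  show "integrable lborel (\<lambda>x. h (Complex x (\<phi> - pi / 2)))" by (rule *(1))
  show "integrable lborel (\<lambda>x. h (Complex x (pi / 2)))" by (rule *(2))
  show "(LINT x|lborel. h (Complex x (\<phi> - pi / 2))) = (LINT x|lborel. h (Complex x (pi / 2)))"
    by (rule *(3))
qed

theorem Gamma_star_plemelj:
  fixes r \<phi> \<omega> :: real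
  assumes \<phi>: "0 \<le> \<phi>" "\<phi> < pi / 2" and \<omega>: "- (pi / 2) < \<omega>" "\<omega> < pi / 2 + \<phi>"
  defines "z \<equiv> exp (Complex r \<omega>)"
  shows "integrable lborel (\<lambda>x. lower_jump x * (lower_ray x / (lower_ray x - z)))"
    and "integrable lborel (\<lambda>x. upper_jump \<phi> x * (upper_ray \<phi> x / (upper_ray \<phi> x - z)))"
    and "2 * pi * \<i> * (Gamma_star z - 1) =
           (LINT x|lborel. lower_jump x * (lower_ray x / (lower_ray x - z))) -
           (LINT x|lborel. upper_jump \<phi> x * (upper_ray \<phi> x / (upper_ray \<phi> x - z)))"
proof -
  define h where "h = (\<lambda>w. (Gamma_star (exp w) - 1) * (exp w / (exp w - z)))"
  define k where "k = (\<lambda>w. (inverse (Gamma_star (exp w)) - 1) * (exp w / (exp w + z)))"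
  have H: "integrable lborel (\<lambda>x. h (Complex x (- (pi / 2))))"
      "integrable lborel (\<lambda>x. h (Complex x (pi / 2 + \<phi>)))"
      "(LINT x|lborel. h (Complex x (- (pi / 2)))) - (LINT x|lborel. h (Complex x (pi / 2 + \<phi>))) =
           2 * pi * \<i> * (Gamma_star z - 1)"
    using Gamma_star_plemelj_right[OF \<phi> \<omega>, of r] unfolding h_def z_def by blast+
  have K: "integrable lborel (\<lambda>x. k (Complex x (\<phi> - pi / 2)))"
      "integrable lborel (\<lambda>x. k (Complex x (pi / 2)))"
      "(LINT x|lborel. k (Complex x (\<phi> - pi / 2))) = (LINT x|lborel. k (Complex x (pi / 2)))"
    using Gamma_star_plemelj_left[OF \<phi> \<omega>, of r] unfolding k_def z_def by blast+
  \<comment> \<open>With w on a separating ray and -w its mirror image, the left kernel turns into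
    the right one, so the two integrands can be subtracted.\<close>
  have ratio: "- w / (- w + z) = w / (w - z)" for w
    by (metis add.commute minus_diff_eq minus_divide_divide uminus_add_conv_diff)
  have diff: "(a - 1) * c - (b - 1) * c = (a - b) * c" for a b c :: complex
    by (simp add: algebra_simps)
  have up: "h (Complex x (pi / 2 + \<phi>)) - k (Complex x (\<phi> - pi / 2)) =
              upper_jump \<phi> x * (upper_ray \<phi> x / (upper_ray \<phi> x - z))" for x
  proof -
    have "exp (Complex x (\<phi> - pi / 2)) = - upper_ray \<phi> x"
      using exp_Complex_minus_pi[of x "pi / 2 + \<phi>"] by (simp add: upper_ray_def algebra_simps)
    thus ?thesis
      unfolding h_def k_def upper_jump_eq[OF \<phi>] upper_ray_def[symmetric] by (simp only: ratio diff)
  qed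
  have low: "h (Complex x (- (pi / 2))) - k (Complex x (pi / 2)) =
              lower_jump x * (lower_ray x / (lower_ray x - z))" for x
  proof -
    have "exp (Complex x (pi / 2)) = - lower_ray x"
      using exp_Complex_minus_pi[of x "pi / 2"] by (simp add: lower_ray_def)
    thus ?thesis
      unfolding h_def k_def lower_jump_eq lower_ray_def[symmetric] by (simp only: ratio diff)
  qed
  show "integrable lborel (\<lambda>x. lower_jump x * (lower_ray x / (lower_ray x - z)))"
    unfolding low[symmetric] by (intro Bochner_Integration.integrable_diff H K)
  show "integrable lborel (\<lambda>x. upper_jump \<phi> x * (upper_ray \<phi> x / (upper_ray \<phi> x - z)))"
    unfolding up[symmetric] by (intro Bochner_Integration.integrable_diff H K)
  show "2 * pi * \<i> * (Gamma_star z - 1) =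
           (LINT x|lborel. lower_jump x * (lower_ray x / (lower_ray x - z))) -
           (LINT x|lborel. upper_jump \<phi> x * (upper_ray \<phi> x / (upper_ray \<phi> x - z)))"
    unfolding up[symmetric] low[symmetric]
    using H(3) K(3) by (simp add: Bochner_Integration.integral_diff H(1,2) K(1,2))
qed

section \<open>Expansion and identification of the Stirling coefficients\<close>

lemma norm_one_minus_exp_Complex_sq:
  "norm (1 - exp (Complex a b)) ^ 2 = (exp a - cos b)\<^sup>2 + (sin b)\<^sup>2"
proof -
  have "norm (1 - exp (Complex a b)) ^ 2 = (1 - exp a * cos b)\<^sup>2 + (exp a * sin b)\<^sup>2"
    by (simp add: cmod_power2 Re_exp Im_exp)
  also have "\<dots> = 1 - 2 * exp a * cos b + (exp a)\<^sup>2 * ((sin b)\<^sup>2 + (cos b)\<^sup>2)"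
    by (simp add: power2_eq_square algebra_simps
        del: sin_cos_squared_add sin_cos_squared_add2 sin_cos_squared_add3)
  also have "\<dots> = (exp a - cos b)\<^sup>2 + (1 - (cos b)\<^sup>2)"
    unfolding sin_cos_squared_add by (simp add: power2_eq_square algebra_simps)
  also have "1 - (cos b)\<^sup>2 = (sin b)\<^sup>2" by (simp add: sin_squared_eq)
  finally show ?thesis .
qed

text \<open>|sin b| is the distance of 1 from the line through 0 with direction e^(i b). This is the
  origin of the secant in the second bound.\<close>

lemma norm_one_minus_exp_Complex_ge_sin: "norm (1 - exp (Complex a b)) \<ge> \<bar>sin b\<bar>"
proof -
  have "\<bar>sin b\<bar>\<^sup>2 \<le> norm (1 - exp (Complex a b)) ^ 2"
    unfolding norm_one_minus_exp_Complex_sq by simp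
  thus ?thesis by (rule power2_le_imp_le) simp
qed

lemma norm_one_minus_ge_1:
  assumes "Re q \<le> 0"
  shows "norm (1 - q) \<ge> 1"
proof -
  have "1 \<le> Re (1 - q)" using assms by simp
  also have "\<dots> \<le> norm (1 - q)" by (rule complex_Re_le_cmod)
  finally show ?thesis .
qed

lemma continuous_upper_jump:
  assumes "0 \<le> \<phi>" "\<phi> < pi / 2"
  shows "continuous_on UNIV (upper_jump \<phi>)"
proof -
  have "continuous_on UNIV (\<lambda>x. Gamma_star (exp (Complex x (pi / 2 + \<phi>))))"
    by (rule continuous_on_horizontal[OF exp_strip_holomorphic]) (use assms in auto)
  moreover have "continuous_on UNIV (upper_ray \<phi>)"
    unfolding upper_ray_def[abs_def] Complex_eq by (intro continuous_intros)
  ultimately show ?thesis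
    unfolding upper_jump_def[abs_def] upper_ray_def[symmetric] by (intro continuous_intros)
qed

lemma continuous_upper_ray: "continuous_on UNIV (upper_ray \<phi>)"
  unfolding upper_ray_def[abs_def] Complex_eq by (intro continuous_intros)

lemma lower_ray_cnj: "lower_ray x = cnj (upper_ray 0 x)"
  by (rule complex_eqI) (simp_all add: Re_upper_ray Im_upper_ray Re_lower_ray Im_lower_ray)

lemma lower_jump_cnj: "lower_jump x = cnj (upper_jump 0 x)"
proof -
  have "upper_ray 0 x \<notin> \<real>\<^sub>\<le>\<^sub>0"
    by (rule Im_nonzero_notin_nonpos_Reals) (simp add: Im_upper_ray)
  from Gamma_star_cnj[OF this] show ?thesis
    by (simp add: lower_jump_def upper_jump_def lower_ray_cnj exp_cnj)
qed

text \<open>In x = ln |w| the measure is dw / w, so near the origin the integrand is of order |w|^(j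
  - 1/2), integrable for j >= 1; at infinity e^(2 pi i w) decays at the rate 2 pi cos phi.\<close>

lemma integrable_upper_jump_moment:
  assumes \<phi>: "0 \<le> \<phi>" "\<phi> < pi / 2" and j: "j \<ge> 1"
  shows "integrable lborel (\<lambda>x. upper_jump \<phi> x * upper_ray \<phi> x ^ j)"
proof -
  define c where "c = cos \<phi>"
  have c: "c > 0" unfolding c_def using \<phi> by (intro cos_gt_zero_pi) auto
  obtain C where C: "C \<ge> 1"
    "\<And>x y. - pi / 2 \<le> y \<Longrightarrow> y \<le> pi / 2 + \<phi> \<Longrightarrow> norm (Gamma_star (exp (Complex x y))) \<le> C * (1 + exp (- x / 2))"
    "\<And>x y. - pi / 2 \<le> y \<Longrightarrow> y \<le> pi / 2 + \<phi> \<Longrightarrow> x \<ge> 0 \<Longrightarrow> norm (Gamma_star (exp (Complex x y)) - 1) \<le> C * exp (- x)"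
    using Gamma_star_sector_bound[OF \<phi>] by blast
  have j': "real j > 0" "real j - 1 / 2 > 0" using j by auto
  have pc: "2 * pi * c > 0" using c by simp
  show ?thesis
  proof (rule Bochner_Integration.integrable_bound)
    show "integrable lborel (\<lambda>x. C * (exp (real j * x - 2 * pi * c * exp x) + exp ((real j - 1 / 2) * x - 2 * pi * c * exp x)))"
      using integrable_exp_gamma_kernel[OF j'(1) pc] integrable_exp_gamma_kernel[OF j'(2) pc]
      by simp
    show "(\<lambda>x. upper_jump \<phi> x * upper_ray \<phi> x ^ j) \<in> borel_measurable lborel"
      using continuous_upper_jump[OF \<phi>] continuous_upper_ray[of \<phi>]
      by (simp, intro borel_measurable_continuous_onI continuous_intros)
    show "AE x in lborel. norm (upper_jump \<phi> x * upper_ray \<phi> x ^ j) \<le>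
      norm (C * (exp (real j * x - 2 * pi * c * exp x) + exp ((real j - 1 / 2) * x - 2 * pi * c * exp x)))"
    proof (rule AE_I2)
      fix x
      have "norm (upper_jump \<phi> x * upper_ray \<phi> x ^ j) =
              norm (Gamma_star (upper_ray \<phi> x)) * exp (- (2 * pi * c * exp x)) * exp (real j * x)"
        by (simp add: upper_jump_def norm_mult norm_power norm_exp_eq_Re Im_upper_ray c_def
            mult_ac flip: exp_of_nat_mult)
      also have "\<dots> \<le> (C * (1 + exp (- x / 2))) * exp (- (2 * pi * c * exp x)) * exp (real j * x)"
        unfolding upper_ray_def using \<phi> by (intro mult_right_mono C(2)) auto
      also have "\<dots> = C * (exp (real j * x - 2 * pi * c * exp x) + exp ((real j - 1 / 2) * x - 2 * pi * c * exp x))"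
        by (simp add: algebra_simps flip: exp_add)
      finally show "norm (upper_jump \<phi> x * upper_ray \<phi> x ^ j) \<le>
        norm (C * (exp (real j * x - 2 * pi * c * exp x) + exp ((real j - 1 / 2) * x - 2 * pi * c * exp x)))"
        using C(1) by simp
    qed
  qed
qed

lemma integrable_lower_jump_moment:
  assumes "j \<ge> 1"
  shows "integrable lborel (\<lambda>x. lower_jump x * lower_ray x ^ j)"
proof -
  have "integrable lborel (\<lambda>x. cnj (upper_jump 0 x * upper_ray 0 x ^ j))"
    by (rule integrable_cnj, rule integrable_upper_jump_moment) (use assms in auto)
  thus ?thesis by (simp add: lower_jump_cnj lower_ray_cnj)
qed

definition upper_moment :: "real \<Rightarrow> nat \<Rightarrow> complex" where
  "upper_moment \<phi> j = (LINT x|lborel. upper_jump \<phi> x * upper_ray \<phi> x ^ j)"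

definition lower_moment :: "nat \<Rightarrow> complex" where
  "lower_moment j = (LINT x|lborel. lower_jump x * lower_ray x ^ j)"

text \<open>The value 1 at index 0 is the limit of \<open>Gamma_star\<close> at infinity, which is
  subtracted before Cauchy's formula is applied. The other coefficients come from expanding the
  kernel in powers of 1 / z.\<close>

definition jump_coeff :: "real \<Rightarrow> nat \<Rightarrow> complex" where
  "jump_coeff \<phi> j = (if j = 0 then 1 else (upper_moment \<phi> j - lower_moment j) / (2 * pi * \<i>))"

text \<open>Finite geometric series for w / (w - z) = 1 - 1 / (1 - w / z): the leading 1 cancels the
  term of index 0, hence the sum from 1.\<close>

lemma ratio_geometric:
  fixes w z :: complex
  assumes "z \<noteq> 0" "w \<noteq> z" "N \<ge> 1"
  shows "w / (w - z) = - (\<Sum>j\<in>{1..<N}. w ^ j / z ^ j) - (w / z) ^ N / (1 - w / z)"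
proof -
  define q where "q = w / z"
  have q: "q \<noteq> 1" using assms by (simp add: q_def)
  have w: "w = q * z" using assms by (simp add: q_def)
  have "w / (w - z) = (q * z) / ((q - 1) * z)" unfolding w by (simp add: left_diff_distrib)
  also have "\<dots> = q / (q - 1)" using assms(1) by simp
  also have "\<dots> = 1 - 1 / (1 - q)"
  proof -
    define d where "d = 1 - q"
    have "d \<noteq> 0" "q = 1 - d" "q - 1 = - d" using q by (simp_all add: d_def)
    thus ?thesis unfolding d_def[symmetric] by (simp add: diff_divide_distrib)
  qed
  also have "1 / (1 - q) = (\<Sum>j<N. q ^ j) + q ^ N / (1 - q)"
    using q by (simp add: sum_gp_strict flip: add_divide_distrib)
  also have "1 - ((\<Sum>j<N. q ^ j) + q ^ N / (1 - q)) = - (\<Sum>j<N. q ^ j) + 1 - q ^ N / (1 - q)"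
    by simp
  also have "(\<Sum>j<N. q ^ j) = 1 + (\<Sum>j\<in>{1..<N}. q ^ j)"
    using assms(3) by (simp add: lessThan_atLeast0 sum.atLeast_Suc_lessThan)
  finally show ?thesis by (simp add: q_def power_divide)
qed

text \<open>The geometric expansion is integrated term by term. The minus signs in the expansion of
  the kernel turn lower minus upper in \<open>Gamma_star_plemelj\<close> into upper minus lower in
  \<open>jump_coeff\<close> and in the error term.\<close>

theorem Gamma_star_expansion:
  fixes r \<phi> \<omega> :: real
  assumes \<phi>: "0 \<le> \<phi>" "\<phi> < pi / 2" and \<omega>: "- (pi / 2) < \<omega>" "\<omega> < pi / 2 + \<phi>" and N: "N \<ge> 1"
  defines "z \<equiv> exp (Complex r \<omega>)"
  defines "u \<equiv> \<lambda>x. upper_jump \<phi> x * ((upper_ray \<phi> x / z) ^ N / (1 - upper_ray \<phi> x / z))"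
  defines "l \<equiv> \<lambda>x. lower_jump x * ((lower_ray x / z) ^ N / (1 - lower_ray x / z))"
  shows "integrable lborel u" "integrable lborel l"
    and "Gamma_star z = (\<Sum>j<N. jump_coeff \<phi> j / z ^ j) +
           ((LINT x|lborel. u x) - (LINT x|lborel. l x)) / (2 * pi * \<i>)"
proof -
  note P = Gamma_star_plemelj[OF \<phi> \<omega>, of r, folded z_def]
  have z0: "z \<noteq> 0" by (simp add: z_def)
  have upne: "upper_ray \<phi> x \<noteq> z" for x
  proof
    assume "upper_ray \<phi> x = z"
    moreover have "\<bar>Im (Complex x (pi / 2 + \<phi>)) - Im (Complex r \<omega>)\<bar> < 2 * pi"
      unfolding abs_less_iff complex.sel using \<phi> \<omega> pi_gt_zero by (intro conjI; linarith)
    ultimately have "Complex x (pi / 2 + \<phi>) = Complex r \<omega>"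
      unfolding upper_ray_def z_def by (rule exp_complex_eqI[rotated])
    thus False using \<omega> by simp
  qed
  have lowne: "lower_ray x \<noteq> z" for x
  proof
    assume "lower_ray x = z"
    moreover have "\<bar>Im (Complex x (- (pi / 2))) - Im (Complex r \<omega>)\<bar> < 2 * pi"
      unfolding abs_less_iff complex.sel using \<phi> \<omega> pi_gt_zero by (intro conjI; linarith)
    ultimately have "Complex x (- (pi / 2)) = Complex r \<omega>"
      unfolding lower_ray_def z_def by (rule exp_complex_eqI[rotated])
    thus False using \<omega> by simp
  qed
  have u: "u x = - (\<Sum>j\<in>{1..<N}. (upper_jump \<phi> x * upper_ray \<phi> x ^ j) / z ^ j)
                 - upper_jump \<phi> x * (upper_ray \<phi> x / (upper_ray \<phi> x - z))" for x
    unfolding u_def ratio_geometric[OF z0 upne N] by (simp add: algebra_simps sum_distrib_left)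
  have l: "l x = - (\<Sum>j\<in>{1..<N}. (lower_jump x * lower_ray x ^ j) / z ^ j)
                 - lower_jump x * (lower_ray x / (lower_ray x - z))" for x
    unfolding l_def ratio_geometric[OF z0 lowne N] by (simp add: algebra_simps sum_distrib_left)
  have iu: "integrable lborel (\<lambda>x. (upper_jump \<phi> x * upper_ray \<phi> x ^ j) / z ^ j)" if "j \<in> {1..<N}" for j
    using integrable_upper_jump_moment[OF \<phi>, of j] that by simp
  have il: "integrable lborel (\<lambda>x. (lower_jump x * lower_ray x ^ j) / z ^ j)" if "j \<in> {1..<N}" for j
    using integrable_lower_jump_moment[of j] that by simp
  have isu: "integrable lborel (\<lambda>x. \<Sum>j\<in>{1..<N}. (upper_jump \<phi> x * upper_ray \<phi> x ^ j) / z ^ j)"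
    and isl: "integrable lborel (\<lambda>x. \<Sum>j\<in>{1..<N}. (lower_jump x * lower_ray x ^ j) / z ^ j)"
    using iu il by (auto intro!: Bochner_Integration.integrable_sum)
  show "integrable lborel u"
    unfolding u[abs_def] by (rule Bochner_Integration.integrable_diff[OF Bochner_Integration.integrable_minus[OF isu] P(2)])
  show "integrable lborel l"
    unfolding l[abs_def] by (rule Bochner_Integration.integrable_diff[OF Bochner_Integration.integrable_minus[OF isl] P(1)])
  have "(LINT x|lborel. u x) = - (LINT x|lborel. (\<Sum>j\<in>{1..<N}. (upper_jump \<phi> x * upper_ray \<phi> x ^ j) / z ^ j))
          - (LINT x|lborel. upper_jump \<phi> x * (upper_ray \<phi> x / (upper_ray \<phi> x - z)))"
    unfolding u Bochner_Integration.integral_diff[OF Bochner_Integration.integrable_minus[OF isu] P(2)]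
      Bochner_Integration.integral_minus ..
  also have "(LINT x|lborel. (\<Sum>j\<in>{1..<N}. (upper_jump \<phi> x * upper_ray \<phi> x ^ j) / z ^ j)) =
               (\<Sum>j\<in>{1..<N}. upper_moment \<phi> j / z ^ j)"
    using iu by (subst Bochner_Integration.integral_sum) (auto simp: upper_moment_def)
  finally have U: "(LINT x|lborel. upper_jump \<phi> x * (upper_ray \<phi> x / (upper_ray \<phi> x - z))) =
      - (\<Sum>j\<in>{1..<N}. upper_moment \<phi> j / z ^ j) - (LINT x|lborel. u x)" by simp
  have "(LINT x|lborel. l x) = - (LINT x|lborel. (\<Sum>j\<in>{1..<N}. (lower_jump x * lower_ray x ^ j) / z ^ j))
          - (LINT x|lborel. lower_jump x * (lower_ray x / (lower_ray x - z)))"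
    unfolding l Bochner_Integration.integral_diff[OF Bochner_Integration.integrable_minus[OF isl] P(1)]
      Bochner_Integration.integral_minus ..
  also have "(LINT x|lborel. (\<Sum>j\<in>{1..<N}. (lower_jump x * lower_ray x ^ j) / z ^ j)) =
               (\<Sum>j\<in>{1..<N}. lower_moment j / z ^ j)"
    using il by (subst Bochner_Integration.integral_sum) (auto simp: lower_moment_def)
  finally have L: "(LINT x|lborel. lower_jump x * (lower_ray x / (lower_ray x - z))) =
      - (\<Sum>j\<in>{1..<N}. lower_moment j / z ^ j) - (LINT x|lborel. l x)" by simp
  have "2 * pi * \<i> * (Gamma_star z - 1) =
      (\<Sum>j\<in>{1..<N}. upper_moment \<phi> j / z ^ j) - (\<Sum>j\<in>{1..<N}. lower_moment j / z ^ j)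
        + ((LINT x|lborel. u x) - (LINT x|lborel. l x))"
    unfolding P(3) U L by simp
  also have "(\<Sum>j\<in>{1..<N}. upper_moment \<phi> j / z ^ j) - (\<Sum>j\<in>{1..<N}. lower_moment j / z ^ j) =
      2 * pi * \<i> * (\<Sum>j\<in>{1..<N}. jump_coeff \<phi> j / z ^ j)"
    unfolding sum_distrib_left sum_subtractf[symmetric]
  proof (rule sum.cong)
    fix j assume "j \<in> {1..<N}"
    hence j: "jump_coeff \<phi> j * (2 * pi * \<i>) = upper_moment \<phi> j - lower_moment j"
      by (simp add: jump_coeff_def)
    have "2 * pi * \<i> * (jump_coeff \<phi> j / z ^ j) = jump_coeff \<phi> j * (2 * pi * \<i>) / z ^ j"
      by (simp add: mult_ac)
    also have "\<dots> = upper_moment \<phi> j / z ^ j - lower_moment j / z ^ j"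
      unfolding j by (rule diff_divide_distrib)
    finally show "upper_moment \<phi> j / z ^ j - lower_moment j / z ^ j = 2 * pi * \<i> * (jump_coeff \<phi> j / z ^ j)" ..
  qed simp
  finally have "2 * pi * \<i> * (Gamma_star z - 1) = 2 * pi * \<i> * ((\<Sum>j\<in>{1..<N}. jump_coeff \<phi> j / z ^ j)
        + ((LINT x|lborel. u x) - (LINT x|lborel. l x)) / (2 * pi * \<i>))"
    by (simp add: distrib_left)
  hence "Gamma_star z - 1 = (\<Sum>j\<in>{1..<N}. jump_coeff \<phi> j / z ^ j)
        + ((LINT x|lborel. u x) - (LINT x|lborel. l x)) / (2 * pi * \<i>)"
    by (subst (asm) mult_cancel_left) auto
  moreover have "(\<Sum>j<N. jump_coeff \<phi> j / z ^ j) = 1 + (\<Sum>j\<in>{1..<N}. jump_coeff \<phi> j / z ^ j)"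
    using N by (simp add: lessThan_atLeast0 sum.atLeast_Suc_lessThan jump_coeff_def)
  ultimately show "Gamma_star z = (\<Sum>j<N. jump_coeff \<phi> j / z ^ j) +
           ((LINT x|lborel. u x) - (LINT x|lborel. l x)) / (2 * pi * \<i>)"
    by (simp add: algebra_simps)
qed

definition upper_abs_moment :: "real \<Rightarrow> nat \<Rightarrow> real" where
  "upper_abs_moment \<phi> N = (LINT x|lborel. norm (upper_jump \<phi> x) * exp (real N * x))"

lemma integrable_upper_abs_moment:
  assumes "0 \<le> \<phi>" "\<phi> < pi / 2" "N \<ge> 1"
  shows "integrable lborel (\<lambda>x. norm (upper_jump \<phi> x) * exp (real N * x))"
  using integrable_norm[OF integrable_upper_jump_moment[OF assms]]
  by (simp add: norm_mult norm_power exp_of_nat_mult)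

text \<open>On the turned upper ray the factor 1 / (1 - w / z) is at most 1 / sin (arg (w / z)) =
  sec (omega - phi). On the lower ray w / z has nonpositive real part for 0 <= omega <= pi, so the
  factor is at most 1; this is the summand 1 in the second bound.\<close>

lemma Gamma_star_expansion_bound:
  fixes r \<phi> \<omega> :: real
  assumes \<phi>: "0 \<le> \<phi>" "\<phi> < pi / 2" and \<omega>: "0 \<le> \<omega>" "\<omega> < pi / 2 + \<phi>" and N: "N \<ge> 1"
  defines "z \<equiv> exp (Complex r \<omega>)"
  shows "norm (Gamma_star z - (\<Sum>j<N. jump_coeff \<phi> j / z ^ j)) \<le>
           (upper_abs_moment \<phi> N / cos (\<omega> - \<phi>) + upper_abs_moment 0 N) * exp (- (real N * r)) / (2 * pi)"
proof -
  have \<omega>': "- (pi / 2) < \<omega>" using \<omega> pi_gt_zero by linarith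
  define u where "u = (\<lambda>x. upper_jump \<phi> x * ((upper_ray \<phi> x / z) ^ N / (1 - upper_ray \<phi> x / z)))"
  define l where "l = (\<lambda>x. lower_jump x * ((lower_ray x / z) ^ N / (1 - lower_ray x / z)))"
  note E = Gamma_star_expansion[OF \<phi> \<omega>' \<omega>(2) N, of r, folded z_def, folded u_def l_def]
  have nz: "norm z = exp r" by (simp add: z_def norm_exp_Complex)
  have cpos: "cos (\<omega> - \<phi>) > 0" using \<phi> \<omega> by (intro cos_gt_zero_pi) auto
  have pw: "(exp x / exp r) ^ N = exp (real N * x) * exp (- (real N * r))" for x
    by (simp add: exp_minus power_divide inverse_eq_divide flip: exp_of_nat_mult)
  have bu: "norm (u x) \<le> norm (upper_jump \<phi> x) * exp (real N * x) * (exp (- (real N * r)) / cos (\<omega> - \<phi>))" for x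
  proof -
    have q: "upper_ray \<phi> x / z = exp (Complex (x - r) (pi / 2 + \<phi> - \<omega>))"
      by (simp add: upper_ray_def z_def flip: exp_diff) (simp add: complex_diff)
    have "sin (pi / 2 + \<phi> - \<omega>) = cos (\<omega> - \<phi>)"
      by (simp add: sin_diff sin_add cos_diff cos_add mult.commute)
    hence "cos (\<omega> - \<phi>) \<le> norm (1 - upper_ray \<phi> x / z)"
      using norm_one_minus_exp_Complex_ge_sin[of "pi / 2 + \<phi> - \<omega>" "x - r"] cpos unfolding q by simp
    hence "(exp x / exp r) ^ N / norm (1 - upper_ray \<phi> x / z) \<le> (exp x / exp r) ^ N / cos (\<omega> - \<phi>)"
      using cpos by (intro divide_left_mono mult_pos_pos) auto
    hence "norm (u x) \<le> norm (upper_jump \<phi> x) * ((exp x / exp r) ^ N / cos (\<omega> - \<phi>))"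
      unfolding u_def norm_mult norm_divide norm_power norm_upper_ray nz by (intro mult_left_mono) auto
    thus ?thesis unfolding pw by simp
  qed
  have bl: "norm (l x) \<le> norm (upper_jump 0 x) * exp (real N * x) * exp (- (real N * r))" for x
  proof -
    have q: "lower_ray x / z = exp (Complex (x - r) (- (pi / 2) - \<omega>))"
      by (simp add: lower_ray_def z_def flip: exp_diff) (simp add: complex_diff)
    have "sin \<omega> \<ge> 0" using \<omega> \<phi> by (intro sin_ge_zero) auto
    hence "Re (lower_ray x / z) \<le> 0"
      unfolding q by (simp add: Re_exp cos_diff)
    hence "1 \<le> norm (1 - lower_ray x / z)" by (rule norm_one_minus_ge_1)
    hence "(exp x / exp r) ^ N / norm (1 - lower_ray x / z) \<le> (exp x / exp r) ^ N / 1"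
      by (intro divide_left_mono) auto
    hence "norm (l x) \<le> norm (lower_jump x) * ((exp x / exp r) ^ N / 1)"
      unfolding l_def norm_mult norm_divide norm_power norm_lower_ray nz by (intro mult_left_mono) auto
    thus ?thesis unfolding pw lower_jump_cnj by simp
  qed
  have "norm (LINT x|lborel. u x) \<le> (LINT x|lborel. norm (u x))" by (rule integral_norm_bound)
  also have "\<dots> \<le> (LINT x|lborel. norm (upper_jump \<phi> x) * exp (real N * x) * (exp (- (real N * r)) / cos (\<omega> - \<phi>)))"
    using integrable_upper_abs_moment[OF \<phi> N] bu E(1) by (intro integral_mono) auto
  also have "\<dots> = upper_abs_moment \<phi> N * (exp (- (real N * r)) / cos (\<omega> - \<phi>))"
    by (simp only: upper_abs_moment_def integral_mult_left_zero)
  finally have U: "norm (LINT x|lborel. u x) \<le> upper_abs_moment \<phi> N * (exp (- (real N * r)) / cos (\<omega> - \<phi>))" .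
  have "norm (LINT x|lborel. l x) \<le> (LINT x|lborel. norm (l x))" by (rule integral_norm_bound)
  also have "\<dots> \<le> (LINT x|lborel. norm (upper_jump 0 x) * exp (real N * x) * exp (- (real N * r)))"
    using integrable_upper_abs_moment[of 0, OF _ _ N] bl E(2) by (intro integral_mono) auto
  also have "\<dots> = upper_abs_moment 0 N * exp (- (real N * r))"
    by (simp only: upper_abs_moment_def integral_mult_left_zero)
  finally have L: "norm (LINT x|lborel. l x) \<le> upper_abs_moment 0 N * exp (- (real N * r))" .
  have "norm (Gamma_star z - (\<Sum>j<N. jump_coeff \<phi> j / z ^ j)) =
          norm ((LINT x|lborel. u x) - (LINT x|lborel. l x)) / (2 * pi)"
    unfolding E(3) by (simp add: norm_divide norm_mult)
  also have "\<dots> \<le> (norm (LINT x|lborel. u x) + norm (LINT x|lborel. l x)) / (2 * pi)"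
    by (intro divide_right_mono norm_triangle_ineq4) auto
  also have "\<dots> \<le> (upper_abs_moment \<phi> N * (exp (- (real N * r)) / cos (\<omega> - \<phi>)) + upper_abs_moment 0 N * exp (- (real N * r))) / (2 * pi)"
    using U L by (intro divide_right_mono add_mono) auto
  also have "\<dots> = (upper_abs_moment \<phi> N / cos (\<omega> - \<phi>) + upper_abs_moment 0 N) * exp (- (real N * r)) / (2 * pi)"
    by (simp add: distrib_right)
  finally show ?thesis .
qed

text \<open>Once the lower coefficients agree, the difference of the two approximations is the
  single term (a N - b N) / x^N, which is o (1 / x^N) only if its coefficient vanishes.\<close>

lemma asymptotic_coeffs_unique:
  fixes a b :: "nat \<Rightarrow> complex" and F :: "real \<Rightarrow> complex"
  assumes a: "\<And>N. (\<lambda>x. F x - (\<Sum>n\<le>N. a n / of_real x ^ n)) \<in> o[at_top](\<lambda>x. 1 / of_real x ^ N)"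
    and b: "\<And>N. (\<lambda>x. F x - (\<Sum>n\<le>N. b n / of_real x ^ n)) \<in> o[at_top](\<lambda>x. 1 / of_real x ^ N)"
  shows "a N = b N"
proof (induction N rule: less_induct)
  case (less N)
  have "(\<lambda>x. (F x - (\<Sum>n\<le>N. b n / of_real x ^ n)) - (F x - (\<Sum>n\<le>N. a n / of_real x ^ n)))
          \<in> o[at_top](\<lambda>x. 1 / of_real x ^ N)"
    by (rule sum_in_smallo(2)[OF b a])
  also have "(\<lambda>x. (F x - (\<Sum>n\<le>N. b n / of_real x ^ n)) - (F x - (\<Sum>n\<le>N. a n / of_real x ^ n))) =
               (\<lambda>x. (a N - b N) * (1 / of_real x ^ N))"
  proof
    fix x
    have "(\<Sum>n\<le>N. a n / of_real x ^ n) - (\<Sum>n\<le>N. b n / of_real x ^ n) =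
            (\<Sum>n\<le>N. (a n - b n) / of_real x ^ n)"
      by (simp add: diff_divide_distrib sum_subtractf)
    also have "\<dots> = (\<Sum>n\<in>{N}. (a n - b n) / of_real x ^ n)"
      by (rule sum.mono_neutral_right) (use less.IH in auto)
    finally show "(F x - (\<Sum>n\<le>N. b n / of_real x ^ n)) - (F x - (\<Sum>n\<le>N. a n / of_real x ^ n)) =
               (a N - b N) * (1 / of_real x ^ N)" by simp
  qed
  finally have o: "(\<lambda>x. (a N - b N) * (1 / of_real x ^ N)) \<in> o[at_top](\<lambda>x. 1 / of_real x ^ N)" .
  show ?case
  proof (rule ccontr)
    assume "a N \<noteq> b N"
    hence pos: "norm (a N - b N) / 2 > 0" by simp
    from landau_o.smallD[OF o this]
    have "eventually (\<lambda>x::real. norm ((a N - b N) * (1 / of_real x ^ N)) \<le>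
            norm (a N - b N) / 2 * norm (1 / (of_real x :: complex) ^ N)) at_top" .
    hence "eventually (\<lambda>x::real. False) at_top"
      using eventually_gt_at_top[of 0]
    proof eventually_elim
      case (elim x)
      define t where "t = norm (1 / (of_real x :: complex) ^ N)"
      have "t > 0" using elim(2) by (simp add: t_def norm_divide norm_power)
      moreover have "norm (a N - b N) * t \<le> norm (a N - b N) / 2 * t"
        using elim(1) unfolding norm_mult t_def .
      ultimately have "norm (a N - b N) \<le> norm (a N - b N) / 2"
        by (simp only: mult_le_cancel_right_pos)
      thus False using pos by simp
    qed
    thus False by simp
  qed
qed

text \<open>The error bound at angle omega = 0 with the terms up to index N has order x^(-N-1), one
  order better than the o-statement asks.\<close>

lemma jump_coeff_expansion:
  assumes \<phi>: "0 \<le> \<phi>" "\<phi> < pi / 2"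
  shows "(\<lambda>x::real. Gamma_star (of_real x) - (\<Sum>n\<le>N. jump_coeff \<phi> n / of_real x ^ n))
           \<in> o[at_top](\<lambda>x. 1 / of_real x ^ N)"
proof -
  define M where "M = (upper_abs_moment \<phi> (Suc N) / cos (0 - \<phi>) + upper_abs_moment 0 (Suc N)) / (2 * pi)"
  have "(\<lambda>x::real. Gamma_star (of_real x) - (\<Sum>n\<le>N. jump_coeff \<phi> n / of_real x ^ n))
           \<in> O[at_top](\<lambda>x. 1 / of_real x ^ Suc N)"
  proof (rule bigoI[where c = M])
    show "eventually (\<lambda>x::real. norm (Gamma_star (of_real x) - (\<Sum>n\<le>N. jump_coeff \<phi> n / of_real x ^ n))
            \<le> M * norm (1 / (of_real x :: complex) ^ Suc N)) at_top"
      using eventually_gt_at_top[of 0]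
    proof eventually_elim
      case (elim x)
      have "exp (Complex (ln x) 0) = of_real x"
        using elim by (intro complex_eqI) (simp_all add: Re_exp Im_exp)
      moreover have "exp (- (real (Suc N) * ln x)) = 1 / x ^ Suc N"
        using elim by (simp add: exp_minus exp_of_nat_mult inverse_eq_divide del: of_nat_Suc power_Suc)
      ultimately show ?case
        using Gamma_star_expansion_bound[OF \<phi>, of 0 "Suc N" "ln x"] \<phi> elim
        by (simp add: M_def lessThan_Suc_atMost norm_divide norm_power norm_mult mult_ac)
    qed
  qed
  also have "(\<lambda>x::real. 1 / (of_real x :: complex) ^ Suc N) \<in> o[at_top](\<lambda>x. 1 / of_real x ^ N)"
  proof (rule landau_o.smallI)
    fix c :: real assume c: "c > 0"
    show "eventually (\<lambda>x::real. norm (1 / (of_real x :: complex) ^ Suc N) \<le> c * norm (1 / (of_real x :: complex) ^ N)) at_top"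
      using eventually_ge_at_top[of "1 / c"] eventually_gt_at_top[of 0]
    proof eventually_elim
      case (elim x)
      have "1 / x \<le> c" using elim c by (simp add: field_simps)
      hence "1 / x * (1 / x ^ N) \<le> c * (1 / x ^ N)" using elim by (intro mult_right_mono) auto
      thus ?case using elim by (simp add: norm_divide norm_power norm_mult)
    qed
  qed
  finally show ?thesis .
qed

lemma lower_moment_cnj: "lower_moment j = cnj (upper_moment 0 j)"
  unfolding lower_moment_def upper_moment_def lower_jump_cnj lower_ray_cnj
  unfolding complex_cnj_mult[symmetric] complex_cnj_power[symmetric] Bochner_Integration.integral_cnj ..

lemma jump_coeff_0_real:
  "jump_coeff 0 j = of_real (if j = 0 then 1 else Im (upper_moment 0 j) / pi)"
proof -
  have "upper_moment 0 j - lower_moment j = 2 * \<i> * of_real (Im (upper_moment 0 j))"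
    unfolding lower_moment_cnj by (rule complex_eqI) auto
  thus ?thesis by (simp add: jump_coeff_def)
qed

text \<open>For \<open>phi = 0\<close> the two jumps are complex conjugates, so the coefficients are real; for the other
  angles they are identified by uniqueness of the asymptotic expansion, without moving contours.\<close>

lemma stirling_coeff_jump_0:
  "stirling_coeff j = (-1) ^ j * (if j = 0 then 1 else Im (upper_moment 0 j) / pi)"
proof -
  define g where "g = (\<lambda>j. (-1) ^ j * (if j = 0 then 1 else Im (upper_moment 0 j) / pi))"
  have g: "(-1) ^ j * of_real (g j) = jump_coeff 0 j" for j
    unfolding jump_coeff_0_real g_def of_real_mult by (simp flip: mult.assoc power_mult_distrib)
  have exp_g: "stirling_expansion g"
    unfolding stirling_expansion_def g using jump_coeff_expansion[of 0] by simp
  have "stirling_coeff = g"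
    unfolding stirling_coeff_def
  proof (rule the_equality)
    show "stirling_expansion g" by (rule exp_g)
    fix g' assume g': "stirling_expansion g'"
    have "(-1) ^ j * complex_of_real (g' j) = (-1) ^ j * complex_of_real (g j)" for j
      by (rule asymptotic_coeffs_unique[where F = "\<lambda>x. Gamma_star (of_real x)"])
         (use g' exp_g in \<open>auto simp: stirling_expansion_def\<close>)
    thus "g' = g" by auto
  qed
  hence "stirling_coeff j = g j" by simp
  thus ?thesis by (simp only: g_def)
qed

lemma jump_coeff_eq_stirling_coeff:
  assumes \<phi>: "0 \<le> \<phi>" "\<phi> < pi / 2"
  shows "jump_coeff \<phi> j = (-1) ^ j * of_real (stirling_coeff j)"
proof -
  have "jump_coeff \<phi> j = jump_coeff 0 j"
    by (rule asymptotic_coeffs_unique[where F = "\<lambda>x. Gamma_star (of_real x)"])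
       (use jump_coeff_expansion[OF \<phi>] jump_coeff_expansion[of 0] in auto)
  also have "\<dots> = (-1) ^ j * of_real (stirling_coeff j)"
    unfolding jump_coeff_0_real stirling_coeff_jump_0 of_real_mult
    by (simp flip: mult.assoc power_mult_distrib)
  finally show ?thesis .
qed

section \<open>Bounds for the remainder\<close>

lemma Gamma_integral_exp_real:
  fixes a b :: real
  assumes "a > 0" "b > 0"
  shows "(LINT x|lborel. exp (a * x - b * exp x)) = Gamma a / b powr a"
proof -
  have "complex_of_real (LINT x|lborel. exp (a * x - b * exp x)) =
          (LINT x|lborel. exp (of_real a * of_real x - of_real b * of_real (exp x)))"
    by (simp add: exp_of_real flip: integral_complex_of_real of_real_mult of_real_diff)
  also have "\<dots> = Gamma (of_real a) * of_real b powr (- of_real a)"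
    using assms by (intro Gamma_integral_exp) auto
  also have "\<dots> = complex_of_real (Gamma a * b powr (-a))"
    using assms by (simp add: Gamma_complex_of_real powr_of_real[of b "-a", simplified])
  finally show ?thesis
    unfolding of_real_eq_iff by (simp add: powr_minus field_simps)
qed

text \<open>q / (1 - q) with q = e^(-2 pi t) is a geometric series, and its m-th term integrates
  against t^(K - 1) dt to Gamma K / (2 pi (m + 1))^K; K >= 2 makes the sum over m converge. All
  terms are positive, so they coincide with their norms in the interchange of sum and
  integral.\<close>

lemma zeta_moment:
  assumes K: "K \<ge> 2"
  defines "f \<equiv> \<lambda>x. exp (real K * x) * (exp (- 2 * pi * exp x) / (1 - exp (- 2 * pi * exp x)))"
  shows "integrable lborel f" "(LINT x|lborel. f x) = zeta (real K) * Gamma (real K) / (2 * pi) ^ K"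
proof -
  define g where "g = (\<lambda>m x. exp (real K * x - 2 * pi * real (Suc m) * exp x))"
  have K': "real K > 0" using K by simp
  have pos: "2 * pi * real (Suc m) > 0" for m by simp
  have int: "integrable lborel (g m)" for m
    unfolding g_def by (rule integrable_exp_gamma_kernel[OF K' pos])
  have Ig: "(LINT x|lborel. g m x) = Gamma (real K) / (2 * pi) ^ K * (1 / real (Suc m) powr real K)" for m
    unfolding g_def Gamma_integral_exp_real[OF K' pos]
    by (simp add: powr_mult powr_realpow del: of_nat_Suc)
  have sums: "(\<lambda>m. g m x) sums f x" for x
  proof -
    define q where "q = exp (- 2 * pi * exp x)"
    have q: "0 \<le> q" "q < 1" by (auto simp: q_def)
    have "(\<lambda>m. exp (real K * x) * (q * q ^ m)) sums (exp (real K * x) * (q * (1 / (1 - q))))"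
      using q by (intro sums_mult geometric_sums) auto
    moreover have "exp (real K * x) * (q * q ^ m) = g m x" for m
    proof -
      have "q * q ^ m = exp (real (Suc m) * (- 2 * pi * exp x))"
        unfolding exp_of_nat_mult q_def by simp
      thus ?thesis by (simp add: g_def mult_ac flip: exp_add)
    qed
    ultimately show ?thesis by (simp add: f_def q_def)
  qed
  have zs: "summable (\<lambda>m. 1 / real (Suc m) powr real K)"
  proof -
    have "summable (\<lambda>n. 1 / real n ^ K)" using inverse_power_summable[OF K, where 'a = real] by (simp add: inverse_eq_divide)
    hence "summable (\<lambda>n. 1 / real (Suc n) ^ K)" by (subst summable_Suc_iff)
    thus ?thesis by (simp add: powr_realpow del: of_nat_Suc)
  qed
  have f_eq: "f x = (\<Sum>m. g m x)" for x using sums_unique[OF sums] .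
  have s1: "AE x in lborel. summable (\<lambda>m. norm (g m x))"
    using sums_summable[OF sums] by (auto simp: g_def)
  have nn: "norm (g m x) = g m x" for m x by (simp add: g_def)
  have s2: "summable (\<lambda>m. LINT x|lborel. norm (g m x))"
    unfolding nn Ig by (intro summable_mult zs)
  show "integrable lborel f"
    unfolding f_eq[abs_def] by (rule integrable_suminf[OF int s1 s2])
  have "(LINT x|lborel. f x) = (\<Sum>m. LINT x|lborel. g m x)"
    unfolding f_eq by (rule integral_suminf[OF int s1 s2])
  also have "\<dots> = Gamma (real K) / (2 * pi) ^ K * zeta (real K)"
    unfolding Ig zeta_def by (rule suminf_mult[OF zs])
  finally show "(LINT x|lborel. f x) = zeta (real K) * Gamma (real K) / (2 * pi) ^ K" by simp
qed

text \<open>With |q| = e^(-2 pi |w| cos phi) the jump is at most |q| / (1 - |q|), because the ray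
  lies on or left of the imaginary axis. The shift x -> x + ln (cos phi) absorbs cos phi into |w|
  and leaves the factor 1 / cos^K phi.\<close>

lemma upper_abs_moment_le:
  assumes \<phi>: "0 \<le> \<phi>" "\<phi> < pi / 2" and K: "K \<ge> 2"
  shows "upper_abs_moment \<phi> K \<le> zeta (real K) * Gamma (real K) / (2 * pi) ^ K / cos \<phi> ^ K"
proof -
  define c where "c = cos \<phi>"
  have c: "c > 0" unfolding c_def using \<phi> by (intro cos_gt_zero_pi) auto
  define f where "f = (\<lambda>x. exp (real K * x) * (exp (- 2 * pi * exp x) / (1 - exp (- 2 * pi * exp x))))"
  have f: "integrable lborel f" "(LINT x|lborel. f x) = zeta (real K) * Gamma (real K) / (2 * pi) ^ K"
    using zeta_moment[OF K] unfolding f_def by auto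
  have fs: "integrable lborel (\<lambda>x. f (ln c + 1 * x))"
    by (rule lborel_integrable_real_affine[OF f(1)]) simp
  have fi: "(LINT x|lborel. f (ln c + 1 * x)) = (LINT x|lborel. f x)"
    using lborel_integral_real_affine[of 1 f "ln c"] by simp
  have le: "norm (upper_jump \<phi> x) * exp (real K * x) \<le> f (ln c + 1 * x) / c ^ K" for x
  proof -
    have e: "exp (ln c + 1 * x) = c * exp x" using c by (simp add: exp_add)
    have eK: "exp (real K * (ln c + 1 * x)) = c ^ K * exp (real K * x)"
      using c by (simp add: distrib_left exp_add exp_of_nat_mult)
    have "sin \<phi> \<ge> 0" using \<phi> by (intro sin_ge_zero) auto
    hence "norm (Gamma_star (upper_ray \<phi> x)) \<le> 1 / (1 - exp (- 2 * pi * Im (upper_ray \<phi> x)))"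
      using c by (intro Gamma_star_left_bound) (auto simp: Im_upper_ray Re_upper_ray c_def)
    hence "norm (Gamma_star (upper_ray \<phi> x)) \<le> 1 / (1 - exp (- 2 * pi * (c * exp x)))"
      by (simp add: Im_upper_ray c_def mult_ac)
    moreover have "norm (exp (2 * pi * \<i> * upper_ray \<phi> x)) = exp (- 2 * pi * (c * exp x))"
      by (simp add: norm_exp_eq_Re Im_upper_ray c_def mult_ac)
    ultimately have "norm (upper_jump \<phi> x) \<le> 1 / (1 - exp (- 2 * pi * (c * exp x))) * exp (- 2 * pi * (c * exp x))"
      unfolding upper_jump_def norm_mult by (simp only: mult_right_mono[OF _ exp_ge_zero])
    hence "norm (upper_jump \<phi> x) * exp (real K * x) \<le>
             1 / (1 - exp (- 2 * pi * (c * exp x))) * exp (- 2 * pi * (c * exp x)) * exp (real K * x)"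
      by (intro mult_right_mono) auto
    also have "\<dots> = f (ln c + 1 * x) / c ^ K"
      unfolding f_def e eK using c by simp
    finally show ?thesis .
  qed
  have "upper_abs_moment \<phi> K \<le> (LINT x|lborel. f (ln c + 1 * x) / c ^ K)"
    unfolding upper_abs_moment_def using K fs
    by (intro integral_mono integrable_upper_abs_moment \<phi> le) auto
  also have "\<dots> = zeta (real K) * Gamma (real K) / (2 * pi) ^ K / c ^ K"
    using fi f(2) by simp
  finally show ?thesis by (simp add: c_def)
qed

text \<open>Valid for every admissible rotation; \<open>phi_star\<close> is inserted only at the
  very end.\<close>

theorem stirling_remainder_bound_zeta:
  fixes r \<phi> \<omega> :: real
  assumes \<phi>: "0 \<le> \<phi>" "\<phi> < pi / 2" and \<omega>: "0 \<le> \<omega>" "\<omega> < pi / 2 + \<phi>" and K: "K \<ge> 2"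
  shows "norm (stirling_remainder K (exp (Complex r \<omega>))) \<le>
           (1 / cos (\<omega> - \<phi>) / cos \<phi> ^ K + 1) * (zeta (real K) * Gamma (real K) / (2 * pi) ^ K) *
             exp (- (real K * r)) / (2 * pi)"
proof -
  define Z where "Z = zeta (real K) * Gamma (real K) / (2 * pi) ^ K"
  have K1: "K \<ge> 1" using K by simp
  have c: "cos (\<omega> - \<phi>) > 0" using \<phi> \<omega> by (intro cos_gt_zero_pi) auto
  have "norm (stirling_remainder K (exp (Complex r \<omega>))) \<le>
          (upper_abs_moment \<phi> K / cos (\<omega> - \<phi>) + upper_abs_moment 0 K) * exp (- (real K * r)) / (2 * pi)"
    using Gamma_star_expansion_bound[OF \<phi> \<omega> K1, of r]
    by (simp only: jump_coeff_eq_stirling_coeff[OF \<phi>] stirling_remainder_def)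
  also have "\<dots> \<le> (Z / cos \<phi> ^ K / cos (\<omega> - \<phi>) + Z) * exp (- (real K * r)) / (2 * pi)"
    using upper_abs_moment_le[OF \<phi> K] upper_abs_moment_le[of 0, OF _ _ K] c
    by (intro divide_right_mono mult_right_mono add_mono) (auto simp: Z_def)
  also have "Z / cos \<phi> ^ K / cos (\<omega> - \<phi>) + Z = (1 / cos (\<omega> - \<phi>) / cos \<phi> ^ K + 1) * Z"
    by (simp add: distrib_right)
  finally show ?thesis by (simp only: Z_def)
qed

text \<open>On the imaginary axis the product is a positive number times i^j
  \<open>Gamma_star\<close> (i s), and \<open>Gamma_star\<close> (i s) stays in the closed fourth
  quadrant. Multiplication by i^j permutes the quadrants, so the imaginary part never changes
  sign.\<close>

lemma upper_jump_0_power_signs: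
  "(\<forall>x. Im (upper_jump 0 x * upper_ray 0 x ^ j) \<ge> 0) \<or> (\<forall>x. Im (upper_jump 0 x * upper_ray 0 x ^ j) \<le> 0)"
proof -
  have ray: "upper_ray 0 x = \<i> * of_real (exp x)" for x
    by (rule complex_eqI) (simp_all add: Re_upper_ray Im_upper_ray)
  have e: "exp (2 * pi * \<i> * upper_ray 0 x) = of_real (exp (- 2 * pi * exp x))" for x
  proof -
    have "2 * pi * \<i> * upper_ray 0 x = of_real (- 2 * pi * exp x)"
      unfolding ray by (simp add: algebra_simps)
    thus ?thesis by (simp only: exp_of_real)
  qed
  have eq: "upper_jump 0 x * upper_ray 0 x ^ j =
          of_real (exp (- 2 * pi * exp x) * exp x ^ j) * (Gamma_star (\<i> * of_real (exp x)) * \<i> ^ j)" for x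
    unfolding upper_jump_def e by (simp add: ray power_mult_distrib)
  have Im: "Im (upper_jump 0 x * upper_ray 0 x ^ j) =
          exp (- 2 * pi * exp x) * exp x ^ j * Im (Gamma_star (\<i> * of_real (exp x)) * \<i> ^ j)" for x
    unfolding eq by (simp del: of_real_mult)
  have signs: "Re (Gamma_star (\<i> * of_real (exp x))) > 0" "Im (Gamma_star (\<i> * of_real (exp x))) \<le> 0" for x
    by (rule Gamma_star_imaginary_signs, simp)+
  have "j mod 4 < 4" by simp
  then consider "j mod 4 = 0" | "j mod 4 = 1" | "j mod 4 = 2" | "j mod 4 = 3" by linarith
  hence ij: "\<i> ^ j \<in> {1, \<i>, -1, - \<i>}"
  proof cases
    have "\<i> ^ j = \<i> ^ (4 * (j div 4) + j mod 4)" by simp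
    also have "\<dots> = (\<i> ^ 4) ^ (j div 4) * \<i> ^ (j mod 4)" by (simp only: power_add power_mult)
    also have "\<i> ^ 4 = (1 :: complex)" by (simp add: power4_eq_xxxx)
    finally have *: "\<i> ^ j = \<i> ^ (j mod 4)" by simp
    {
      case 1 thus ?thesis using * by simp
    next
      case 2 thus ?thesis using * by simp
    next
      case 3 thus ?thesis using * by simp
    next
      case 4 thus ?thesis using * by (simp add: power3_eq_cube)
    }
  qed
  have pos: "exp (- 2 * pi * exp x) * exp x ^ j > 0" for x by simp
  consider "\<i> ^ j = 1" | "\<i> ^ j = \<i>" | "\<i> ^ j = -1" | "\<i> ^ j = - \<i>" using ij by auto
  thus ?thesis
  proof cases
    case 1
    have "Im (upper_jump 0 x * upper_ray 0 x ^ j) \<le> 0" for x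
      unfolding Im 1 using signs(2)[of x] pos[of x] by (intro mult_nonneg_nonpos) auto
    thus ?thesis by blast
  next
    case 2
    have "Im (upper_jump 0 x * upper_ray 0 x ^ j) \<ge> 0" for x
      unfolding Im 2 using signs(1)[of x] pos[of x] by (intro mult_nonneg_nonneg) auto
    thus ?thesis by blast
  next
    case 3
    have "Im (upper_jump 0 x * upper_ray 0 x ^ j) \<ge> 0" for x
      unfolding Im 3 using signs(2)[of x] pos[of x] by (intro mult_nonneg_nonneg) auto
    thus ?thesis by blast
  next
    case 4
    have "Im (upper_jump 0 x * upper_ray 0 x ^ j) \<le> 0" for x
      unfolding Im 4 using signs(1)[of x] pos[of x] by (intro mult_nonneg_nonpos) auto
    thus ?thesis by blast
  qed
qed

text \<open>With a constant sign, the integral of the modulus is the modulus of the integral, and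
  this is pi times a coefficient. Thus the coefficients themselves, not estimates for them, enter
  the first bound.\<close>

lemma abs_Im_upper_moment:
  assumes "j \<ge> 1"
  shows "integrable lborel (\<lambda>x. \<bar>Im (upper_jump 0 x * upper_ray 0 x ^ j)\<bar>)"
    and "(LINT x|lborel. \<bar>Im (upper_jump 0 x * upper_ray 0 x ^ j)\<bar>) = pi * \<bar>stirling_coeff j\<bar>"
proof -
  define f where "f = (\<lambda>x. Im (upper_jump 0 x * upper_ray 0 x ^ j))"
  have i: "integrable lborel (\<lambda>x. upper_jump 0 x * upper_ray 0 x ^ j)"
    by (rule integrable_upper_jump_moment) (use assms in auto)
  hence f: "integrable lborel f" unfolding f_def by (rule integrable_Im)
  show "integrable lborel (\<lambda>x. \<bar>Im (upper_jump 0 x * upper_ray 0 x ^ j)\<bar>)"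
    using f unfolding f_def by (rule Bochner_Integration.integrable_abs)
  have I: "(LINT x|lborel. f x) = Im (upper_moment 0 j)"
    unfolding f_def upper_moment_def using i by (rule integral_Im)
  have "(LINT x|lborel. \<bar>f x\<bar>) = \<bar>LINT x|lborel. f x\<bar>"
  proof (cases "\<forall>x. f x \<ge> 0")
    case True
    thus ?thesis using Bochner_Integration.integral_nonneg[of lborel f] by simp
  next
    case False
    hence neg: "f x \<le> 0" for x using upper_jump_0_power_signs[of j] by (auto simp: f_def)
    hence "(LINT x|lborel. \<bar>f x\<bar>) = (LINT x|lborel. - f x)" by simp
    also have "\<dots> = - (LINT x|lborel. f x)" by simp
    moreover have "(LINT x|lborel. - f x) \<ge> 0" by (rule integral_nonneg_AE) (use neg in auto)
    ultimately show ?thesis by simp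
  qed
  also have "\<dots> = pi * \<bar>stirling_coeff j\<bar>"
    unfolding I stirling_coeff_jump_0 using assms by (simp add: abs_mult power_abs)
  finally show "(LINT x|lborel. \<bar>Im (upper_jump 0 x * upper_ray 0 x ^ j)\<bar>) = pi * \<bar>stirling_coeff j\<bar>"
    by (simp add: f_def)
qed

text \<open>For phi = 0 the lower ray is the negative of the upper one and the jumps are conjugate,
  so the two kernels are 1 / (1 - q) and 1 / (1 + q). Over the common denominator 1 - q^2 the
  numerator splits into the integrands that belong to the coefficients K and K + 1.\<close>

theorem stirling_remainder_bound_two_terms:
  fixes r \<omega> :: real
  assumes \<omega>: "0 \<le> \<omega>" "\<omega> \<le> pi / 4" and K: "K \<ge> 1"
  shows "norm (stirling_remainder K (exp (Complex r \<omega>))) \<le>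
           \<bar>stirling_coeff K\<bar> * exp (- (real K * r)) + \<bar>stirling_coeff (K + 1)\<bar> * exp (- (real (K + 1) * r))"
proof -
  define z where "z = exp (Complex r \<omega>)"
  have z0: "z \<noteq> 0" and nz: "norm z = exp r" by (simp_all add: z_def norm_exp_Complex)
  define J where "J = (\<lambda>j x. upper_jump 0 x * upper_ray 0 x ^ j)"
  define u where "u = (\<lambda>x. upper_jump 0 x * ((upper_ray 0 x / z) ^ K / (1 - upper_ray 0 x / z)))"
  define l where "l = (\<lambda>x. lower_jump x * ((lower_ray x / z) ^ K / (1 - lower_ray x / z)))"
  have \<omega>': "- (pi / 2) < \<omega>" "\<omega> < pi / 2 + 0" using \<omega> pi_gt_zero by linarith+
  have \<phi>: "(0::real) \<le> 0" "(0::real) < pi / 2" by auto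
  have E: "integrable lborel u" "integrable lborel l"
    "Gamma_star z = (\<Sum>j<K. jump_coeff 0 j / z ^ j) +
           ((LINT x|lborel. u x) - (LINT x|lborel. l x)) / (2 * pi * \<i>)"
    using Gamma_star_expansion[OF \<phi> \<omega>' K, of r] unfolding u_def l_def z_def by blast+
  have bound: "norm (u x - l x) \<le> 2 * (\<bar>Im (J K x)\<bar> * exp (- (real K * r)) + \<bar>Im (J (K + 1) x)\<bar> * exp (- (real (K + 1) * r)))" for x
  proof -
    define w where "w = upper_ray 0 x"
    define q where "q = w / z"
    have w: "w = \<i> * of_real (exp x)"
      unfolding w_def by (rule complex_eqI) (simp_all add: Re_upper_ray Im_upper_ray)
    have low: "lower_ray x = - w" unfolding lower_ray_eq w by simp
    have Jl: "lower_jump x * lower_ray x ^ K = cnj (J K x)"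
      by (simp add: J_def lower_jump_cnj lower_ray_cnj)
    \<comment> \<open>arg q = pi/2 - omega, so q^2 has argument pi - 2 omega; omega <= pi/4 keeps it
      in the closed left half-plane.\<close>
    have q2: "Re (q ^ 2) \<le> 0"
    proof -
      have "q = exp (Complex (x - r) (pi / 2 - \<omega>))"
        by (simp add: q_def w_def upper_ray_def z_def flip: exp_diff) (simp add: complex_diff)
      hence "q ^ 2 = exp (Complex (2 * (x - r)) (2 * (pi / 2 - \<omega>)))"
        by (simp add: power2_eq_square complex_add flip: exp_add)
      moreover have "cos (2 * (pi / 2 - \<omega>)) = - cos (2 * \<omega>)"
        by (simp add: right_diff_distrib cos_diff)
      moreover have "cos (2 * \<omega>) \<ge> 0" using \<omega> by (intro cos_ge_zero) auto
      ultimately show ?thesis by (simp add: Re_exp mult_le_0_iff)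
    qed
    hence d: "norm (1 - q ^ 2) \<ge> 1" by (rule norm_one_minus_ge_1)
    hence d0: "1 - q ^ 2 \<noteq> 0" by auto
    have f: "1 - q ^ 2 = (1 - q) * (1 + q)" by (simp add: power2_eq_square algebra_simps)
    have nq: "1 - q \<noteq> 0" "1 + q \<noteq> 0" using d0 unfolding f by auto
    have i1: "1 / (1 - q) = (1 + q) / (1 - q ^ 2)" and i2: "1 / (1 + q) = (1 - q) / (1 - q ^ 2)"
      unfolding f using nq by simp_all
    have "u x = J K x / z ^ K * (1 / (1 - q))"
      by (simp add: u_def J_def q_def w_def power_divide)
    also have "\<dots> = J K x * (1 + q) / (z ^ K * (1 - q ^ 2))" unfolding i1 by simp
    finally have ux: "u x = J K x * (1 + q) / (z ^ K * (1 - q ^ 2))" .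
    have "l x = cnj (J K x) / z ^ K * (1 / (1 + q))"
      unfolding Jl[symmetric] l_def low power_divide q_def by simp
    also have "\<dots> = cnj (J K x) * (1 - q) / (z ^ K * (1 - q ^ 2))" unfolding i2 by simp
    finally have lx: "l x = cnj (J K x) * (1 - q) / (z ^ K * (1 - q ^ 2))" .
    have num: "J K x * (1 + q) - cnj (J K x) * (1 - q) =
            2 * \<i> * of_real (Im (J K x)) + q * (2 * of_real (Re (J K x)))"
      by (rule complex_eqI) (simp_all add: algebra_simps)
    \<comment> \<open>One more factor w = i e^x turns the real part into an imaginary part, hence
      the coefficient of index K + 1.\<close>
    have J1: "Im (J (K + 1) x) = exp x * Re (J K x)"
    proof -
      have "J (K + 1) x = J K x * (\<i> * of_real (exp x))"
        by (simp add: J_def w_def[symmetric] w)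
      thus ?thesis by simp
    qed
    have nq': "norm q = exp x / exp r" by (simp add: q_def norm_divide nz w_def)
    have "norm (u x - l x) = norm (J K x * (1 + q) - cnj (J K x) * (1 - q)) / (norm (z ^ K) * norm (1 - q ^ 2))"
      unfolding ux lx by (simp add: norm_divide norm_mult flip: diff_divide_distrib)
    also have "\<dots> \<le> norm (J K x * (1 + q) - cnj (J K x) * (1 - q)) / (norm (z ^ K) * 1)"
      using d z0 by (intro divide_left_mono mult_left_mono mult_pos_pos) auto
    also have "\<dots> \<le> (2 * \<bar>Im (J K x)\<bar> + norm q * (2 * \<bar>Re (J K x)\<bar>)) / (norm (z ^ K) * 1)"
      unfolding num
      by (intro divide_right_mono order_trans[OF norm_triangle_ineq]) (auto simp: norm_mult)
    also have "norm q * (2 * \<bar>Re (J K x)\<bar>) = 2 * \<bar>Im (J (K + 1) x)\<bar> / exp r"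
      unfolding J1 nq' by (simp add: abs_mult)
    also have "norm (z ^ K) * 1 = exp (real K * r)" by (simp add: norm_power nz exp_of_nat_mult)
    also have "(2 * \<bar>Im (J K x)\<bar> + 2 * \<bar>Im (J (K + 1) x)\<bar> / exp r) / exp (real K * r) =
        2 * (\<bar>Im (J K x)\<bar> * exp (- (real K * r)) + \<bar>Im (J (K + 1) x)\<bar> * exp (- (real (K + 1) * r)))"
    proof -
      have "exp (- (real (K + 1) * r)) = exp (- (real K * r)) / exp r"
        by (simp add: distrib_right flip: exp_diff)
      moreover have "a / exp (real K * r) = a * exp (- (real K * r))" for a
        by (simp add: exp_minus divide_inverse)
      ultimately show ?thesis by (simp add: algebra_simps)
    qed
    finally show ?thesis .
  qed
  have J: "integrable lborel (\<lambda>x. \<bar>Im (J K x)\<bar>)" "(LINT x|lborel. \<bar>Im (J K x)\<bar>) = pi * \<bar>stirling_coeff K\<bar>"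
      "integrable lborel (\<lambda>x. \<bar>Im (J (K + 1) x)\<bar>)" "(LINT x|lborel. \<bar>Im (J (K + 1) x)\<bar>) = pi * \<bar>stirling_coeff (K + 1)\<bar>"
    using abs_Im_upper_moment[of K] abs_Im_upper_moment[of "K + 1"] K unfolding J_def by auto
  have "norm ((LINT x|lborel. u x) - (LINT x|lborel. l x)) = norm (LINT x|lborel. u x - l x)"
    using E by simp
  also have "\<dots> \<le> (LINT x|lborel. norm (u x - l x))" by (rule integral_norm_bound)
  also have "\<dots> \<le> (LINT x|lborel. 2 * (\<bar>Im (J K x)\<bar> * exp (- (real K * r)) + \<bar>Im (J (K + 1) x)\<bar> * exp (- (real (K + 1) * r))))"
    using E J by (intro integral_mono bound) auto
  also have "\<dots> = 2 * (pi * \<bar>stirling_coeff K\<bar> * exp (- (real K * r)) + pi * \<bar>stirling_coeff (K + 1)\<bar> * exp (- (real (K + 1) * r)))"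
    using J by (simp del: of_nat_add of_nat_Suc)
  also have "\<dots> = 2 * pi * (\<bar>stirling_coeff K\<bar> * exp (- (real K * r)) + \<bar>stirling_coeff (K + 1)\<bar> * exp (- (real (K + 1) * r)))"
    by (simp add: distrib_left mult.assoc)
  finally have main: "norm ((LINT x|lborel. u x) - (LINT x|lborel. l x)) \<le>
      2 * pi * (\<bar>stirling_coeff K\<bar> * exp (- (real K * r)) + \<bar>stirling_coeff (K + 1)\<bar> * exp (- (real (K + 1) * r)))" .
  have "stirling_remainder K z = ((LINT x|lborel. u x) - (LINT x|lborel. l x)) / (2 * pi * \<i>)"
    unfolding stirling_remainder_def E(3) jump_coeff_eq_stirling_coeff[OF \<phi>] by simp
  hence "norm (stirling_remainder K z) = norm ((LINT x|lborel. u x) - (LINT x|lborel. l x)) / (2 * pi)"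
    by (simp add: norm_divide norm_mult)
  also have "\<dots> \<le> 2 * pi * (\<bar>stirling_coeff K\<bar> * exp (- (real K * r)) + \<bar>stirling_coeff (K + 1)\<bar> * exp (- (real (K + 1) * r))) / (2 * pi)"
    using main by (intro divide_right_mono) auto
  finally show ?thesis by (simp add: z_def)
qed

section \<open>The coefficients as a line integral\<close>

lemma ex1_phi_star:
  assumes w: "0 < w" "w < pi" and K: "K \<ge> 2"
  shows "\<exists>!p. is_phi_star K w p"
proof -
  \<comment> \<open>Both cases of the side condition on p say |w - 2 p| < m. As m <= pi/2, sine is
    injective there, and sin m = sin w exceeds the prescribed value c, so w - 2 p = arcsin c is the
    one solution.\<close>
  define m where "m = min w (pi - w)"
  have m: "0 < m" "m \<le> pi / 2" using w by (auto simp: m_def min_def)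
  have sin_m: "sin m = sin w" by (auto simp: m_def min_def)
  define c where "c = (real K - 1) / (real K + 1) * sin w"
  have sw: "sin w > 0" using w by (intro sin_gt_zero) auto
  have c: "\<bar>c\<bar> < sin m"
  proof -
    have "(real K - 1) / (real K + 1) * sin w < 1 * sin w"
      using K sw by (intro mult_strict_right_mono) (auto simp: field_simps)
    moreover have "c \<ge> 0" unfolding c_def using K sw by (intro mult_nonneg_nonneg) auto
    ultimately show ?thesis by (simp add: sin_m c_def)
  qed
  have "\<bar>c\<bar> \<le> 1" by (rule less_imp_le[OF less_le_trans[OF c sin_le_one]])
  hence c1: "- 1 \<le> c" "c \<le> 1" by linarith+
  have eq_iff: "(real K + 1) * sin (w - 2 * p) = (real K - 1) * sin w \<longleftrightarrow> sin (w - 2 * p) = c" for p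
    unfolding c_def using K by (simp add: field_simps)
  have range: "(pi / 2 \<le> w \<and> w < pi \<longrightarrow> - pi / 2 + w < p \<and> p < pi / 2) \<and>
     (0 < w \<and> w < pi / 2 \<longrightarrow> 0 < p \<and> p < w) \<longleftrightarrow> - m < w - 2 * p \<and> w - 2 * p < m" for p
    using w by (auto simp: m_def min_def)
  have iff: "is_phi_star K w p \<longleftrightarrow> w - 2 * p = arcsin c" for p
  proof
    assume "is_phi_star K w p"
    hence *: "sin (w - 2 * p) = c" "- m < w - 2 * p" "w - 2 * p < m"
      unfolding is_phi_star_def eq_iff range by auto
    have "arcsin (sin (w - 2 * p)) = w - 2 * p" using * m by (intro arcsin_sin) auto
    thus "w - 2 * p = arcsin c" using * by simp
  next
    assume a: "w - 2 * p = arcsin c"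
    have "arcsin (sin m) = m" using m by (intro arcsin_sin) auto
    moreover have "arcsin c < arcsin (sin m)" using c c1 by (intro arcsin_less_arcsin) auto
    moreover have "arcsin (- sin m) < arcsin c" using c c1 by (intro arcsin_less_arcsin) auto
    moreover have "arcsin (- sin m) = - arcsin (sin m)" by (rule arcsin_minus) auto
    moreover have "sin (arcsin c) = c" using c1 by (intro sin_arcsin)
    ultimately have "sin (w - 2 * p) = c" "- m < w - 2 * p" "w - 2 * p < m"
      unfolding a by auto
    thus "is_phi_star K w p"
      unfolding is_phi_star_def eq_iff range by blast
  qed
  show ?thesis
    unfolding iff by (rule ex1I[of _ "(w - arcsin c) / 2"]) (auto simp: field_simps)
qed

text \<open>These are the conditions on the rotation angle in
  \<open>stirling_remainder_bound_zeta\<close>: the turned ray stays in the open upper half-plane,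
  and the point of angle w lies strictly before it.\<close>

lemma phi_star_range:
  assumes w: "0 < w" "w < pi" and K: "K \<ge> 2"
  shows "0 \<le> phi_star K w" "phi_star K w < pi / 2" "w < pi / 2 + phi_star K w"
proof -
  have "is_phi_star K w (phi_star K w)"
    unfolding phi_star_def by (rule theI'[OF ex1_phi_star[OF assms]])
  thus "0 \<le> phi_star K w" "phi_star K w < pi / 2" "w < pi / 2 + phi_star K w"
    using w unfolding is_phi_star_def by (cases "w < pi / 2"; auto)+
qed

lemma Lambert_W_exp:
  assumes "x \<ge> -1"
  shows "Lambert_W (x * exp x) = x"
  unfolding Lambert_W_def
proof (rule the_equality)
  fix w :: real assume w: "- 1 \<le> w \<and> w * exp w = x * exp x"
  have mono: "a * exp a < b * exp b" if "- 1 \<le> a" "a < b" for a b :: real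
  proof (rule DERIV_pos_imp_increasing_open[OF that(2)])
    fix y assume "a < y" "y < b"
    hence "(1 + y) * exp y > 0" using that by simp
    moreover have "((\<lambda>y. y * exp y) has_real_derivative (1 + y) * exp y) (at y)"
      by (auto intro!: derivative_eq_intros simp: algebra_simps)
    ultimately show "\<exists>d. ((\<lambda>y. y * exp y) has_real_derivative d) (at y) \<and> d > 0" by blast
  qed (intro continuous_intros)
  show "w = x" using mono[of w x] mono[of x w] w assms by (cases w x rule: linorder_cases) auto
qed (use assms in auto)

text \<open>In logarithms, w e^w = e^(pi - 1) reads w + ln w = pi - 1, and x + ln x is
  increasing.\<close>

lemma le_of_Lambert_W_le:
  assumes "0 < l" "Lambert_W (exp (pi - 1)) \<le> l"
  shows "pi - 1 \<le> l + ln l"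
proof -
  \<comment> \<open>At w = e^(pi - 1) the product w e^w already exceeds e^(pi - 1), which gives the
    upper end for the intermediate value theorem.\<close>
  have "\<exists>w\<ge>0. w \<le> exp (pi - 1) \<and> w * exp w = exp (pi - 1)"
  proof (rule IVT')
    show "exp (pi - 1) \<le> exp (pi - 1) * exp (exp (pi - 1 :: real))" by simp
  qed (auto intro!: continuous_intros)
  then obtain w :: real where w: "w \<ge> 0" "w * exp w = exp (pi - 1)" by blast
  have "w \<noteq> 0" using w(2) by auto
  hence w0: "w > 0" using w by simp
  have "Lambert_W (exp (pi - 1)) = w" using Lambert_W_exp[of w] w by simp
  hence wl: "w \<le> l" using assms by simp
  have "pi - 1 = ln (w * exp w)" using w(2) by simp
  also have "\<dots> = ln w + w" using w0 by (simp add: ln_mult)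
  also have "\<dots> \<le> ln l + l" using wl w0 by (intro add_mono) auto
  finally show ?thesis by simp
qed

lemma Lambda_nonzero: "Lambda l \<noteq> 0"
  by (simp add: Lambda_def complex_eq_iff)

lemma norm_Lambda_pos: "norm (Lambda l) > 0"
  using Lambda_nonzero by simp

lemma omega_range: "0 < omega l" "omega l < pi"
proof -
  have Im: "Im (Lambda l) > 0" by (simp add: Lambda_def)
  show "0 < omega l" "omega l < pi"
    unfolding omega_def using Im Arg_lt_pi[of "Lambda l"] by auto
qed

lemma Lambda_polar: "Lambda l = of_real (norm (Lambda l)) * cis (omega l)"
  unfolding omega_def using rcis_cmod_Arg[of "Lambda l"] by (simp add: rcis_def)

text \<open>The preceding inequality says Re (Lambda l) >= pi = Im (Lambda l). An angle above pi/4
  would give a cosine below and a sine above the common value at pi/4.\<close>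

lemma omega_le_pi_4:
  assumes "0 < l" "Lambert_W (exp (pi - 1)) \<le> l"
  shows "omega l \<le> pi / 4"
proof (rule ccontr)
  assume "\<not> omega l \<le> pi / 4"
  hence w: "pi / 4 < omega l" by simp
  have "pi \<le> Re (Lambda l)" using le_of_Lambert_W_le[OF assms] by (simp add: Lambda_def)
  also have "Re (Lambda l) = norm (Lambda l) * cos (omega l)"
    by (subst Lambda_polar) simp
  also have "\<dots> < norm (Lambda l) * cos (pi / 4)"
    using w omega_range[of l] norm_Lambda_pos[of l]
    by (intro mult_strict_left_mono cos_monotone_0_pi) auto
  finally have 1: "pi < norm (Lambda l) * cos (pi / 4)" .
  have Im: "norm (Lambda l) * sin (omega l) = pi"
  proof -
    have "Im (Lambda l) = norm (Lambda l) * sin (omega l)" by (subst Lambda_polar) simp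
    thus ?thesis by (simp add: Lambda_def)
  qed
  have Re: "norm (Lambda l) * cos (omega l) \<ge> pi"
    using \<open>pi \<le> Re (Lambda l)\<close> \<open>Re (Lambda l) = norm (Lambda l) * cos (omega l)\<close> by simp
  hence "cos (omega l) > 0"
    using norm_Lambda_pos[of l] pi_gt_zero by (metis less_le_trans zero_less_mult_pos)
  have half: "omega l < pi / 2"
  proof (rule ccontr)
    assume "\<not> omega l < pi / 2"
    hence "cos (omega l) \<le> cos (pi / 2)"
      using omega_range[of l] by (intro cos_monotone_0_pi_le) auto
    thus False using \<open>cos (omega l) > 0\<close> by simp
  qed
  have "sin (pi / 4) < sin (omega l)"
    using w half by (intro sin_monotone_2pi) auto
  hence "norm (Lambda l) * sin (pi / 4) < norm (Lambda l) * sin (omega l)"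
    using norm_Lambda_pos[of l] by (rule mult_strict_left_mono)
  hence "norm (Lambda l) * sin (pi / 4) < pi" unfolding Im .
  thus False using 1 by (simp add: sin_45 cos_45)
qed

section \<open>From derivatives at 0 to an integral over Im y = pi\<close>

lemma integrable_inverse_1_plus_sq: "integrable lborel (\<lambda>x::real. 1 / (1 + x\<^sup>2))"
proof -
  define F where "F = (\<lambda>x::real. 1 / (1 + x\<^sup>2))"
  have pos: "1 + x\<^sup>2 > 0" for x :: real by (simp add: add_pos_nonneg)
  have cont: "continuous_on A F" for A
    unfolding F_def using pos by (intro continuous_intros) (auto simp: less_imp_neq[symmetric])
  have "integrable lborel (\<lambda>x. exp x * F (exp x))"
  proof (rule Bochner_Integration.integrable_bound)
    show "integrable lborel (\<lambda>x::real. exp (- 1 * \<bar>x\<bar>))" using integrable_exp_neg_abs[of 1] by simp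
    have "continuous_on UNIV (\<lambda>x. exp x * F (exp x))"
      by (intro continuous_intros continuous_on_compose2[OF cont[of UNIV]]) auto
    thus "(\<lambda>x. exp x * F (exp x)) \<in> borel_measurable lborel"
      using borel_measurable_continuous_onI by auto
    show "AE x in lborel. norm (exp x * F (exp x)) \<le> norm (exp (- 1 * \<bar>x\<bar>))"
    proof (rule AE_I2)
      fix x :: real
      have "exp x * F (exp x) \<le> exp (- \<bar>x\<bar>)"
      proof (cases "x \<ge> 0")
        case True
        have "exp x * (1 / (1 + (exp x)\<^sup>2)) \<le> exp x * (1 / (exp x)\<^sup>2)"
          using pos[of "exp x"] by (intro mult_left_mono divide_left_mono) auto
        also have "\<dots> = exp (- x)" by (simp add: power2_eq_square exp_minus field_simps)
        finally show ?thesis using True by (simp add: F_def)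
      next
        case False
        have "exp x * (1 / (1 + (exp x)\<^sup>2)) \<le> exp x * 1"
          using pos[of "exp x"] by (intro mult_left_mono) (auto simp: divide_le_eq_1)
        thus ?thesis using False by (simp add: F_def)
      qed
      moreover have "exp x * F (exp x) \<ge> 0" using pos[of "exp x"] by (simp add: F_def)
      ultimately show "norm (exp x * F (exp x)) \<le> norm (exp (- 1 * \<bar>x\<bar>))" by simp
    qed
  qed
  hence 1: "integrable lborel (\<lambda>x. indicator {0<..} x *\<^sub>R F x)"
    using exp_substitution_real(1)[OF cont] by (simp add: set_integrable_def)
  have 2: "integrable lborel (\<lambda>x. indicator {0<..} (-x) *\<^sub>R F (-x))"
    using lborel_integrable_real_affine[OF 1, of "-1" 0] by simp
  have "integrable lborel F"
  proof (rule Bochner_Integration.integrable_bound[OF Bochner_Integration.integrable_add[OF 1 2]])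
    show "F \<in> borel_measurable lborel" using borel_measurable_continuous_onI[OF cont] by simp
    have "AE x in lborel. x \<noteq> (0::real)" by (rule AE_lborel_singleton)
    thus "AE x in lborel. norm (F x) \<le> norm (indicator {0<..} x *\<^sub>R F x + indicator {0<..} (-x) *\<^sub>R F (-x))"
      by eventually_elim (auto simp: F_def indicator_def)
  qed
  thus ?thesis by (simp add: F_def)
qed

text \<open>At the left end of the line the denominator grows only linearly, so its reciprocal
  powers decay algebraically and a majorant of order 1 / x^2 replaces the exponential ones.\<close>

lemma integrable_of_square_decay:
  fixes f :: "real \<Rightarrow> complex"
  assumes cont: "continuous_on UNIV f"
    and bound: "\<And>x. X \<le> \<bar>x\<bar> \<Longrightarrow> norm (f x) \<le> B / x\<^sup>2"
  shows "integrable lborel f"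
proof -
  define Y where "Y = max X 1"
  have "compact (f ` {-Y..Y})"
    by (intro compact_continuous_image continuous_on_subset[OF cont]) auto
  then obtain M where M: "M > 0" "\<And>x. x \<in> {-Y..Y} \<Longrightarrow> norm (f x) \<le> M"
    using compact_imp_bounded bounded_pos by (metis imageI)
  define C where "C = M * (1 + Y\<^sup>2) + 2 * \<bar>B\<bar>"
  have pos: "1 + x\<^sup>2 > 0" for x :: real by (simp add: add_pos_nonneg)
  have C: "C \<ge> 0" unfolding C_def using M(1) by simp
  show ?thesis
  proof (rule Bochner_Integration.integrable_bound)
    show "integrable lborel (\<lambda>x. C * (1 / (1 + x\<^sup>2)))"
      by (rule integrable_mult_right) (rule integrable_inverse_1_plus_sq)
    show "f \<in> borel_measurable lborel" using borel_measurable_continuous_onI[OF cont] by simp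
    show "AE x in lborel. norm (f x) \<le> norm (C * (1 / (1 + x\<^sup>2)))"
    proof (rule AE_I2)
      fix x :: real
      have "norm (f x) * (1 + x\<^sup>2) \<le> C"
      proof (cases "\<bar>x\<bar> \<ge> Y")
        case True
        hence x: "\<bar>x\<bar> \<ge> 1" "X \<le> \<bar>x\<bar>" by (auto simp: Y_def)
        have x2: "1 \<le> x\<^sup>2" using x(1) by (simp add: abs_le_square_iff[of 1 x, simplified])
        have "norm (f x) \<le> \<bar>B\<bar> / x\<^sup>2"
          by (rule order_trans[OF bound[OF x(2)] divide_right_mono[OF abs_ge_self]]) simp
        hence "norm (f x) * (1 + x\<^sup>2) \<le> \<bar>B\<bar> / x\<^sup>2 * (x\<^sup>2 + x\<^sup>2)"
          using x2 by (intro mult_mono) auto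
        also have "\<dots> = 2 * \<bar>B\<bar>"
        proof -
          have "x \<noteq> 0" using x(1) by auto
          thus ?thesis by (simp add: field_simps)
        qed
        also have "\<dots> \<le> C" unfolding C_def using M(1) pos[of Y] by simp
        finally show ?thesis .
      next
        case False
        hence "x \<in> {-Y..Y}" by auto
        hence "norm (f x) \<le> M" by (rule M(2))
        moreover have "x\<^sup>2 \<le> Y\<^sup>2" using False by (intro abs_le_square_iff[THEN iffD1]) auto
        ultimately have "norm (f x) * (1 + x\<^sup>2) \<le> M * (1 + Y\<^sup>2)"
          using M(1) pos[of x] by (intro mult_mono) auto
        also have "\<dots> \<le> C" by (simp add: C_def)
        finally show ?thesis .
      qed
      thus "norm (f x) \<le> norm (C * (1 / (1 + x\<^sup>2)))"
        using C pos[of x] by (simp add: le_divide_eq)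
    qed
  qed
qed

text \<open>\<open>b_neg\<close> is defined by derivatives of a real function, the residue by those
  of a complex one. The derivative of a holomorphic function along the real line is the complex
  derivative, and it stays real if the values are real.\<close>

lemma higher_deriv_of_real:
  assumes "F holomorphic_on U" "open U" "\<And>t::real. of_real t \<in> U"
    and "\<And>t::real. F (of_real t) = of_real (\<phi> t)"
  shows "(deriv ^^ k) F (of_real t) = of_real ((deriv ^^ k) \<phi> t)"
proof (induction k arbitrary: t)
  case (Suc k)
  define G where "G = (deriv ^^ k) F"
  define \<psi> where "\<psi> = (deriv ^^ k) \<phi>"
  have "G holomorphic_on U" unfolding G_def by (intro holomorphic_higher_deriv assms)
  hence "(G has_field_derivative deriv G (of_real t)) (at (of_real t))"
    by (intro holomorphic_derivI[of _ U] assms)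
  from has_vector_derivative_real_field[OF this]
  have "((\<lambda>t. of_real (\<psi> t)) has_vector_derivative deriv G (of_real t)) (at t)"
    using Suc.IH by (simp add: G_def \<psi>_def)
  hence d: "((\<lambda>t. complex_of_real (\<psi> t)) has_derivative (\<lambda>x. x *\<^sub>R deriv G (of_real t))) (at t)"
    by (simp add: has_vector_derivative_def)
  have "((\<lambda>t. Re (of_real (\<psi> t))) has_derivative (\<lambda>x. Re (x *\<^sub>R deriv G (of_real t)))) (at t)"
    by (rule bounded_linear.has_derivative[OF bounded_linear_Re d])
  hence R: "(\<psi> has_real_derivative Re (deriv G (of_real t))) (at t)"
    unfolding has_real_derivative_iff_has_vector_derivative has_vector_derivative_def by simp
  have "((\<lambda>t. Im (of_real (\<psi> t))) has_derivative (\<lambda>x. Im (x *\<^sub>R deriv G (of_real t)))) (at t)"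
    by (rule bounded_linear.has_derivative[OF bounded_linear_Im d])
  hence "((\<lambda>t. 0) has_real_derivative Im (deriv G (of_real t))) (at t)"
    unfolding has_real_derivative_iff_has_vector_derivative has_vector_derivative_def by simp
  hence "Im (deriv G (of_real t)) = 0" using DERIV_unique[OF _ DERIV_const] by blast
  moreover have "deriv \<psi> t = Re (deriv G (of_real t))" using R by (rule DERIV_imp_deriv)
  ultimately show ?case by (simp add: G_def \<psi>_def complex_eq_iff)
qed (use assms(4) in auto)

definition saddle_fun :: "real \<Rightarrow> complex \<Rightarrow> complex" where
  "saddle_fun l y = of_real l * exp y + y - of_real l"

text \<open>For y = a + b i the imaginary part l e^a sin b + b has the sign of b when |b| <= pi, so
  a zero is real; on the real line the function is strictly increasing and vanishes at 0.\<close>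

lemma saddle_fun_nonzero:
  assumes l: "l > 0" and y: "\<bar>Im y\<bar> \<le> pi" "y \<noteq> 0"
  shows "saddle_fun l y \<noteq> 0"
proof
  assume z: "saddle_fun l y = 0"
  have Re: "l * exp (Re y) * cos (Im y) + Re y - l = 0"
    using arg_cong[OF z, of Re] by (simp add: saddle_fun_def Re_exp)
  have Im: "l * exp (Re y) * sin (Im y) + Im y = 0"
    using arg_cong[OF z, of Im] by (simp add: saddle_fun_def Im_exp)
  have le: "l * exp (Re y) > 0" using l by simp
  have Im0: "Im y = 0"
  proof (cases "Im y" "0::real" rule: linorder_cases)
    case greater
    hence "sin (Im y) \<ge> 0" using y by (intro sin_ge_zero) auto
    hence "l * exp (Re y) * sin (Im y) \<ge> 0" by (rule mult_nonneg_nonneg[OF less_imp_le[OF le]])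
    thus ?thesis using Im greater by linarith
  next
    case less
    hence "sin (- Im y) \<ge> 0" using y by (intro sin_ge_zero) auto
    hence "sin (Im y) \<le> 0" by simp
    hence "l * exp (Re y) * sin (Im y) \<le> 0" by (rule mult_nonneg_nonpos[OF less_imp_le[OF le]])
    thus ?thesis using Im less by linarith
  qed
  hence R0: "l * exp (Re y) + Re y - l = 0" using Re by simp
  have "Re y = 0"
  proof (cases "Re y" "0::real" rule: linorder_cases)
    case greater
    hence "l * exp (Re y) > l * 1" using l by (intro mult_strict_left_mono) auto
    thus ?thesis using R0 greater by linarith
  next
    case less
    hence "l * exp (Re y) < l * 1" using l by (intro mult_strict_left_mono) auto
    thus ?thesis using R0 less by linarith
  qed
  with Im0 y(2) show False by (simp add: complex_eq_iff)
qed

text \<open>The threshold 4 l serves the left end, where the linear term must dominate the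
  constants; the inequality serves the right end, where the exponential dominates everything
  else.\<close>

lemma exp_linear_dominates:
  assumes "l > (0::real)"
  obtains X where "X \<ge> 4 * l" "X \<ge> 2" "\<And>x. x \<ge> X \<Longrightarrow> x / 2 \<le> l * exp x - x - pi - l"
proof -
  have "filterlim (\<lambda>x. l * exp x - x - pi - l - x / 2) at_top at_top"
    using assms by real_asymp
  hence "eventually (\<lambda>x. l * exp x - x - pi - l - x / 2 \<ge> 0) at_top"
    by (rule filterlim_at_top[THEN iffD1, rule_format])
  then obtain X0 where X0: "\<And>x. x \<ge> X0 \<Longrightarrow> l * exp x - x - pi - l - x / 2 \<ge> 0"
    by (auto simp: eventually_at_top_linorder)
  show ?thesis
  proof (rule that[of "max X0 (max (4 * l) 2)"])
    fix x assume "x \<ge> max X0 (max (4 * l) 2)"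
    hence "x \<ge> X0" by simp
    from X0[OF this] show "x / 2 \<le> l * exp x - x - pi - l" by linarith
  qed auto
qed

lemma saddle_fun_growth:
  assumes l: "l > 0"
  obtains X where "X \<ge> 2" "\<And>x y. \<bar>y\<bar> \<le> pi \<Longrightarrow> X \<le> \<bar>x\<bar> \<Longrightarrow> \<bar>x\<bar> / 2 \<le> norm (saddle_fun l (Complex x y))"
proof -
  obtain X where X: "X \<ge> 4 * l" "X \<ge> 2" "\<And>x. x \<ge> X \<Longrightarrow> x / 2 \<le> l * exp x - x - pi - l"
    using exp_linear_dominates[OF l] by blast
  show ?thesis
  proof (rule that[OF X(2)])
    fix x y :: real assume y: "\<bar>y\<bar> \<le> pi" and x: "X \<le> \<bar>x\<bar>"
    have ne: "norm (of_real l * exp (Complex x y)) = l * exp x"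
      using l by (simp add: norm_mult norm_exp_Complex)
    have nl: "norm (complex_of_real l) = l" using l by simp
    show "\<bar>x\<bar> / 2 \<le> norm (saddle_fun l (Complex x y))"
    proof (cases "x \<ge> 0")
      case True
      have "norm (Complex x y) \<le> \<bar>x\<bar> + \<bar>y\<bar>" using cmod_le[of "Complex x y"] by simp
      moreover have "norm (Complex x y - of_real l) \<le> norm (Complex x y) + norm (complex_of_real l)"
        by (rule norm_triangle_ineq4)
      moreover have "norm (of_real l * exp (Complex x y)) - norm (Complex x y - of_real l) \<le>
          norm (of_real l * exp (Complex x y) + (Complex x y - of_real l))"
        by (rule norm_diff_ineq)
      ultimately have "l * exp x - (\<bar>x\<bar> + \<bar>y\<bar> + l) \<le> norm (of_real l * exp (Complex x y) + (Complex x y - of_real l))"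
        unfolding ne nl by linarith
      moreover have "of_real l * exp (Complex x y) + (Complex x y - of_real l) = saddle_fun l (Complex x y)"
        by (simp add: saddle_fun_def)
      ultimately have "l * exp x - (\<bar>x\<bar> + \<bar>y\<bar> + l) \<le> norm (saddle_fun l (Complex x y))" by simp
      moreover have "x / 2 \<le> l * exp x - x - pi - l" using X(3) x True by simp
      ultimately show ?thesis using y True by simp
    next
      case False
      have "l * exp x \<le> l * 1" using False l by (intro mult_left_mono) auto
      moreover have "\<bar>x\<bar> \<le> norm (Complex x y)" using abs_Re_le_cmod[of "Complex x y"] by simp
      moreover have "norm (of_real l * exp (Complex x y) - of_real l) \<le> l * exp x + l"
        using norm_triangle_ineq4[of "of_real l * exp (Complex x y)" "of_real l"] unfolding ne nl .
      moreover have "norm (Complex x y) - norm (of_real l * exp (Complex x y) - of_real l) \<le>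
          norm (Complex x y + (of_real l * exp (Complex x y) - of_real l))"
        by (rule norm_diff_ineq)
      moreover have "Complex x y + (of_real l * exp (Complex x y) - of_real l) = saddle_fun l (Complex x y)"
        by (simp add: saddle_fun_def)
      ultimately have "\<bar>x\<bar> - 2 * l \<le> norm (saddle_fun l (Complex x y))" by simp
      thus ?thesis using X(1) x by linarith
    qed
  qed
qed

text \<open>The bracket in \<open>b_neg\<close> is ((l + 1) y / f)^(n + 1), so its n-th derivative
  at 0 is n! (l + 1)^(n + 1) times the residue of 1 / f^(n + 1). The integrands on Im y = -pi and Im
  y = pi are conjugate, so a single imaginary part remains.\<close>

theorem b_neg_eq_line_integral:
  assumes l: "l > 0" and n: "n \<ge> 1"
  defines "g \<equiv> \<lambda>x. 1 / saddle_fun l (Complex x pi) ^ (n + 1)"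
  shows "integrable lborel g"
    and "b_neg n l = - ((l + 1) ^ (2 * n + 1) * fact n / pi) * Im (LINT x|lborel. g x)"
proof -
  \<comment> \<open>The ball adds the point 0, where the bracket has its removable singularity; it
    lies in the strip, so 0 is the only zero of f in \<open>U\<close>.\<close>
  define U where "U = {y. saddle_fun l y \<noteq> 0} \<union> ball 0 1"
  have sf_holo: "saddle_fun l holomorphic_on A" for A
    unfolding saddle_fun_def[abs_def] by (intro holomorphic_intros)
  have oU: "open U"
    unfolding U_def saddle_fun_def
    by (intro open_Un open_ball open_Collect_neq continuous_intros)
  have nz: "saddle_fun l y \<noteq> 0" if "y \<in> U" "y \<noteq> 0" for y
  proof (cases "y \<in> ball 0 1")
    case True
    hence "\<bar>Im y\<bar> \<le> pi" using abs_Im_le_cmod[of y] pi_gt3 by simp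
    thus ?thesis using saddle_fun_nonzero[OF l _ that(2)] by simp
  qed (use that in \<open>auto simp: U_def\<close>)
  have inU: "y \<in> U" if "\<bar>Im y\<bar> \<le> pi" for y
    using saddle_fun_nonzero[OF l that] by (cases "y = 0") (auto simp: U_def)
  have "(saddle_fun l has_field_derivative of_real (l + 1)) (at 0)"
    unfolding saddle_fun_def[abs_def] by (auto intro!: derivative_eq_intros)
  hence d0: "deriv (saddle_fun l) 0 = of_real (l + 1)" by (rule DERIV_imp_deriv)
  \<comment> \<open>The divided difference of f at 0, zero-free on \<open>U\<close>; the bracket is
    a power of (l + 1) / k.\<close>
  define k where "k = (\<lambda>y. if y = 0 then of_real (l + 1) else saddle_fun l y / y)"
  have "(\<lambda>z. if z = 0 then deriv (saddle_fun l) 0 else (saddle_fun l z - saddle_fun l 0) / (z - 0)) holomorphic_on U"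
    by (rule pole_lemma_open[OF sf_holo oU])
  moreover have "saddle_fun l 0 = 0" by (simp add: saddle_fun_def)
  ultimately have k: "k holomorphic_on U" by (simp add: k_def d0 cong: if_cong)
  have l1: "complex_of_real (l + 1) \<noteq> 0" unfolding of_real_eq_0_iff using l by simp
  have k0: "k y \<noteq> 0" if "y \<in> U" for y
    using nz[OF that] l1 by (auto simp: k_def simp del: of_real_add)
  define F where "F = (\<lambda>y. (of_real (l + 1) / k y) ^ (n + 1))"
  have F: "F holomorphic_on U" unfolding F_def using k0 by (intro holomorphic_intros k) auto
  define \<phi> where "\<phi> = (\<lambda>t. (if t = 0 then 1 else (l + 1) * t / (l * exp t + t - l)) ^ (n + 1))"
  have F\<phi>: "F (of_real t) = of_real (\<phi> t)" for t :: real
  proof (cases "t = 0")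
    case True
    thus ?thesis using l1 by (simp add: F_def \<phi>_def k_def del: of_real_add)
  next
    case False
    have "saddle_fun l (of_real t) = of_real (l * exp t + t - l)"
      by (simp add: saddle_fun_def exp_of_real)
    thus ?thesis using False by (simp add: F_def \<phi>_def k_def)
  qed
  define D where "D = (deriv ^^ n) \<phi> 0"
  have D: "(deriv ^^ n) F 0 = of_real D"
    using higher_deriv_of_real[OF F oU _ F\<phi>, of n 0] inU by (simp add: D_def)
  define h where "h = (\<lambda>y. (F y / of_real (l + 1) ^ (n + 1)) / y ^ Suc n)"
  have h_eq: "h y = 1 / saddle_fun l y ^ (n + 1)" if "y \<in> U" "y \<noteq> 0" for y
    using that nz[OF that] l1 by (simp add: h_def F_def k_def power_divide field_simps del: of_real_add)
  have F': "(\<lambda>y. F y / of_real (l + 1) ^ (n + 1)) holomorphic_on U"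
    using F l1 by (intro holomorphic_intros) auto
  have res: "residue h 0 = of_real D / (fact n * of_real (l + 1) ^ (n + 1))"
  proof -
    have "residue h 0 = (deriv ^^ n) (\<lambda>y. F y / of_real (l + 1) ^ (n + 1)) 0 / fact n"
      unfolding h_def by (rule residue_holomorphic_over_power'[OF oU _ F']) (use inU in simp)
    also have "(\<lambda>y. F y / of_real (l + 1) ^ (n + 1)) = (\<lambda>y. inverse (of_real (l + 1) ^ (n + 1)) * F y)"
      by (simp add: divide_inverse mult.commute)
    also have "(deriv ^^ n) \<dots> 0 = inverse (of_real (l + 1) ^ (n + 1)) * (deriv ^^ n) F 0"
      by (rule higher_deriv_cmult[OF F _ oU]) (use inU in simp)
    finally show ?thesis unfolding D by (simp add: divide_inverse mult_ac del: of_real_add)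
  qed
  have holo: "h holomorphic_on U - {0}"
    unfolding h_def by (intro holomorphic_intros holomorphic_on_subset[OF F]) (use l1 in auto)
  obtain X where X: "X \<ge> 2" "\<And>x y. \<bar>y\<bar> \<le> pi \<Longrightarrow> X \<le> \<bar>x\<bar> \<Longrightarrow> \<bar>x\<bar> / 2 \<le> norm (saddle_fun l (Complex x y))"
    using saddle_fun_growth[OF l] by blast
  have bound: "norm (h (Complex x y)) \<le> 4 / x\<^sup>2" if y: "- pi \<le> y" "y \<le> pi" and x: "X \<le> \<bar>x\<bar>" for x y
  proof -
    have x2: "\<bar>x\<bar> / 2 \<ge> 1" using x X(1) by simp
    have y': "\<bar>y\<bar> \<le> pi" using y by simp
    have "(\<bar>x\<bar> / 2) ^ 2 \<le> (\<bar>x\<bar> / 2) ^ (n + 1)" using x2 n by (intro power_increasing) auto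
    also have "\<dots> \<le> norm (saddle_fun l (Complex x y)) ^ (n + 1)"
      using X(2)[OF y' x] by (intro power_mono) auto
    finally have le: "x\<^sup>2 / 4 \<le> norm (saddle_fun l (Complex x y)) ^ (n + 1)"
      by (simp add: power_divide)
    have "x \<noteq> 0" using x2 by auto
    hence "norm (h (Complex x y)) = 1 / norm (saddle_fun l (Complex x y)) ^ (n + 1)"
      using y' by (subst h_eq) (auto intro!: inU simp: norm_divide norm_power norm_mult complex_eq_iff)
    also have "\<dots> \<le> 1 / (x\<^sup>2 / 4)"
      using le \<open>x \<noteq> 0\<close> by (intro divide_left_mono mult_pos_pos) (auto intro: less_le_trans[of 0 "x\<^sup>2 / 4"])
    finally show ?thesis by simp
  qed
  have inU0: "Complex x pi \<in> U - {0}" "Complex x (- pi) \<in> U - {0}" for x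
    by (auto intro!: inU simp: complex_eq_iff)
  have i1: "integrable lborel (\<lambda>x. h (Complex x (- pi)))"
    by (rule integrable_of_square_decay[OF continuous_on_horizontal[OF holo inU0(2)] bound]) auto
  have i2: "integrable lborel (\<lambda>x. h (Complex x pi))"
    by (rule integrable_of_square_decay[OF continuous_on_horizontal[OF holo inU0(1)] bound]) auto
  have main: "(LINT x|lborel. h (Complex x (- pi))) - (LINT x|lborel. h (Complex x pi)) =
      2 * pi * \<i> * residue h 0"
  proof (rule strip_residue[OF _ oU _ holo _ _ bound _ _ i1 i2])
    show "((\<lambda>x::real. 4 / x\<^sup>2) \<longlongrightarrow> 0) at_top" "((\<lambda>x::real. 4 / x\<^sup>2) \<longlongrightarrow> 0) at_bot"
      by real_asymp+
  qed (auto intro!: inU)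
  have hg: "h (Complex x pi) = g x" for x
    unfolding g_def by (rule h_eq) (use inU0(1)[of x] in auto)
  have hc: "h (Complex x (- pi)) = cnj (g x)" for x
  proof -
    have "saddle_fun l (Complex x (- pi)) = cnj (saddle_fun l (Complex x pi))"
      by (simp add: saddle_fun_def exp_cnj complex_cnj)
    thus ?thesis unfolding g_def using inU0(2)[of x] by (subst h_eq) auto
  qed
  show ig: "integrable lborel g" using i2 unfolding hg .
  define I where "I = (LINT x|lborel. g x)"
  have "cnj I - I = 2 * pi * \<i> * (of_real D / (fact n * of_real (l + 1) ^ (n + 1)))"
    using main unfolding hg hc res I_def Bochner_Integration.integral_cnj .
  moreover have "complex_of_real D / (fact n * of_real (l + 1) ^ (n + 1)) = of_real (D / (fact n * (l + 1) ^ (n + 1)))"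
    by simp
  moreover define Q where "Q = D / (fact n * (l + 1) ^ (n + 1))"
  ultimately have "cnj I - I = 2 * pi * \<i> * of_real Q" by (simp only:)
  from arg_cong[OF this, of Im]
  have "- Im I = pi * Q" by simp
  hence "Q = - Im I / pi" by (simp add: field_simps)
  moreover have "D = Q * (fact n * (l + 1) ^ (n + 1))"
    unfolding Q_def using l by (intro nonzero_divide_eq_eq[THEN iffD1]) auto
  ultimately have "D = - (Im I * (fact n * (l + 1) ^ (n + 1)) / pi)" by simp
  moreover have "b_neg n l = (l + 1) ^ n * D" by (simp add: b_neg_def D_def \<phi>_def)
  ultimately show "b_neg n l = - ((l + 1) ^ (2 * n + 1) * fact n / pi) * Im (LINT x|lborel. g x)"
  proof -
    have "(l + 1) ^ (2 * n + 1) = (l + 1) ^ n * (l + 1) ^ (n + 1)"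
      unfolding power_add[symmetric] by (rule arg_cong[of _ _ "(^) (l + 1)"]) simp
    thus ?thesis
      unfolding \<open>b_neg n l = (l + 1) ^ n * D\<close> \<open>D = - (Im I * (fact n * (l + 1) ^ (n + 1)) / pi)\<close> I_def[symmetric]
      by (simp add: mult_ac del: power_Suc)
  qed
qed

section \<open>From the line integral to a ray integral\<close>

text \<open>In the variable \<open>w = ln s\<close>; the measure \<open>ds = e^w dw\<close> is included.\<close>

definition ray_integrand :: "nat \<Rightarrow> real \<Rightarrow> complex \<Rightarrow> complex" where
  "ray_integrand n l w = exp ((of_nat n + 1 / 2) * w) * Gamma_star (exp w) * exp (- (exp w * cnj (Lambda l)))"

text \<open>On Im y = pi, e^y = -e^x, and the integral over x is a Gamma integral with c = l s,
  equal to Gamma s (l s)^(-s) up to elementary factors. On passing to \<open>Gamma_star\<close> s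
  the powers s^s cancel, and l^(-s) forms e^(-s cnj (Lambda l)) together with the remaining
  exponentials.\<close>

lemma inner_line_integral:
  assumes l: "l > 0" and \<alpha>: "\<bar>\<alpha>\<bar> < pi / 2"
  shows "(LINT x|lborel. exp (of_nat (n + 1) * Complex v \<alpha>) * exp (exp (Complex v \<alpha>) * saddle_fun l (Complex x pi))) =
           of_real (sqrt (2 * pi)) * ray_integrand n l (Complex v \<alpha>)"
proof -
  define w where "w = Complex v \<alpha>"
  define s where "s = exp w"
  have s0: "s \<noteq> 0" by (simp add: s_def)
  have "cos \<alpha> > 0" using \<alpha> by (intro cos_gt_zero_pi) auto
  hence Re_s: "Re s > 0" by (simp add: s_def w_def Re_exp)
  have Re_c: "Re (of_real l * s) > 0" using Re_s l by simp
  have Ln_s: "Ln s = w"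
    unfolding s_def by (rule Ln_exp) (use \<alpha> pi_gt_zero in \<open>auto simp: w_def abs_less_iff\<close>)
  have Ln_ls: "Ln (of_real l * s) = of_real (ln l) + w"
    using Ln_times_of_real[OF l s0] l by (simp add: Ln_s Ln_of_real)
  have sf: "exp (s * saddle_fun l (Complex x pi)) =
      exp (s * (\<i> * pi - of_real l)) * exp (s * of_real x - of_real l * s * of_real (exp x))" for x
  proof -
    have e1: "exp (Complex x pi) = - of_real (exp x)" by (rule complex_eqI) (simp_all add: Re_exp Im_exp)
    have e2: "Complex x pi = of_real x + \<i> * of_real pi" by (rule Complex_eq)
    show ?thesis
      unfolding saddle_fun_def e1 unfolding e2 exp_add[symmetric] by (rule arg_cong[of _ _ exp]) (simp add: algebra_simps)
  qed
  have "(LINT x|lborel. exp (of_nat (n + 1) * w) * exp (s * saddle_fun l (Complex x pi))) =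
      (LINT x|lborel. exp (of_nat (n + 1) * w) * exp (s * (\<i> * pi - of_real l)) * exp (s * of_real x - of_real l * s * of_real (exp x)))"
    unfolding sf by (simp only: mult.assoc)
  also have "\<dots> = exp (of_nat (n + 1) * w) * exp (s * (\<i> * pi - of_real l)) * (Gamma s * (of_real l * s) powr (- s))"
    unfolding Bochner_Integration.integral_mult_right_zero Gamma_integral_exp(2)[OF Re_s Re_c] ..
  also have "(of_real l * s) powr (- s) = exp (- s * (of_real (ln l) + w))"
    using l s0 by (simp add: powr_def Ln_ls)
  also have "Gamma s = Gamma_star s * (of_real (sqrt (2 * pi)) * exp ((s - 1 / 2) * w) * exp (- s))"
    using s0 by (simp add: Gamma_star_def powr_def Ln_s)
  also have "exp (of_nat (n + 1) * w) * exp (s * (\<i> * pi - of_real l)) *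
      (Gamma_star s * (of_real (sqrt (2 * pi)) * exp ((s - 1 / 2) * w) * exp (- s)) * exp (- s * (of_real (ln l) + w))) =
      of_real (sqrt (2 * pi)) * (Gamma_star s * (exp (of_nat (n + 1) * w) * exp (s * (\<i> * pi - of_real l)) *
        exp ((s - 1 / 2) * w) * exp (- s) * exp (- s * (of_real (ln l) + w))))"
    by (simp only: mult_ac)
  also have "exp (of_nat (n + 1) * w) * exp (s * (\<i> * pi - of_real l)) *
        exp ((s - 1 / 2) * w) * exp (- s) * exp (- s * (of_real (ln l) + w)) =
      exp ((of_nat n + 1 / 2) * w) * exp (- (s * cnj (Lambda l)))"
    unfolding exp_add[symmetric] by (rule arg_cong[of _ _ exp]) (simp add: Lambda_def algebra_simps)
  finally show ?thesis by (simp add: ray_integrand_def s_def w_def mult_ac)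
qed

text \<open>The decay rate in |s| of the Laplace integrand along the ray of angle omega / 2, at the
  point x + pi i of the line.\<close>

definition damping :: "real \<Rightarrow> real \<Rightarrow> real" where
  "damping l x = - Re (cis (omega l / 2) * saddle_fun l (Complex x pi))"

text \<open>1 + t <= e^t at t = x + ln l bounds the rate below by |Lambda l| cos (omega / 2) > 0,
  with equality at the critical point x = -ln l. Its linear growth far out makes the double integral
  converge absolutely.\<close>

lemma saddle_damping:
  assumes l: "l > 0"
  shows "\<exists>X>0. \<exists>c>0. \<forall>x. damping l x > 0 \<and> (X \<le> \<bar>x\<bar> \<longrightarrow> damping l x \<ge> c * \<bar>x\<bar>)"
proof -
  define \<alpha> where "\<alpha> = omega l / 2"
  define D where "D = damping l"
  have \<alpha>: "0 < \<alpha>" "\<alpha> < pi / 2" using omega_range[of l] by (auto simp: \<alpha>_def)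
  have ca: "cos \<alpha> > 0" using \<alpha> by (intro cos_gt_zero_pi) auto
  have sa: "sin \<alpha> > 0" using \<alpha> by (intro sin_gt_zero) auto
  have D: "D x = cos \<alpha> * (l * exp x - x + l) + pi * sin \<alpha>" for x
    by (simp add: D_def damping_def \<alpha>_def[symmetric] saddle_fun_def Re_exp Im_exp algebra_simps)
  have "Re (cis (- \<alpha>) * Lambda l) = norm (Lambda l) * cos (omega l - \<alpha>)"
  proof -
    have "cis (- \<alpha>) * Lambda l = of_real (norm (Lambda l)) * cis (omega l - \<alpha>)"
      by (subst Lambda_polar) (simp add: cis_mult mult_ac)
    thus ?thesis by simp
  qed
  also have "omega l - \<alpha> = \<alpha>" by (simp add: \<alpha>_def)
  finally have L: "cos \<alpha> * (l + ln l + 1) + pi * sin \<alpha> = norm (Lambda l) * cos \<alpha>"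
    by (simp add: Lambda_def algebra_simps)
  have pos: "D x > 0" for x
  proof -
    have "1 + (x + ln l) \<le> exp (x + ln l)" by (rule exp_ge_add_one_self)
    also have "\<dots> = l * exp x" using l by (simp add: exp_add)
    finally have "cos \<alpha> * (l + ln l + 1) \<le> cos \<alpha> * (l * exp x - x + l)"
      using ca by (intro mult_left_mono) auto
    moreover have "norm (Lambda l) * cos \<alpha> > 0" using ca norm_Lambda_pos by (intro mult_pos_pos)
    ultimately show ?thesis unfolding D using L by linarith
  qed
  obtain X where X: "X \<ge> 4 * l" "X \<ge> 2" "\<And>x. x \<ge> X \<Longrightarrow> x / 2 \<le> l * exp x - x - pi - l"
    using exp_linear_dominates[OF l] by blast
  have "D x \<ge> cos \<alpha> / 2 * \<bar>x\<bar>" if x: "X \<le> \<bar>x\<bar>" for x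
  proof -
    have "\<bar>x\<bar> / 2 \<le> l * exp x - x + l"
    proof (cases "x \<ge> 0")
      case True
      thus ?thesis using X(3)[of x] x l pi_gt_zero by linarith
    next
      case False
      have "l * exp x > 0" using l by simp
      thus ?thesis using False l by linarith
    qed
    hence "cos \<alpha> * (\<bar>x\<bar> / 2) \<le> cos \<alpha> * (l * exp x - x + l)" using ca by (intro mult_left_mono) auto
    moreover have "pi * sin \<alpha> \<ge> 0" using sa by simp
    ultimately show ?thesis unfolding D by simp
  qed
  moreover have "X > 0" "cos \<alpha> / 2 > 0" using X(2) ca by auto
  ultimately show ?thesis using pos unfolding D_def by blast
qed

lemma fact_over_power_integral:
  fixes c :: complex
  assumes "Re c > 0"
  shows "integrable lborel (\<lambda>v. exp (of_nat (n + 1) * of_real v - c * of_real (exp v)))"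
    and "(LINT v|lborel. exp (of_nat (n + 1) * of_real v - c * of_real (exp v))) = fact n / c ^ (n + 1)"
proof -
  have s: "Re (of_nat (n + 1) :: complex) > 0" by simp
  note * = Gamma_integral_exp[OF s assms]
  show "integrable lborel (\<lambda>v. exp (of_nat (n + 1) * of_real v - c * of_real (exp v)))" by (rule *(1))
  have "c \<noteq> 0" using assms by auto
  hence "c powr of_nat (n + 1) = c ^ (n + 1)" by (intro powr_nat') auto
  hence "c powr (- of_nat (n + 1)) = inverse (c ^ (n + 1))" unfolding powr_minus by (rule arg_cong)
  moreover have "Gamma (of_nat (n + 1) :: complex) = fact n" by (simp add: Gamma_fact)
  ultimately show "(LINT v|lborel. exp (of_nat (n + 1) * of_real v - c * of_real (exp v))) = fact n / c ^ (n + 1)"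
    unfolding *(2) by (simp only: divide_inverse)
qed

text \<open>Integrating the modulus over |s| leaves n! / rate^(n + 1), which is at most of order 1 /
  x^2 because n >= 1; this justifies Fubini. The sign (-1)^(n + 1) comes from k = -e^(i alpha) f,
  whose real part is the positive rate.\<close>

lemma line_integral_eq_ray_integral:
  assumes l: "l > 0" and n: "n \<ge> 1"
  shows "fact n * (-1) ^ (n + 1) * (LINT x|lborel. 1 / saddle_fun l (Complex x pi) ^ (n + 1)) =
           of_real (sqrt (2 * pi)) * (LINT v|lborel. ray_integrand n l (Complex v (omega l / 2)))"
proof -
  define \<alpha> where "\<alpha> = omega l / 2"
  have \<alpha>: "\<bar>\<alpha>\<bar> < pi / 2" using omega_range[of l] by (simp add: \<alpha>_def)
  define D where "D = damping l"
  obtain X c where D: "c > 0" "X > 0" "\<And>x. D x > 0" "\<And>x. X \<le> \<bar>x\<bar> \<Longrightarrow> D x \<ge> c * \<bar>x\<bar>"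
    using saddle_damping[OF l] unfolding D_def by blast
  \<comment> \<open>The exponent n + 1 in place of n contains the measure ds = s dv.\<close>
  define f where "f = (\<lambda>x v. exp (of_nat (n + 1) * Complex v \<alpha>) * exp (exp (Complex v \<alpha>) * saddle_fun l (Complex x pi)))"
  define k where "k = (\<lambda>x. - (cis \<alpha> * saddle_fun l (Complex x pi)))"
  have Rek: "Re (k x) = D x" for x by (simp add: k_def D_def damping_def \<alpha>_def)
  have f_eq: "f x v = exp (of_nat (n + 1) * (\<i> * of_real \<alpha>)) * exp (of_nat (n + 1) * of_real v - k x * of_real (exp v))" for x v
  proof -
    have e1: "exp (Complex v \<alpha>) = of_real (exp v) * cis \<alpha>" by (rule exp_Complex_eq)
    have e2: "Complex v \<alpha> = of_real v + \<i> * of_real \<alpha>" by (rule Complex_eq)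
    show ?thesis
      unfolding f_def e1 k_def exp_add[symmetric] unfolding e2
      by (rule arg_cong[of _ _ exp]) (simp add: algebra_simps)
  qed
  have nf: "norm (f x v) = exp (real (n + 1) * v - D x * exp v)" for x v
    unfolding f_eq norm_mult norm_exp_eq_Re by (simp add: Rek)
  have int_v: "integrable lborel (f x)" for x
    unfolding f_eq[abs_def] by (rule integrable_mult_right) (rule fact_over_power_integral(1), simp add: Rek D(3))
  have norm_int: "(LINT v|lborel. norm (f x v)) = fact n / D x ^ (n + 1)" for x
  proof -
    have "(LINT v|lborel. norm (f x v)) = Gamma (real (n + 1)) / D x powr real (n + 1)"
      unfolding nf by (rule Gamma_integral_exp_real) (use D(3) in auto)
    also have "Gamma (real (n + 1)) = fact n" using Gamma_fact[of n, where 'a = real] by (simp add: add.commute)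
    also have "D x powr real (n + 1) = D x ^ (n + 1)" by (rule powr_realpow[OF D(3)])
    finally show ?thesis .
  qed
  have contD: "continuous_on UNIV D"
    unfolding D_def damping_def[abs_def] saddle_fun_def Complex_eq by (intro continuous_intros)
  have int_x: "integrable lborel (\<lambda>x. LINT v|lborel. norm (f x v))"
  proof -
    have "integrable lborel (\<lambda>x. complex_of_real (fact n / D x ^ (n + 1)))"
    proof (rule integrable_of_square_decay[where X = "max X (1 / c)" and B = "fact n / c ^ 2"])
      have "D x ^ (n + 1) \<noteq> 0" for x using D(3)[of x] by simp
      thus "continuous_on UNIV (\<lambda>x. complex_of_real (fact n / D x ^ (n + 1)))"
        by (intro continuous_intros contD) auto
      fix x assume x: "max X (1 / c) \<le> \<bar>x\<bar>"
      have cx: "c * \<bar>x\<bar> \<ge> 1" using x D(1) by (simp add: field_simps)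
      have x0: "x \<noteq> 0" using cx by auto
      have "(c * \<bar>x\<bar>) ^ 2 \<le> (c * \<bar>x\<bar>) ^ (n + 1)" using cx n by (intro power_increasing) auto
      also have "\<dots> \<le> D x ^ (n + 1)" using D(4)[of x] x cx by (intro power_mono) auto
      finally have "(c * \<bar>x\<bar>) ^ 2 \<le> D x ^ (n + 1)" .
      moreover have "(c * \<bar>x\<bar>) ^ 2 > 0" using x0 D(1) by simp
      ultimately have "fact n / D x ^ (n + 1) \<le> fact n / (c * \<bar>x\<bar>) ^ 2"
        by (intro divide_left_mono mult_pos_pos zero_less_power[OF D(3)]) auto
      also have "\<dots> = fact n / c ^ 2 / x ^ 2" by (simp add: power_mult_distrib)
      finally show "norm (complex_of_real (fact n / D x ^ (n + 1))) \<le> fact n / c ^ 2 / x\<^sup>2"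
        using D(3)[of x] by (simp only: norm_of_real) simp
    qed
    thus ?thesis unfolding norm_int by (subst (asm) integrable_complex_iff) simp
  qed
  have "continuous_on UNIV (\<lambda>p. f (fst p) (snd p))"
    unfolding f_def saddle_fun_def Complex_eq by (intro continuous_intros)
  hence meas: "case_prod f \<in> borel_measurable (lborel \<Otimes>\<^sub>M lborel)"
    unfolding lborel_prod case_prod_beta' using borel_measurable_continuous_onI by simp
  have "integrable (lborel \<Otimes>\<^sub>M lborel) (case_prod f)"
    by (rule lborel_pair.Fubini_integrable[OF meas]) (use int_x int_v in auto)
  from lborel_pair.Fubini_integral[OF this]
  have swap: "(LINT v|lborel. LINT x|lborel. f x v) = (LINT x|lborel. LINT v|lborel. f x v)" .
  have "(LINT v|lborel. f x v) = fact n * (-1) ^ (n + 1) * (1 / saddle_fun l (Complex x pi) ^ (n + 1))" for x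
  proof -
    have "(LINT v|lborel. f x v) = exp (of_nat (n + 1) * (\<i> * of_real \<alpha>)) * (fact n / k x ^ (n + 1))"
      unfolding f_eq Bochner_Integration.integral_mult_right_zero
      by (subst fact_over_power_integral(2)) (simp_all add: Rek D(3))
    also have "exp (of_nat (n + 1) * (\<i> * of_real \<alpha>)) = cis \<alpha> ^ (n + 1)"
      unfolding cis_conv_exp by (rule exp_of_nat_mult)
    also have "k x ^ (n + 1) = (-1) ^ (n + 1) * (cis \<alpha> ^ (n + 1) * saddle_fun l (Complex x pi) ^ (n + 1))"
      unfolding k_def power_mult_distrib[symmetric] by (simp only: mult_minus_left mult_1)
    also have "cis \<alpha> ^ (n + 1) * (fact n / ((-1) ^ (n + 1) * (cis \<alpha> ^ (n + 1) * saddle_fun l (Complex x pi) ^ (n + 1)))) =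
        fact n / (-1) ^ (n + 1) * (1 / saddle_fun l (Complex x pi) ^ (n + 1))"
    proof -
      have canc: "a * (b / (c * (a * d))) = b / c * (1 / d)" if "a \<noteq> 0" for a b c d :: complex
        using that by simp
      have "cis \<alpha> ^ (n + 1) \<noteq> 0" by (rule power_not_zero) (rule cis_neq_zero)
      from this(1) show ?thesis by (rule canc)
    qed
    also have "fact n / (-1) ^ (n + 1) = fact n * (-1 :: complex) ^ (n + 1)"
      by (cases "even n") auto
    finally show ?thesis .
  qed
  hence "(LINT x|lborel. LINT v|lborel. f x v) =
      fact n * (-1) ^ (n + 1) * (LINT x|lborel. 1 / saddle_fun l (Complex x pi) ^ (n + 1))"
    by (simp only: Bochner_Integration.integral_mult_right_zero)
  moreover have "(LINT v|lborel. LINT x|lborel. f x v) =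
      of_real (sqrt (2 * pi)) * (LINT v|lborel. ray_integrand n l (Complex v \<alpha>))"
    unfolding f_def inner_line_integral[OF l \<alpha>] by (simp only: Bochner_Integration.integral_mult_right_zero)
  ultimately show ?thesis using swap by (simp only: \<alpha>_def)
qed

text \<open>Angles between omega / 2 and omega deviate from arg (Lambda l) = omega by at most omega
  / 2, so e^(-s cnj (Lambda l)) decays throughout at least at the rate |Lambda l| cos (omega / 2).
  At the final angle the exponent is real.\<close>

lemma ray_integral_rotate:
  assumes n: "n \<ge> 1"
  shows "integrable lborel (\<lambda>v. ray_integrand n l (Complex v (omega l)))"
    and "(LINT v|lborel. ray_integrand n l (Complex v (omega l / 2))) =
           (LINT v|lborel. ray_integrand n l (Complex v (omega l)))"
proof -
  define \<omega> where "\<omega> = omega l"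
  have \<omega>: "0 < \<omega>" "\<omega> < pi" using omega_range by (auto simp: \<omega>_def)
  \<comment> \<open>The least rotation for which the sector bound of \<open>Gamma_star\<close>
    reaches the angle omega.\<close>
  define \<phi> where "\<phi> = max 0 (\<omega> - pi / 2)"
  have \<phi>: "0 \<le> \<phi>" "\<phi> < pi / 2" "\<omega> \<le> pi / 2 + \<phi>" using \<omega> by (auto simp: \<phi>_def max_def)
  obtain C where C: "C \<ge> 1"
    "\<And>x y. - pi / 2 \<le> y \<Longrightarrow> y \<le> pi / 2 + \<phi> \<Longrightarrow> norm (Gamma_star (exp (Complex x y))) \<le> C * (1 + exp (- x / 2))"
    using Gamma_star_sector_bound[OF \<phi>(1,2)] by blast
  define \<kappa> where "\<kappa> = norm (Lambda l) * cos (\<omega> / 2)"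
  have "cos (\<omega> / 2) > 0" using \<omega> by (intro cos_gt_zero_pi) auto
  hence \<kappa>: "\<kappa> > 0" unfolding \<kappa>_def using norm_Lambda_pos by (intro mult_pos_pos)
  define U where "U = {w. \<bar>Im w\<bar> < pi}"
  \<comment> \<open>3/2 is 1/2 plus the additional 1 that yields the factor e^(-x) in the
    majorant.\<close>
  have "((\<lambda>x. exp ((real n + 3 / 2) * x - \<kappa> * exp x)) \<longlongrightarrow> 0) at_top"
    by (rule exp_gamma_kernel_limits) (use \<kappa> in auto)
  hence "eventually (\<lambda>x. exp ((real n + 3 / 2) * x - \<kappa> * exp x) < 1) at_top"
    by (rule order_tendstoD) simp
  then obtain X where X: "\<And>x. x \<ge> X \<Longrightarrow> exp ((real n + 3 / 2) * x - \<kappa> * exp x) < 1"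
    by (auto simp: eventually_at_top_linorder)
  have nb: "norm (ray_integrand n l (Complex x y)) \<le> C * (1 + exp (- x / 2)) * exp ((real n + 1 / 2) * x - \<kappa> * exp x)"
    if y: "\<omega> / 2 \<le> y" "y \<le> \<omega>" for x y
  proof -
    have "cos (\<omega> / 2) \<le> cos (\<omega> - y)" using y \<omega> by (intro cos_monotone_0_pi_le) auto
    hence "\<kappa> * exp x \<le> norm (Lambda l) * cos (\<omega> - y) * exp x"
      unfolding \<kappa>_def using norm_Lambda_pos[of l] by (intro mult_right_mono mult_left_mono) auto
    moreover have "Re (exp (Complex x y) * cnj (Lambda l)) = norm (Lambda l) * cos (\<omega> - y) * exp x"
    proof -
      have "exp (Complex x y) * cnj (Lambda l) = of_real (exp x * norm (Lambda l)) * cis (y - \<omega>)"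
        unfolding exp_Complex_eq by (subst Lambda_polar) (simp add: cis_cnj cis_mult mult_ac \<omega>_def)
      thus ?thesis by (simp add: cos_diff mult_ac)
    qed
    ultimately have "norm (exp (- (exp (Complex x y) * cnj (Lambda l)))) \<le> exp (- (\<kappa> * exp x))"
      unfolding norm_exp_eq_Re by simp
    moreover have "norm (Gamma_star (exp (Complex x y))) \<le> C * (1 + exp (- x / 2))"
      using y \<omega> \<phi> by (intro C(2)) auto
    moreover have "norm (exp ((of_nat n + 1 / 2) * Complex x y)) = exp ((real n + 1 / 2) * x)"
      by (simp add: norm_exp_eq_Re)
    ultimately have "norm (ray_integrand n l (Complex x y)) \<le>
        exp ((real n + 1 / 2) * x) * (C * (1 + exp (- x / 2))) * exp (- (\<kappa> * exp x))"
      unfolding ray_integrand_def norm_mult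
      by (intro mult_mono mult_nonneg_nonneg add_nonneg_nonneg) (use C(1) in auto)
    also have "\<dots> = C * (1 + exp (- x / 2)) * exp ((real n + 1 / 2) * x - \<kappa> * exp x)"
      unfolding diff_conv_add_uminus exp_add by (simp only: mult_ac)
    finally show ?thesis .
  qed
  have bound: "norm (ray_integrand n l (Complex x y)) \<le> 2 * C * exp (- 1 * \<bar>x\<bar>)"
    if y: "\<omega> / 2 \<le> y" "y \<le> \<omega>" and x: "\<bar>X\<bar> \<le> \<bar>x\<bar>" for x y
  proof (cases "x \<ge> 0")
    case True
    have "(1 + exp (- x / 2)) \<le> 2" using True by simp
    hence "C * (1 + exp (- x / 2)) * exp ((real n + 1 / 2) * x - \<kappa> * exp x) \<le> C * 2 * exp ((real n + 1 / 2) * x - \<kappa> * exp x)"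
      using C(1) by (intro mult_right_mono mult_left_mono) auto
    also have "exp ((real n + 1 / 2) * x - \<kappa> * exp x) \<le> exp (- x) * 1"
    proof -
      have "exp ((real n + 1 / 2) * x - \<kappa> * exp x) = exp (- x) * exp ((real n + 3 / 2) * x - \<kappa> * exp x)"
        unfolding exp_add[symmetric] by (rule arg_cong[of _ _ exp]) (simp add: algebra_simps)
      also have "\<dots> \<le> exp (- x) * 1"
      proof (intro mult_left_mono)
        have "X \<le> x" using x True by linarith
        thus "exp ((real n + 3 / 2) * x - \<kappa> * exp x) \<le> 1" using X[of x] by linarith
      qed auto
      finally show ?thesis .
    qed
    finally have "C * (1 + exp (- x / 2)) * exp ((real n + 1 / 2) * x - \<kappa> * exp x) \<le> C * 2 * (exp (- x) * 1)"
      using C(1) by (simp add: mult_left_mono)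
    from order_trans[OF nb[OF y] this] show ?thesis using True by (simp add: mult_ac)
  next
    case False
    have "1 \<le> exp (- x / 2)" using False by simp
    hence "1 + exp (- x / 2) \<le> 2 * exp (- x / 2)" by linarith
    moreover have "\<kappa> * exp x > 0" using \<kappa> by simp
    hence "exp ((real n + 1 / 2) * x - \<kappa> * exp x) \<le> exp ((real n + 1 / 2) * x)" by simp
    ultimately have "C * (1 + exp (- x / 2)) * exp ((real n + 1 / 2) * x - \<kappa> * exp x) \<le>
        C * (2 * exp (- x / 2)) * exp ((real n + 1 / 2) * x)"
      using C(1) by (intro mult_mono) auto
    also have "\<dots> = 2 * C * (exp (- x / 2) * exp ((real n + 1 / 2) * x))" by simp
    also have "exp (- x / 2) * exp ((real n + 1 / 2) * x) = exp (real n * x)"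
      unfolding exp_add[symmetric] by (rule arg_cong[of _ _ exp]) (simp add: algebra_simps)
    finally have le: "C * (1 + exp (- x / 2)) * exp ((real n + 1 / 2) * x - \<kappa> * exp x) \<le> 2 * C * exp (real n * x)" .
    have "exp (real n * x) \<le> exp (1 * x)"
      unfolding exp_le_cancel_iff using n False by (intro mult_right_mono_neg) auto
    hence "2 * C * exp (real n * x) \<le> 2 * C * exp (1 * x)" using C(1) by (intro mult_left_mono) auto
    from order_trans[OF order_trans[OF nb[OF y] le] this] show ?thesis using False by simp
  qed
  have holo: "ray_integrand n l holomorphic_on U"
    unfolding ray_integrand_def[abs_def] U_def by (intro holomorphic_intros exp_strip_holomorphic)
  have oU: "open U" unfolding U_def by (rule open_Im_strip)
  have U2: "z \<in> U" if "\<omega> / 2 \<le> Im z" "Im z \<le> \<omega>" for z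
    using that \<omega> by (simp add: U_def)
  have ab: "\<omega> / 2 \<le> \<omega>" using \<omega> by simp
  note * = strip_shift_exp[OF ab oU U2 holo zero_less_one bound]
  show "integrable lborel (\<lambda>v. ray_integrand n l (Complex v (omega l)))"
    unfolding \<omega>_def[symmetric] by (rule *(2))
  show "(LINT v|lborel. ray_integrand n l (Complex v (omega l / 2))) =
           (LINT v|lborel. ray_integrand n l (Complex v (omega l)))"
    unfolding \<omega>_def[symmetric] by (rule *(3))
qed

theorem b_neg_eq_ray_integral:
  assumes l: "l > 0" and n: "n \<ge> 1"
  shows "b_neg n l = (-1) ^ n * (l + 1) ^ (2 * n + 1) * sqrt (2 * pi) / pi *
           Im (LINT v|lborel. ray_integrand n l (Complex v (omega l)))"
proof -
  define I where "I = (LINT x|lborel. 1 / saddle_fun l (Complex x pi) ^ (n + 1))"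
  define J where "J = (LINT v|lborel. ray_integrand n l (Complex v (omega l)))"
  have "fact n * (-1) ^ (n + 1) * I = of_real (sqrt (2 * pi)) * J"
    using line_integral_eq_ray_integral[OF l n] ray_integral_rotate(2)[OF n, of l]
    by (simp add: I_def J_def)
  moreover have "fact n * (-1) ^ (n + 1) * I = of_real (fact n * (-1) ^ (n + 1)) * I" by simp
  ultimately have "of_real (fact n * (-1) ^ (n + 1)) * I = of_real (sqrt (2 * pi)) * J" by (simp only:)
  from arg_cong[OF this, of Im]
  have "fact n * (-1) ^ (n + 1) * Im I = sqrt (2 * pi) * Im J"
    by (simp only: Im_complex_of_real Re_complex_of_real times_complex.sel mult_zero_left add_0_right)
  hence "(-1) ^ (n + 1) * ((-1) ^ (n + 1) * (fact n * Im I)) = (-1) ^ (n + 1) * (sqrt (2 * pi) * Im J)"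
    by (simp add: mult_ac)
  hence "fact n * Im I = - ((-1) ^ n * sqrt (2 * pi) * Im J)"
    by (simp flip: mult.assoc power_mult_distrib)
  moreover have "b_neg n l = - ((l + 1) ^ (2 * n + 1) / pi) * (fact n * Im I)"
    using b_neg_eq_line_integral(2)[OF l n] by (simp add: I_def)
  ultimately show ?thesis by (simp add: J_def)
qed

section \<open>The remainder integral\<close>

text \<open>After t = e^x this is one of the two terms of the stated integrand, with the measure
  included; the other is its complex conjugate.\<close>

definition remainder_integrand :: "nat \<Rightarrow> nat \<Rightarrow> real \<Rightarrow> real \<Rightarrow> complex" where
  "remainder_integrand K n l x =
     exp ((of_nat n + 1 / 2) * Complex x (omega l)) * of_real (exp (- (exp x * cmod (Lambda l)))) *
       stirling_remainder K (exp (Complex x (omega l)))"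

lemma ray_integrand_omega:
  "ray_integrand n l (Complex x (omega l)) =
     exp ((of_nat n + 1 / 2) * Complex x (omega l)) * of_real (exp (- (exp x * cmod (Lambda l)))) *
       Gamma_star (exp (Complex x (omega l)))"
proof -
  have "exp (Complex x (omega l)) * cnj (Lambda l) = of_real (exp x * cmod (Lambda l))"
  proof -
    have "exp (Complex x (omega l)) * cnj (Lambda l) = of_real (exp x * cmod (Lambda l)) * cis (omega l - omega l)"
      unfolding exp_Complex_eq by (subst Lambda_polar) (simp add: cis_cnj cis_mult mult_ac)
    thus ?thesis by simp
  qed
  thus ?thesis
    unfolding ray_integrand_def by (simp only: of_real_minus[symmetric] exp_of_real mult_ac)
qed

text \<open>The contribution of the k-th Stirling term to the ray integral at angle omega, without
  its coefficient. It is a fixed phase times a positive function, and the imaginary part of the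
  phase is the sine in the finite sum.\<close>

definition moment_term :: "nat \<Rightarrow> real \<Rightarrow> nat \<Rightarrow> real \<Rightarrow> complex" where
  "moment_term n l k x = cis ((real n - real k + 1 / 2) * omega l) *
     of_real (exp ((real n - real k + 1 / 2) * x - cmod (Lambda l) * exp x))"

lemma moment_term_integral:
  assumes "k < n"
  shows "integrable lborel (moment_term n l k)"
    and "(LINT x|lborel. moment_term n l k x) = cis ((real n - real k + 1 / 2) * omega l) *
           of_real (Gamma (real n - real k + 1 / 2) / cmod (Lambda l) powr (real n - real k + 1 / 2))"
proof -
  have a: "real n - real k + 1 / 2 > 0" using assms by simp
  show "integrable lborel (moment_term n l k)"
    unfolding moment_term_def[abs_def]
    by (intro integrable_mult_right integrable_of_real integrable_exp_gamma_kernel a norm_Lambda_pos)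
  show "(LINT x|lborel. moment_term n l k x) = cis ((real n - real k + 1 / 2) * omega l) *
           of_real (Gamma (real n - real k + 1 / 2) / cmod (Lambda l) powr (real n - real k + 1 / 2))"
    unfolding moment_term_def Bochner_Integration.integral_mult_right_zero integral_complex_of_real
      Gamma_integral_exp_real[OF a norm_Lambda_pos] ..
qed

lemma remainder_integrand_eq:
  "remainder_integrand K n l x = ray_integrand n l (Complex x (omega l)) -
     (\<Sum>k<K. of_real ((-1) ^ k * stirling_coeff k) * moment_term n l k x)"
proof -
  define w where "w = Complex x (omega l)"
  define d where "d = complex_of_real (exp (- (exp x * cmod (Lambda l))))"
  have tm: "exp ((of_nat n + 1 / 2) * w) * d * ((-1) ^ k * of_real (stirling_coeff k) / exp w ^ k) =
          of_real ((-1) ^ k * stirling_coeff k) * moment_term n l k x" for k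
  proof -
    have "exp ((of_nat n + 1 / 2) * w) / exp w ^ k = exp ((of_nat n + 1 / 2) * w - of_nat k * w)"
      by (simp add: exp_diff exp_of_nat_mult)
    also have "(of_nat n + 1 / 2) * w - of_nat k * w =
        of_real ((real n - real k + 1 / 2) * x) + \<i> * of_real ((real n - real k + 1 / 2) * omega l)"
      by (simp add: w_def complex_eq_iff algebra_simps)
    also have "exp \<dots> = of_real (exp ((real n - real k + 1 / 2) * x)) * cis ((real n - real k + 1 / 2) * omega l)"
      unfolding exp_add cis_conv_exp exp_of_real ..
    finally have e: "exp ((of_nat n + 1 / 2) * w) / exp w ^ k =
        of_real (exp ((real n - real k + 1 / 2) * x)) * cis ((real n - real k + 1 / 2) * omega l)" .
    have "moment_term n l k x = exp ((of_nat n + 1 / 2) * w) / exp w ^ k * d"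
      unfolding e moment_term_def d_def
      by (simp add: exp_diff exp_minus inverse_eq_divide mult_ac)
    thus ?thesis by (simp add: mult_ac)
  qed
  have "remainder_integrand K n l x = exp ((of_nat n + 1 / 2) * w) * d * Gamma_star (exp w) -
      (\<Sum>k<K. exp ((of_nat n + 1 / 2) * w) * d * ((-1) ^ k * of_real (stirling_coeff k) / exp w ^ k))"
    unfolding remainder_integrand_def stirling_remainder_def w_def[symmetric] d_def[symmetric]
    by (simp only: right_diff_distrib sum_distrib_left)
  thus ?thesis
    unfolding tm unfolding ray_integrand_omega unfolding w_def[symmetric] d_def[symmetric] .
qed

lemma integrable_remainder_integrand:
  assumes "n \<ge> 1" "K \<le> n"
  shows "integrable lborel (remainder_integrand K n l)"
  unfolding remainder_integrand_eq[abs_def]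
  by (intro Bochner_Integration.integrable_diff Bochner_Integration.integrable_sum integrable_mult_right
        moment_term_integral ray_integral_rotate assms) (use assms in auto)

text \<open>The equation for A is solved for A: its left-hand side is a ray integral, the finite sum
  consists of the imaginary parts of the subtracted moments, and the common prefactor is
  nonzero.\<close>

lemma b_neg_remainder:
  fixes l A :: real
  assumes l: "0 < l" and n: "n \<ge> 1" and K: "K \<le> n"
    and A: "b_neg n l =
      (-1) ^ n * Gamma (real n + 1 / 2) * (l + 1) ^ (2 * n + 1)
        / ((pi / 2 * cmod (Lambda l)) powr (1 / 2) * cmod (Lambda l) ^ n)
      * ((\<Sum>k<K. (-1) ^ k * cmod (Lambda l) ^ k * stirling_coeff k
             * (Gamma (real n - real k + 1 / 2) / Gamma (real n + 1 / 2))
             * sin ((real n - real k + 1 / 2) * omega l)) + A)"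
  shows "A = cmod (Lambda l) powr (real n + 1 / 2) / Gamma (real n + 1 / 2) *
               Im (LINT x|lborel. remainder_integrand K n l x)"
proof -
  define R where "R = cmod (Lambda l)"
  have R: "R > 0" unfolding R_def by (rule norm_Lambda_pos)
  define G where "G = Gamma (real n + 1 / 2)"
  have G: "G > 0" unfolding G_def by (intro Gamma_real_pos) simp
  define J where "J = Im (LINT v|lborel. ray_integrand n l (Complex v (omega l)))"
  define S where "S = (\<Sum>k<K. (-1) ^ k * R ^ k * stirling_coeff k * (Gamma (real n - real k + 1 / 2) / G)
                         * sin ((real n - real k + 1 / 2) * omega l))"
  have int: "(LINT x|lborel. remainder_integrand K n l x) =
      (LINT v|lborel. ray_integrand n l (Complex v (omega l))) -
        (\<Sum>k<K. of_real ((-1) ^ k * stirling_coeff k) * (LINT x|lborel. moment_term n l k x))"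
  proof -
    have i: "integrable lborel (\<lambda>x. of_real ((-1) ^ k * stirling_coeff k) * moment_term n l k x)" if "k \<in> {..<K}" for k
      using that K by (intro integrable_mult_right moment_term_integral(1)) auto
    have "(LINT x|lborel. remainder_integrand K n l x) =
      (LINT v|lborel. ray_integrand n l (Complex v (omega l))) -
        (LINT x|lborel. (\<Sum>k<K. of_real ((-1) ^ k * stirling_coeff k) * moment_term n l k x))"
      unfolding remainder_integrand_eq
      by (rule Bochner_Integration.integral_diff[OF ray_integral_rotate(1)[OF n] Bochner_Integration.integrable_sum[OF i]])
    also have "(LINT x|lborel. (\<Sum>k<K. of_real ((-1) ^ k * stirling_coeff k) * moment_term n l k x)) =
        (\<Sum>k<K. LINT x|lborel. of_real ((-1) ^ k * stirling_coeff k) * moment_term n l k x)"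
      by (rule Bochner_Integration.integral_sum[OF i])
    finally show ?thesis by (simp only: Bochner_Integration.integral_mult_right_zero)
  qed
  have Im: "Im (LINT x|lborel. remainder_integrand K n l x) =
      J - (\<Sum>k<K. (-1) ^ k * stirling_coeff k * (sin ((real n - real k + 1 / 2) * omega l) *
              (Gamma (real n - real k + 1 / 2) / R powr (real n - real k + 1 / 2))))"
  proof -
    have "Im (\<Sum>k<K. of_real ((-1) ^ k * stirling_coeff k) * (LINT x|lborel. moment_term n l k x)) =
      (\<Sum>k<K. (-1) ^ k * stirling_coeff k * (sin ((real n - real k + 1 / 2) * omega l) *
              (Gamma (real n - real k + 1 / 2) / R powr (real n - real k + 1 / 2))))"
      unfolding Im_sum
    proof (rule sum.cong)
      fix k assume "k \<in> {..<K}"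
      hence k: "k < n" using K by simp
      show "Im (of_real ((-1) ^ k * stirling_coeff k) * (LINT x|lborel. moment_term n l k x)) =
          (-1) ^ k * stirling_coeff k * (sin ((real n - real k + 1 / 2) * omega l) *
              (Gamma (real n - real k + 1 / 2) / R powr (real n - real k + 1 / 2)))"
        unfolding moment_term_integral(2)[OF k] R_def
        by (simp only: times_complex.sel Re_complex_of_real Im_complex_of_real cis.sel mult_zero_left
              mult_zero_right add_0_right add_0_left)
    qed simp
    thus ?thesis unfolding int J_def by simp
  qed
  have S: "R powr (real n + 1 / 2) / G * (\<Sum>k<K. (-1) ^ k * stirling_coeff k * (sin ((real n - real k + 1 / 2) * omega l) *
              (Gamma (real n - real k + 1 / 2) / R powr (real n - real k + 1 / 2)))) = S"
    unfolding S_def sum_distrib_left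
  proof (rule sum.cong)
    fix k assume "k \<in> {..<K}"
    have "R powr (real n + 1 / 2) / R powr (real n - real k + 1 / 2) = R powr (real k)"
      by (simp flip: powr_diff)
    hence e: "R powr (real n + 1 / 2) / R powr (real n - real k + 1 / 2) = R ^ k"
      using R by (simp add: powr_realpow)
    show "R powr (real n + 1 / 2) / G * ((-1) ^ k * stirling_coeff k * (sin ((real n - real k + 1 / 2) * omega l) *
              (Gamma (real n - real k + 1 / 2) / R powr (real n - real k + 1 / 2)))) =
        (-1) ^ k * R ^ k * stirling_coeff k * (Gamma (real n - real k + 1 / 2) / G) * sin ((real n - real k + 1 / 2) * omega l)"
      unfolding e[symmetric] by (simp add: mult_ac)
  qed simp
  define P where "P = (-1) ^ n * (l + 1) ^ (2 * n + 1) * sqrt (2 * pi) / pi"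
  have P: "P \<noteq> 0" using l by (simp add: P_def)
  have pref: "(-1) ^ n * Gamma (real n + 1 / 2) * (l + 1) ^ (2 * n + 1)
        / ((pi / 2 * cmod (Lambda l)) powr (1 / 2) * cmod (Lambda l) ^ n) = P * (G / R powr (real n + 1 / 2))"
  proof -
    \<comment> \<open>The ray integral carries sqrt (2 pi) / pi, the equation for A carries 1 / sqrt
      (pi / 2); the two numbers are equal.\<close>
    have sq: "sqrt (2 * pi) / pi * sqrt (pi / 2) = 1"
    proof -
      have "sqrt (2 * pi) * sqrt (pi / 2) = sqrt (pi * pi)"
        unfolding real_sqrt_mult[symmetric] by (simp add: field_simps)
      thus ?thesis by (simp add: field_simps)
    qed
    have "(pi / 2 * R) powr (1 / 2) = sqrt (pi / 2 * R)"
      using R by (intro powr_half_sqrt) simp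
    also have "\<dots> = sqrt (pi / 2) * sqrt R" by (rule real_sqrt_mult)
    finally have "(pi / 2 * R) powr (1 / 2) = sqrt (pi / 2) * sqrt R" .
    moreover have "R powr (real n + 1 / 2) = R ^ n * sqrt R"
      using R by (simp add: powr_add powr_realpow powr_half_sqrt)
    ultimately have "(pi / 2 * R) powr (1 / 2) * R ^ n = sqrt (pi / 2) * R powr (real n + 1 / 2)"
      by simp
    hence "(-1) ^ n * Gamma (real n + 1 / 2) * (l + 1) ^ (2 * n + 1)
        / ((pi / 2 * cmod (Lambda l)) powr (1 / 2) * cmod (Lambda l) ^ n) =
        (-1) ^ n * G * (l + 1) ^ (2 * n + 1) / (sqrt (pi / 2) * R powr (real n + 1 / 2))"
      by (simp only: R_def G_def)
    also have "\<dots> = (-1) ^ n * (l + 1) ^ (2 * n + 1) * (1 / sqrt (pi / 2)) * (G / R powr (real n + 1 / 2))"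
      by (simp only: times_divide_eq_right times_divide_eq_left mult_1_right divide_divide_eq_left mult_ac)
    also have "1 / sqrt (pi / 2) = sqrt (2 * pi) / pi"
    proof -
      have "x / y * s = 1 \<Longrightarrow> s \<noteq> 0 \<Longrightarrow> 1 / s = x / y" for x y s :: real
        by (metis nonzero_eq_divide_eq)
      from this[OF sq] show ?thesis by simp
    qed
    also have "(-1) ^ n * (l + 1) ^ (2 * n + 1) * (sqrt (2 * pi) / pi) * (G / R powr (real n + 1 / 2)) =
        P * (G / R powr (real n + 1 / 2))"
      by (simp only: P_def times_divide_eq_right)
    finally show ?thesis .
  qed
  have "P * J = P * (G / R powr (real n + 1 / 2)) * (S + A)"
    using b_neg_eq_ray_integral[OF l n] A
    unfolding pref unfolding P_def[symmetric] J_def[symmetric] S_def R_def[symmetric] G_def[symmetric] by simp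
  hence "J = G / R powr (real n + 1 / 2) * (S + A)" unfolding mult.assoc mult_left_cancel[OF P] .
  hence "R powr (real n + 1 / 2) / G * J = S + A" using R G by simp
  hence "A = R powr (real n + 1 / 2) / G * J - S" by simp
  also have "\<dots> = R powr (real n + 1 / 2) / G * Im (LINT x|lborel. remainder_integrand K n l x)"
    unfolding Im right_diff_distrib S ..
  finally show ?thesis by (simp only: R_def G_def)
qed

text \<open>One estimate for both bounds, the second being the case c2 = 0. The two pointwise terms
  integrate to Gamma at n - K + 1/2 and n - K - 1/2; K < n keeps both arguments positive.\<close>

lemma remainder_bound:
  assumes n: "n \<ge> 1" and K: "K < n" and c: "c1 \<ge> 0" "c2 \<ge> 0"
    and bound: "\<And>r. norm (stirling_remainder K (exp (Complex r (omega l)))) \<le>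
                  c1 * exp (- (real K * r)) + c2 * exp (- (real (K + 1) * r))"
    and A: "A = cmod (Lambda l) powr (real n + 1 / 2) / Gamma (real n + 1 / 2) *
               Im (LINT x|lborel. remainder_integrand K n l x)"
  shows "\<bar>A\<bar> \<le> cmod (Lambda l) ^ K * c1 * (Gamma (real n - real K + 1 / 2) / Gamma (real n + 1 / 2)) +
               cmod (Lambda l) ^ (K + 1) * c2 * (Gamma (real n - real K - 1 / 2) / Gamma (real n + 1 / 2))"
proof -
  define R where "R = cmod (Lambda l)"
  have R: "R > 0" unfolding R_def by (rule norm_Lambda_pos)
  define G where "G = Gamma (real n + 1 / 2)"
  have G: "G > 0" unfolding G_def by (intro Gamma_real_pos) simp
  define a where "a = real n - real K + 1 / 2"
  define b where "b = real n - real K - 1 / 2"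
  have a: "a > 0" and b: "b > 0" using K by (auto simp: a_def b_def)
  define f where "f = (\<lambda>x. c1 * exp (a * x - R * exp x) + c2 * exp (b * x - R * exp x))"
  have f: "integrable lborel f"
    unfolding f_def using integrable_exp_gamma_kernel[OF a R] integrable_exp_gamma_kernel[OF b R] by simp
  have If: "(LINT x|lborel. f x) = c1 * (Gamma a / R powr a) + c2 * (Gamma b / R powr b)"
    unfolding f_def Gamma_integral_exp_real[OF a R, symmetric] Gamma_integral_exp_real[OF b R, symmetric]
    using integrable_exp_gamma_kernel[OF a R] integrable_exp_gamma_kernel[OF b R] by simp
  have le: "norm (remainder_integrand K n l x) \<le> f x" for x
  proof -
    have "norm (remainder_integrand K n l x) =
        exp ((real n + 1 / 2) * x) * exp (- (R * exp x)) * norm (stirling_remainder K (exp (Complex x (omega l))))"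
      by (simp add: remainder_integrand_def norm_mult norm_exp_eq_Re R_def mult.commute)
    also have "\<dots> \<le> exp ((real n + 1 / 2) * x) * exp (- (R * exp x)) * (c1 * exp (- (real K * x)) + c2 * exp (- (real (K + 1) * x)))"
      by (intro mult_left_mono bound) simp
    also have "\<dots> = c1 * (exp ((real n + 1 / 2) * x) * exp (- (R * exp x)) * exp (- (real K * x))) +
        c2 * (exp ((real n + 1 / 2) * x) * exp (- (R * exp x)) * exp (- (real (K + 1) * x)))"
      by (simp only: distrib_left mult_ac)
    also have "\<dots> = f x"
      unfolding f_def exp_add[symmetric] a_def b_def by (simp add: algebra_simps)
    finally show ?thesis .
  qed
  have "\<bar>Im (LINT x|lborel. remainder_integrand K n l x)\<bar> \<le> norm (LINT x|lborel. remainder_integrand K n l x)"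
    by (rule abs_Im_le_cmod)
  also have "\<dots> \<le> (LINT x|lborel. norm (remainder_integrand K n l x))" by (rule integral_norm_bound)
  also have "\<dots> \<le> (LINT x|lborel. f x)"
    using integrable_remainder_integrand[of n K l] n K f le by (intro integral_mono) auto
  finally have "\<bar>Im (LINT x|lborel. remainder_integrand K n l x)\<bar> \<le> c1 * (Gamma a / R powr a) + c2 * (Gamma b / R powr b)"
    unfolding If .
  hence "R powr (real n + 1 / 2) / G * \<bar>Im (LINT x|lborel. remainder_integrand K n l x)\<bar> \<le>
      R powr (real n + 1 / 2) / G * (c1 * (Gamma a / R powr a) + c2 * (Gamma b / R powr b))"
    using G by (intro mult_left_mono) auto
  also have "\<dots> = (R powr (real n + 1 / 2) / R powr a) * c1 * (Gamma a / G) + (R powr (real n + 1 / 2) / R powr b) * c2 * (Gamma b / G)"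
    by (simp add: distrib_left mult_ac)
  also have "R powr (real n + 1 / 2) / R powr a = R ^ K"
  proof -
    have "R powr (real n + 1 / 2) / R powr a = R powr (real K)"
      unfolding powr_diff[symmetric] by (rule arg_cong[of _ _ "(powr) R"]) (simp add: a_def)
    thus ?thesis using R by (simp add: powr_realpow)
  qed
  also have "R powr (real n + 1 / 2) / R powr b = R ^ (K + 1)"
  proof -
    have "R powr (real n + 1 / 2) / R powr b = R powr (real (K + 1))"
      unfolding powr_diff[symmetric] by (rule arg_cong[of _ _ "(powr) R"]) (simp add: b_def)
    also have "\<dots> = R ^ (K + 1)" using R by (rule powr_realpow)
    finally show ?thesis .
  qed
  finally show ?thesis
    unfolding A abs_mult a_def b_def R_def[symmetric] G_def[symmetric] using G by simp
qed

section \<open>The remainder integral over t > 0\<close>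

lemma continuous_stirling_remainder:
  "continuous_on (- \<real>\<^sub>\<le>\<^sub>0) (stirling_remainder K)"
proof -
  have "z \<noteq> 0" if "z \<notin> \<real>\<^sub>\<le>\<^sub>0" for z :: complex using that by auto
  thus ?thesis
    unfolding stirling_remainder_def[abs_def]
    by (intro continuous_intros holomorphic_on_imp_continuous_on[OF Gamma_star_holomorphic]) auto
qed

lemma stirling_remainder_cnj:
  assumes "z \<notin> \<real>\<^sub>\<le>\<^sub>0"
  shows "stirling_remainder K (cnj z) = cnj (stirling_remainder K z)"
  unfolding stirling_remainder_def Gamma_star_cnj[OF assms] by simp

lemma polar_notin_nonpos_Reals:
  assumes "t > 0" "\<bar>y\<bar> < pi"
  shows "of_real t * exp (of_real y * \<i>) \<notin> \<real>\<^sub>\<le>\<^sub>0"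
proof -
  have "of_real t * exp (of_real y * \<i>) = exp (Complex (ln t) y)"
    using assms(1) by (simp add: exp_Complex_eq cis_conv_exp mult.commute)
  thus ?thesis using exp_Complex_notin_nonpos_Reals[OF assms(2)] by simp
qed

text \<open>After t = e^x the integrand is E - cnj E, because the remainder commutes with
  conjugation off the cut; its integral is therefore 2 i times an imaginary part.\<close>

lemma remainder_integral_half_line:
  fixes n K :: nat and l :: real
  assumes n: "n \<ge> 1" and K: "K \<le> n"
  defines "f \<equiv> \<lambda>t::real.
           complex_of_real (t powr (real n - 1 / 2) * exp (- t * cmod (Lambda l)))
           * (exp (of_real ((real n + 1 / 2) * omega l) * \<i>)
                * stirling_remainder K (of_real t * exp (of_real (omega l) * \<i>))
              - exp (- of_real ((real n + 1 / 2) * omega l) * \<i>)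
                * stirling_remainder K (of_real t * exp (- of_real (omega l) * \<i>)))"
  shows "set_integrable lborel {0<..} f"
    and "(LINT t:{0<..}|lborel. f t) = 2 * \<i> * of_real (Im (LINT x|lborel. remainder_integrand K n l x))"
proof -
  define \<omega> where "\<omega> = omega l"
  have \<omega>: "\<bar>\<omega>\<bar> < pi" "\<bar>- \<omega>\<bar> < pi" using omega_range[of l] by (auto simp: \<omega>_def)
  define E where "E = remainder_integrand K n l"
  have iE: "integrable lborel E" unfolding E_def by (rule integrable_remainder_integrand[OF n K])
  have cont: "continuous_on {0<..} f"
  proof -
    have A: "continuous_on {0<..} (\<lambda>t. stirling_remainder K (of_real t * exp (of_real y * \<i>)))"
      if "\<bar>y\<bar> < pi" for y
    proof (rule continuous_on_compose2[OF continuous_stirling_remainder])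
      show "continuous_on {0<..} (\<lambda>t. of_real t * exp (of_real y * \<i>))" by (intro continuous_intros)
      show "(\<lambda>t. of_real t * exp (of_real y * \<i>)) ` {0<..} \<subseteq> - \<real>\<^sub>\<le>\<^sub>0"
        using polar_notin_nonpos_Reals[OF _ that] by auto
    qed
    have B: "continuous_on {0<..} (\<lambda>t. t powr (real n - 1 / 2) * exp (- t * cmod (Lambda l)))"
      by (intro continuous_intros) auto
    show ?thesis
      unfolding f_def \<omega>_def[symmetric] of_real_minus[symmetric]
      by (intro continuous_on_mult continuous_on_diff continuous_on_const continuous_on_of_real
            A B \<omega>)
  qed
  have fE: "of_real (exp x) * f (exp x) = E x - cnj (E x)" for x
  proof -
    define z where "z = exp (Complex x \<omega>)"
    define M where "M = stirling_remainder K z"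
    have z: "of_real (exp x) * exp (of_real \<omega> * \<i>) = z"
      by (simp add: z_def exp_Complex_eq cis_conv_exp mult.commute)
    have zc: "of_real (exp x) * exp (- of_real \<omega> * \<i>) = cnj z"
      unfolding z[symmetric] by (simp add: exp_cnj)
    have Mc: "stirling_remainder K (cnj z) = cnj M"
      unfolding M_def z_def by (intro stirling_remainder_cnj exp_Complex_notin_nonpos_Reals \<omega>)
    define q where "q = exp (of_real ((real n + 1 / 2) * \<omega>) * \<i>)"
    have qc: "exp (- of_real ((real n + 1 / 2) * \<omega>) * \<i>) = cnj q"
      unfolding q_def by (simp add: exp_cnj)
    define d where "d = exp x * (exp x powr (real n - 1 / 2) * exp (- exp x * cmod (Lambda l)))"
    have "of_real (exp x) * f (exp x) = of_real d * (q * M - cnj q * cnj M)"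
      unfolding f_def \<omega>_def[symmetric] z zc M_def[symmetric] Mc qc q_def[symmetric] d_def by simp
    moreover have "E x = of_real d * (q * M)"
    proof -
      have "exp x * exp x powr (real n - 1 / 2) = exp ((real n + 1 / 2) * x)"
        by (simp add: powr_def algebra_simps flip: exp_add)
      hence d: "d = exp ((real n + 1 / 2) * x) * exp (- (exp x * cmod (Lambda l)))"
        unfolding d_def by (simp flip: mult.assoc)
      have "(of_nat n + 1 / 2) * Complex x \<omega> = of_real ((real n + 1 / 2) * x) + of_real ((real n + 1 / 2) * \<omega>) * \<i>"
        by (simp add: complex_eq_iff)
      hence "exp ((of_nat n + 1 / 2) * Complex x \<omega>) = of_real (exp ((real n + 1 / 2) * x)) * q"
        by (simp only: exp_add exp_of_real q_def)
      thus ?thesis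
        unfolding E_def remainder_integrand_def \<omega>_def[symmetric] z_def[symmetric] M_def[symmetric] d
        by (simp add: mult_ac)
    qed
    ultimately show ?thesis by (simp add: right_diff_distrib)
  qed
  have iEc: "integrable lborel (\<lambda>x. E x - cnj (E x))"
    by (intro Bochner_Integration.integrable_diff iE integrable_cnj)
  show sf: "set_integrable lborel {0<..} f"
    unfolding exp_substitution(1)[OF cont] fE by (rule iEc)
  have "(LINT t:{0<..}|lborel. f t) = (LINT x|lborel. E x - cnj (E x))"
    unfolding exp_substitution(2)[OF cont sf] fE ..
  also have "\<dots> = (LINT x|lborel. E x) - (LINT x|lborel. cnj (E x))"
    by (rule Bochner_Integration.integral_diff[OF iE integrable_cnj[OF iE]])
  also have "(LINT x|lborel. cnj (E x)) = cnj (LINT x|lborel. E x)" by (rule Bochner_Integration.integral_cnj)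
  also have "(LINT x|lborel. E x) - cnj (LINT x|lborel. E x) = 2 * \<i> * of_real (Im (LINT x|lborel. E x))"
    by (rule complex_eqI) auto
  finally show "(LINT t:{0<..}|lborel. f t) = 2 * \<i> * of_real (Im (LINT x|lborel. remainder_integrand K n l x))"
    by (simp only: E_def)
qed

theorem mainTheorem5:
  fixes l A :: real and n K :: nat
  assumes "0 < l" and "2 \<le> n" and "1 \<le> K" and "K \<le> n - 1"
    and A_def: "b_neg n l =
      (-1) ^ n * Gamma (real n + 1 / 2) * (l + 1) ^ (2 * n + 1)
        / ((pi / 2 * cmod (Lambda l)) powr (1 / 2) * cmod (Lambda l) ^ n)
      * ((\<Sum>k<K. (-1) ^ k * cmod (Lambda l) ^ k * stirling_coeff k
             * (Gamma (real n - real k + 1 / 2) / Gamma (real n + 1 / 2))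
             * sin ((real n - real k + 1 / 2) * omega l)) + A)"
  shows
    "(let f = (\<lambda>t::real.
           complex_of_real (t powr (real n - 1 / 2) * exp (- t * cmod (Lambda l)))
           * (exp (of_real ((real n + 1 / 2) * omega l) * \<i>)
                * stirling_remainder K (of_real t * exp (of_real (omega l) * \<i>))
              - exp (- of_real ((real n + 1 / 2) * omega l) * \<i>)
                * stirling_remainder K (of_real t * exp (- of_real (omega l) * \<i>))))
     in set_integrable lborel {0<..} f \<and>
        complex_of_real A =
          complex_of_real (cmod (Lambda l) powr (real n + 1 / 2))
            / (2 * \<i> * complex_of_real (Gamma (real n + 1 / 2)))
          * (LINT t:{0<..}|lborel. f t)) \<and>
    (Lambert_W (exp (pi - 1)) \<le> l \<longrightarrow>
      \<bar>A\<bar> \<le> cmod (Lambda l) ^ K * \<bar>stirling_coeff K\<bar>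
               * (Gamma (real n - real K + 1 / 2) / Gamma (real n + 1 / 2))
           + cmod (Lambda l) ^ (K + 1) * \<bar>stirling_coeff (K + 1)\<bar>
               * (Gamma (real n - real K - 1 / 2) / Gamma (real n + 1 / 2))) \<and>
    (2 \<le> K \<longrightarrow>
      (\<exists>!p. is_phi_star K (omega l) p) \<and>
      \<bar>A\<bar> \<le> 1 / 2 * (1 / cos (omega l - phi_star K (omega l)) / cos (phi_star K (omega l)) ^ K + 1)
             * cmod (Lambda l) ^ K * (1 / pi)
             * (zeta (real K) * Gamma (real K) / (2 * pi) ^ K)
             * (Gamma (real n - real K + 1 / 2) / Gamma (real n + 1 / 2)))"

proof -
  have n: "n \<ge> 1" and K: "K < n" "K \<le> n" using assms(2-4) by auto
  have \<omega>: "0 < omega l" "omega l < pi" by (rule omega_range)+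
  define I where "I = (LINT x|lborel. remainder_integrand K n l x)"
  have A: "A = cmod (Lambda l) powr (real n + 1 / 2) / Gamma (real n + 1 / 2) * Im I"
    unfolding I_def by (rule b_neg_remainder[OF \<open>0 < l\<close> n K(2) A_def])
  define f where "f = (\<lambda>t::real.
           complex_of_real (t powr (real n - 1 / 2) * exp (- t * cmod (Lambda l)))
           * (exp (of_real ((real n + 1 / 2) * omega l) * \<i>)
                * stirling_remainder K (of_real t * exp (of_real (omega l) * \<i>))
              - exp (- of_real ((real n + 1 / 2) * omega l) * \<i>)
                * stirling_remainder K (of_real t * exp (- of_real (omega l) * \<i>))))"
  have f: "set_integrable lborel {0<..} f" "(LINT t:{0<..}|lborel. f t) = 2 * \<i> * of_real (Im I)"
    unfolding f_def I_def by (rule remainder_integral_half_line[OF n K(2)])+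
  have A_eq: "complex_of_real A =
          complex_of_real (cmod (Lambda l) powr (real n + 1 / 2))
            / (2 * \<i> * complex_of_real (Gamma (real n + 1 / 2)))
          * (LINT t:{0<..}|lborel. f t)"
    unfolding f(2) A by simp
  have bound1: "\<bar>A\<bar> \<le> cmod (Lambda l) ^ K * \<bar>stirling_coeff K\<bar>
               * (Gamma (real n - real K + 1 / 2) / Gamma (real n + 1 / 2))
           + cmod (Lambda l) ^ (K + 1) * \<bar>stirling_coeff (K + 1)\<bar>
               * (Gamma (real n - real K - 1 / 2) / Gamma (real n + 1 / 2))"
    if "Lambert_W (exp (pi - 1)) \<le> l"
  proof (rule remainder_bound[OF n K(1) _ _ _ A[unfolded I_def]])
    show "norm (stirling_remainder K (exp (Complex r (omega l)))) \<le>
        \<bar>stirling_coeff K\<bar> * exp (- (real K * r)) + \<bar>stirling_coeff (K + 1)\<bar> * exp (- (real (K + 1) * r))" for r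
      using \<omega> omega_le_pi_4[OF \<open>0 < l\<close> that] \<open>1 \<le> K\<close>
      by (intro stirling_remainder_bound_two_terms) auto
  qed auto
  have bound2: "\<bar>A\<bar> \<le> 1 / 2 * (1 / cos (omega l - phi_star K (omega l)) / cos (phi_star K (omega l)) ^ K + 1)
             * cmod (Lambda l) ^ K * (1 / pi)
             * (zeta (real K) * Gamma (real K) / (2 * pi) ^ K)
             * (Gamma (real n - real K + 1 / 2) / Gamma (real n + 1 / 2))" if K2: "2 \<le> K"
  proof -
    define \<phi> where "\<phi> = phi_star K (omega l)"
    have \<phi>: "0 \<le> \<phi>" "\<phi> < pi / 2" "omega l < pi / 2 + \<phi>"
      unfolding \<phi>_def by (rule phi_star_range[OF \<omega> K2])+
    \<comment> \<open>The remainder bound carries 1 / (2 pi), which becomes the factor (1/2) (1/pi)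
      of the statement.\<close>
    define c where "c = (1 / cos (omega l - \<phi>) / cos \<phi> ^ K + 1) * (zeta (real K) * Gamma (real K) / (2 * pi) ^ K) / (2 * pi)"
    have b: "norm (stirling_remainder K (exp (Complex r (omega l)))) \<le>
        c * exp (- (real K * r)) + 0 * exp (- (real (K + 1) * r))" for r
      using stirling_remainder_bound_zeta[OF \<phi>(1,2) less_imp_le[OF \<omega>(1)] \<phi>(3) K2, of r]
      by (simp add: c_def)
    \<comment> \<open>Nonnegativity of c follows from the bound itself at r = 0, without a look at
      the signs of its factors.\<close>
    have "norm (stirling_remainder K (exp (Complex 0 (omega l)))) \<le> c" using b[of 0] by simp
    hence c: "c \<ge> 0" using norm_ge_zero order_trans by blast
    have "\<bar>A\<bar> \<le> cmod (Lambda l) ^ K * c * (Gamma (real n - real K + 1 / 2) / Gamma (real n + 1 / 2)) +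
        cmod (Lambda l) ^ (K + 1) * 0 * (Gamma (real n - real K - 1 / 2) / Gamma (real n + 1 / 2))"
      by (rule remainder_bound[OF n K(1) c order_refl b A[unfolded I_def]])
    thus ?thesis unfolding \<phi>_def[symmetric] by (simp add: c_def mult_ac)
  qed
  show ?thesis
    unfolding Let_def f_def[symmetric]
    using f(1) A_eq bound1 bound2 ex1_phi_star[OF \<omega>] by blast
qed

end
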